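(* Let $\psi_2 = \sup_{0\le x\le 1} \frac{1+x+x^3}{1+x^2+x^4} = 1.239\ldots$. Let $\mathcal{R}$ and $\mathcal{A}$ be the sets of vertices of a right triangle and of an acute triangle, respectively. Then, as $n\to\infty$, $$\chi(\mathbb{R}^n,\mathcal{R}) \ge (1.1133\ldots+o(1))^n \quad\text{and}\quad \chi(\mathbb{R}^n,\mathcal{A}) \ge (1.0742\ldots+o(1))^n,$$ where $1.1133\ldots=\psi_2^{1/2}$ and $1.0742\ldots=\psi_2^{1/3}$.
   Context: For a set $\mathcal{M}\subset\mathbb{R}^d$, the chromatic number $\chi(\mathbb{R}^n,\mathcal{M})$ is the smallest $r$ such that there exists a coloring of the points of the Euclidean space $\mathbb{R}^n$ with $r$ colors and with no monochromatic isometric copy of $\mathcal{M}$ (a copy is a subset of $\mathbb{R}^n$ isometric to $\mathcal{M}$ in the Euclidean metric). The triangles are arbitrary fixed (right, respectively acute) triangles, and the $o(1)$ terms are with respect to $n\to\infty$. *)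

theory Defs
  imports "HOL-Analysis.Analysis" "HOL-Library.Extended_Nat" "HOL-Library.Landau_Symbols"
begin

text \<open>
  The dimension \<open>n\<close> varies inside the statement, so the points of \<open>\<real>\<^sup>n\<close> are the elements of
  \<^term>\<open>topspace (Euclidean_space n)\<close>, i.e. the real sequences vanishing from index \<open>n\<close> on.
\<close>

definition euclid_dist :: "nat \<Rightarrow> (nat \<Rightarrow> real) \<Rightarrow> (nat \<Rightarrow> real) \<Rightarrow> real" where
  "euclid_dist n x y = L2_set (\<lambda>i. x i - y i) {..<n}"

definition isometric_copy :: "nat \<Rightarrow> 'a::euclidean_space set \<Rightarrow> (nat \<Rightarrow> real) set \<Rightarrow> bool" where
  "isometric_copy n M S \<longleftrightarrow>
     S \<subseteq> topspace (Euclidean_space n) \<and>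
     (\<exists>f. bij_betw f M S \<and> (\<forall>x\<in>M. \<forall>y\<in>M. euclid_dist n (f x) (f y) = dist x y))"

definition monochromatic :: "('p \<Rightarrow> nat) \<Rightarrow> 'p set \<Rightarrow> bool" where
  "monochromatic col S \<longleftrightarrow> (\<exists>c. \<forall>x\<in>S. col x = c)"

definition colorable :: "nat \<Rightarrow> 'a::euclidean_space set \<Rightarrow> nat \<Rightarrow> bool" where
  "colorable n M r \<longleftrightarrow>
     (\<exists>col. (\<forall>x\<in>topspace (Euclidean_space n). col x < r) \<and>
            (\<forall>S. isometric_copy n M S \<longrightarrow> \<not> monochromatic col S))"

text \<open>
  The value is \<open>\<infinity>\<close> if there is no suitable coloring with finitely many colors; otherwise the
  infimum is attained, because the order on \<^typ>\<open>enat\<close> is a well-order.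
\<close>

definition chromatic_number :: "nat \<Rightarrow> 'a::euclidean_space set \<Rightarrow> enat" where
  "chromatic_number n M = (INF r\<in>{r. colorable n M r}. enat r)"

text \<open>The angle at the vertex \<open>b\<close>; only used for \<open>a \<noteq> b\<close> and \<open>c \<noteq> b\<close>.\<close>

definition angle :: "'a::euclidean_space \<Rightarrow> 'a \<Rightarrow> 'a \<Rightarrow> real" where
  "angle a b c = arccos (((a - b) \<bullet> (c - b)) / (norm (a - b) * norm (c - b)))"

definition right_triangle :: "'a::euclidean_space set \<Rightarrow> bool" where
  "right_triangle T \<longleftrightarrow>
     (\<exists>a b c. T = {a, b, c} \<and> \<not> collinear {a, b, c} \<and> angle a b c = pi / 2)"

definition acute_triangle :: "'a::euclidean_space set \<Rightarrow> bool" where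
  "acute_triangle T \<longleftrightarrow>
     (\<exists>a b c. T = {a, b, c} \<and> \<not> collinear {a, b, c} \<and>
        angle b a c < pi / 2 \<and> angle a b c < pi / 2 \<and> angle a c b < pi / 2)"

definition psi2 :: real where
  "psi2 = (SUP x\<in>{0..1}. (1 + x + x ^ 3) / (1 + x\<^sup>2 + x ^ 4))"

end

theory Submission
  imports Defs "HOL-Complex_Analysis.Complex_Analysis" "HOL-Number_Theory.Prime_Powers"
    "HOL-Real_Asymp.Real_Asymp"
begin

text \<open>
  Let \<open>V\<close> be a finite set of points in dimension \<open>m\<close> in which every subset of density more than \<open>\<beta>\<close>
  contains two points at a fixed distance. Color the product of \<open>k\<close> copies of \<open>V\<close>, living in dimension
  \<open>k m\<close>, with fewer than \<open>1 / (k \<beta>)\<close> colors, and take a color class of density more than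
  \<open>k \<beta>\<close>. On every line of the product, the points of the class without a neighbour of the class on that
  line form an independent set. So these points have density at most \<open>\<beta>\<close> for each direction, and some
  point \<open>x\<close> of the class has a neighbour in the class in each of the \<open>k\<close> directions
  (\<open>corner_exists\<close>). This is an orthogonal corner with apex \<open>x\<close>, and its legs can be given arbitrary lengths
  by scaling the factors. For \<open>k = 2\<close> a corner is a right triangle. For \<open>k = 3\<close> the end points of the three
  legs can form any acute triangle. Hence \<open>\<chi>(\<real>\<^sup>n, M)\<close> is at least of order
  \<open>1 / \<beta>\<close> with \<open>m = n / k\<close>, which explains the exponents \<open>1/2\<close> and \<open>1/3\<close>.

  It remains to find \<open>V\<close> with \<open>\<beta> = (psi2 + o(1)) ^ (-m)\<close>, which is Raigorodskii's theorem. Take the vectors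
  with \<open>a\<close> entries \<open>1\<close>, \<open>b\<close> entries \<open>-1\<close> and \<open>0\<close> elsewhere. Half their squared distances are integers in
  \<open>[0, D]\<close> with \<open>D = a + 3 b\<close>. For a prime \<open>p > D / 2\<close>, a subset that avoids the distance \<open>sqrt (2 p)\<close> has
  only nonzero residues modulo \<open>p\<close> off the diagonal, and the polynomial method bounds its size by the number of
  reduced monomials of degree less than \<open>p\<close>, at most \<open>(1 + x\<^sup>2 + x ^ 4) ^ m / x ^ (2 p - 2)\<close> for
  \<open>0 < x \<le> 1\<close> (\<open>independent_vectors_of_type_card_le\<close>, \<open>card_exponents_le\<close>). On the other hand
  \<open>(1 + x + x ^ 3) ^ m\<close> is a sum over the types \<open>(a, b)\<close> of the number of vectors of the type times \<open>x ^ D\<close>, so that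
  some type has at least \<open>(1 + x + x ^ 3) ^ m / x ^ D\<close> vectors up to a polynomial factor
  (\<open>large_vectors_of_type_exists\<close>). The quotient of the two bounds is the \<open>m\<close>-th power of the ratio in the definition of
  \<^const>\<open>psi2\<close>, provided that \<open>2 p\<close> exceeds \<open>D\<close> by at most \<open>o(m)\<close>.

  The existence of such primes is a consequence of the prime number theorem. It is proved here with Newman's
  Tauberian theorem (\<open>newman_tauberian\<close>), applied to \<open>\<Sum> (psi n - n) / n\<^sup>2\<close> with Chebyshev's function
  \<open>psi\<close>, after showing that the zeta function has no zeros with real part at least \<open>1\<close>
  (\<open>szeta_nonzero\<close>). Convergence of this series already yields primes in \<open>(n, (1 + \<delta>) n]\<close> for all large
  \<open>n\<close> (\<open>eventually_prime_in_short_interval\<close>).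
\<close>

section \<open>The zeta function without its pole\<close>

text \<open>
  Local uniform majorants make the partial sums converge locally uniformly, and locally uniform
  limits of holomorphic functions are holomorphic.
\<close>
lemma holomorphic_suminf:
  fixes f :: "nat \<Rightarrow> complex \<Rightarrow> complex"
  assumes S: "open S" and hol: "\<And>n. f n holomorphic_on S"
    and bnd: "\<And>z. z \<in> S \<Longrightarrow> \<exists>d>0. \<exists>M. summable M \<and> (\<forall>n. \<forall>w\<in>ball z d \<inter> S. norm (f n w) \<le> M n)"
  shows "(\<lambda>z. \<Sum>n. f n z) holomorphic_on S"
proof (rule holomorphic_uniform_sequence[where f = "\<lambda>n z. \<Sum>i<n. f i z"])
  show "open S" by fact
  show "(\<lambda>z. \<Sum>i<n. f i z) holomorphic_on S" for n
    by (intro holomorphic_intros hol)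
next
  fix z assume "z \<in> S"
  then obtain d M where d: "d > 0" "summable M" "\<And>n w. w \<in> ball z d \<inter> S \<Longrightarrow> norm (f n w) \<le> M n"
    using bnd by meson
  obtain e where e: "e > 0" "cball z e \<subseteq> S"
    using S \<open>z \<in> S\<close> open_contains_cball by blast
  define r where "r = min (d/2) e"
  have r: "r > 0" "cball z r \<subseteq> S" "cball z r \<subseteq> ball z d"
    using d e by (auto simp: r_def)
  have "uniform_limit (cball z r) (\<lambda>n z. \<Sum>i<n. f i z) (\<lambda>z. \<Sum>n. f n z) sequentially"
    using d(2) r by (intro Weierstrass_m_test[of _ _ M] d(3)) auto
  thus "\<exists>d>0. cball z d \<subseteq> S \<and> uniform_limit (cball z d) (\<lambda>n z. \<Sum>i<n. f i z) (\<lambda>z. \<Sum>n. f n z) sequentially"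
    using r by blast
qed

lemma norm_powr_shift_diff_le:
  assumes a: "a > 0" and u: "0 \<le> u" "u \<le> 1" and s: "Re s \<ge> -1"
  shows "norm (complex_of_real (a + u) powr (-s) - of_real a powr (-s)) \<le> norm s * a powr (-Re s - 1)"
proof -
  let ?S = "closed_segment (complex_of_real a) (of_real (a + 1))"
  have mem: "z \<in> ?S \<Longrightarrow> \<exists>x. z = of_real x \<and> a \<le> x \<and> x \<le> a + 1" for z
    unfolding closed_segment_of_real by (auto simp: closed_segment_eq_real_ivl)
  have "norm (complex_of_real (a + u) powr (-s) - of_real a powr (-s)) \<le>
        (norm s * a powr (-Re s - 1)) * norm (complex_of_real (a + u) - of_real a)"
  proof (rule field_differentiable_bound[where S = ?S and f' = "\<lambda>z. -s * z powr (-s - 1)"])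
    fix z assume z: "z \<in> ?S"
    then obtain x where x: "z = of_real x" "a \<le> x" "x \<le> a + 1" using mem by blast
    show "((\<lambda>z. z powr (-s)) has_field_derivative -s * z powr (-s - 1)) (at z within ?S)"
      using x a by (auto intro!: derivative_eq_intros simp: complex_nonpos_Reals_iff)
    have "norm (z powr (-s - 1)) = x powr (-Re s - 1)"
      using x a by (simp add: norm_powr_real_powr)
    also have "\<dots> \<le> a powr (-Re s - 1)"
      using s x a by (intro powr_mono2') auto
    finally show "norm (-s * z powr (-s - 1)) \<le> norm s * a powr (-Re s - 1)"
      by (simp add: norm_mult mult_left_mono)
  next
    have "a + u \<in> closed_segment a (a + 1)" using u by (simp add: closed_segment_eq_real_ivl)
    thus "complex_of_real (a + u) \<in> ?S" unfolding closed_segment_of_real by blast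
  qed auto
  also have "norm (complex_of_real (a + u) - of_real a) = u"
    using u by simp
  also have "norm s * a powr (-Re s - 1) * u \<le> norm s * a powr (-Re s - 1) * 1"
    using u by (intro mult_left_mono) auto
  finally show ?thesis by simp
qed

lemma norm_nat_powr: "n > 0 \<Longrightarrow> norm (complex_of_nat n powr s) = real n powr Re s"
  using norm_powr_real_powr[of "of_nat n" s] by simp

text \<open>
  The integral of \<open>(s - 1) (n powr (-s) - t powr (-s))\<close> over \<open>t \<in> {n..n+1}\<close>. Summing these terms gives
  \<open>(s - 1) \<zeta>(s) - 1\<close>; each term is of order \<open>n powr (-Re s - 1)\<close>, so the sum exists for
  \<open>Re s > 0\<close>. The factor \<open>s - 1\<close> removes the pole, so that no case distinction at \<open>s = 1\<close> is needed.
\<close>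
definition zterm :: "nat \<Rightarrow> complex \<Rightarrow> complex" where
  "zterm n s = (s - 1) * of_nat n powr (-s) + of_nat (Suc n) powr (1 - s) - of_nat n powr (1 - s)"

text \<open>
  As a function of the step length \<open>u\<close>, the expression
  \<open>(n + u) powr (1 - s) + (s - 1) u n powr (-s)\<close> has a small derivative on \<open>[0, 1]\<close>, and \<^term>\<open>zterm n s\<close>
  is its increment.
\<close>
lemma norm_zterm_le:
  assumes n: "n > 0" and s: "Re s \<ge> -1"
  shows "norm (zterm n s) \<le> norm s * norm (s - 1) * n powr (-Re s - 1)"
proof -
  let ?S = "closed_segment (0::complex) 1"
  let ?h = "\<lambda>u. (of_nat n + u) powr (1 - s) + (s - 1) * u * of_nat n powr (-s)"
  have "norm (?h 1 - ?h 0) \<le> (norm s * norm (s - 1) * n powr (-Re s - 1)) * norm (1 - 0 :: complex)"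
  proof (rule field_differentiable_bound[where S = ?S and 
          f' = "\<lambda>u. (1 - s) * (of_nat n + u) powr (-s) + (s - 1) * of_nat n powr (-s)"])
    fix z assume z: "z \<in> ?S"
    then obtain x where x: "z = of_real x" "0 \<le> x" "x \<le> 1"
      unfolding closed_segment_def by (auto simp: scaleR_conv_of_real)
    have nz: "of_nat n + z = of_real (real n + x)" using x by simp
    show "(?h has_field_derivative (1 - s) * (of_nat n + z) powr (-s) + (s - 1) * of_nat n powr (-s)) (at z within ?S)"
      using x n nz by (auto intro!: derivative_eq_intros simp: complex_nonpos_Reals_iff)
    have "(1 - s) * (of_nat n + z) powr (-s) + (s - 1) * of_nat n powr (-s) = 
          (1 - s) * (of_real (real n + x) powr (-s) - of_real (real n) powr (-s))"
      using nz by (simp add: algebra_simps)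
    also have "norm \<dots> \<le> norm (1 - s) * (norm s * n powr (-Re s - 1))"
      unfolding norm_mult using n s x by (intro mult_left_mono norm_powr_shift_diff_le) auto
    finally show "norm ((1 - s) * (of_nat n + z) powr (-s) + (s - 1) * of_nat n powr (-s)) \<le> norm s * norm (s - 1) * n powr (-Re s - 1)"
      by (simp add: norm_minus_commute mult_ac)
  qed auto
  also have "?h 1 - ?h 0 = zterm n s"
    using n by (simp add: zterm_def algebra_simps)
  finally show ?thesis by simp
qed

lemma holomorphic_zterm: "n > 0 \<Longrightarrow> zterm n holomorphic_on A"
  unfolding zterm_def by (intro holomorphic_intros) auto

lemma summable_Suc_powr: "x > 1 \<Longrightarrow> summable (\<lambda>n. real (Suc n) powr (-x))"
  using summable_real_powr_iff[of "-x"] by (subst summable_Suc_iff) auto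

text \<open>
  The coefficients \<open>c\<close> are \<open>1\<close> for the zeta function itself, and the error of Chebyshev's
  function when its Dirichlet series is summed by parts.
\<close>
lemma holomorphic_zterm_series:
  fixes c :: "nat \<Rightarrow> complex"
  assumes c: "\<And>n. n > 0 \<Longrightarrow> norm (c n) \<le> C * real n powr \<beta>" and "\<beta> \<ge> 0"
  shows "(\<lambda>s. \<Sum>n. c (Suc n) * zterm (Suc n) s) holomorphic_on {s. Re s > \<beta>}"
    and "Re s > \<beta> \<Longrightarrow> summable (\<lambda>n. norm (c (Suc n) * zterm (Suc n) s))"
proof -
  have C: "C \<ge> 0" using order_trans[OF norm_ge_zero c[of 1]] by simp
  have bound: "norm (c (Suc n) * zterm (Suc n) w) \<le> C * (K * (K + 1)) * real (Suc n) powr (- (1 + (x - \<beta>)))"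
    if "Re w \<ge> x" "x > \<beta>" "norm w \<le> K" for w K x n
  proof -
    have K: "K \<ge> 0" using that(3) norm_ge_zero[of w] by linarith
    have "norm (c (Suc n) * zterm (Suc n) w) \<le> (C * real (Suc n) powr \<beta>) * (norm w * norm (w - 1) * real (Suc n) powr (-Re w - 1))"
      unfolding norm_mult[of "c _"] using C that \<open>\<beta> \<ge> 0\<close>
      by (intro mult_mono c norm_zterm_le) auto
    also have "\<dots> \<le> (C * real (Suc n) powr \<beta>) * ((K * (K + 1)) * real (Suc n) powr (-x - 1))"
      using that C K norm_triangle_ineq4[of w 1] 
      by (intro mult_mono mult_nonneg_nonneg powr_mono) (auto intro: order_trans[OF norm_ge_zero])
    also have "\<dots> = C * (K * (K + 1)) * (real (Suc n) powr \<beta> * real (Suc n) powr (-x - 1))" by (simp add: mult_ac)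
    also have "real (Suc n) powr \<beta> * real (Suc n) powr (-x - 1) = real (Suc n) powr (- (1 + (x - \<beta>)))"
      by (subst powr_add [symmetric]) (simp add: algebra_simps)
    finally show ?thesis .
  qed
  show "(\<lambda>s. \<Sum>n. c (Suc n) * zterm (Suc n) s) holomorphic_on {s. Re s > \<beta>}"
  proof (rule holomorphic_suminf)
    show "open {s. Re s > \<beta>}" by (simp add: open_halfspace_Re_gt)
    show "(\<lambda>s. c (Suc n) * zterm (Suc n) s) holomorphic_on {s. Re s > \<beta>}" for n
      by (intro holomorphic_intros holomorphic_zterm) auto
    fix z assume z: "z \<in> {s. Re s > \<beta>}"
    define d where "d = (Re z - \<beta>) / 2"
    have d: "d > 0" using z by (simp add: d_def)
    have "summable (\<lambda>n. C * ((norm z + d) * (norm z + d + 1)) * real (Suc n) powr (- (1 + d)))"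
      using d by (intro summable_mult summable_Suc_powr) auto
    moreover have "norm (c (Suc n) * zterm (Suc n) w) \<le> C * ((norm z + d) * (norm z + d + 1)) * real (Suc n) powr (- (1 + d))"
      if "w \<in> ball z d" for n w
    proof -
      have "\<bar>Re z - Re w\<bar> \<le> norm (z - w)" using abs_Re_le_cmod[of "z - w"] by simp
      moreover have "norm (z - w) < d" using that by (simp add: dist_norm)
      moreover have "norm w \<le> norm z + norm (z - w)"
        by (metis norm_minus_commute norm_triangle_sub)
      ultimately show ?thesis
        using bound[of "\<beta> + d" w "norm z + d" n] d by (simp add: d_def field_simps)
    qed
    ultimately show "\<exists>d>0. \<exists>M. summable M \<and> (\<forall>n. \<forall>w\<in>ball z d \<inter> {s. Re s > \<beta>}. norm (c (Suc n) * zterm (Suc n) w) \<le> M n)"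
      using d by blast
  qed
  show "summable (\<lambda>n. norm (c (Suc n) * zterm (Suc n) s))" if "Re s > \<beta>"
  proof (rule summable_comparison_test')
    show "summable (\<lambda>n. C * (norm s * (norm s + 1)) * real (Suc n) powr (- (1 + (Re s - \<beta>))))"
      using that by (intro summable_mult summable_Suc_powr) auto
  qed (use bound[of "Re s" s "norm s"] that in auto)
qed

section \<open>Zeros of the zeta function\<close>

text \<open>
  This is \<open>(s - 1) \<zeta>(s)\<close>, continued to the half-plane \<open>Re s > 0\<close>.
\<close>
definition szeta :: "complex \<Rightarrow> complex" where
  "szeta s = 1 + (\<Sum>n. zterm (Suc n) s)"

abbreviation zeta_series :: "complex \<Rightarrow> complex" where
  "zeta_series s \<equiv> (\<Sum>n. of_nat (Suc n) powr (-s))"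

text \<open>
  This is \<open>- \<zeta>'(s) / \<zeta>(s)\<close>; it is only used for \<open>Re s > 1\<close>, where the series converges.
\<close>
definition mangoldt_series :: "complex \<Rightarrow> complex" where
  "mangoldt_series s = (\<Sum>n. mangoldt (Suc n) * of_nat (Suc n) powr (-s))"

lemma szeta_holomorphic: "szeta holomorphic_on {s. Re s > 0}"
  using holomorphic_zterm_series(1)[of "\<lambda>_. 1" 1 0]
  unfolding szeta_def by (auto intro!: holomorphic_intros)

lemma zterm_1: "n > 0 \<Longrightarrow> zterm n 1 = 0"
  by (simp add: zterm_def del: of_nat_Suc)

lemma szeta_1: "szeta 1 = 1"
  unfolding szeta_def by (simp add: zterm_1)

lemma zeta_series_abs_summable: "Re s > 1 \<Longrightarrow> summable (\<lambda>n. norm (complex_of_nat (Suc n) powr (-s)))"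
  using summable_Suc_powr[of "Re s"] by (simp add: norm_nat_powr del: of_nat_Suc)

lemma szeta_eq:
  assumes s: "Re s > 1"
  shows "szeta s = (s - 1) * zeta_series s"
proof -
  have "(\<lambda>n. of_nat (Suc n) powr (-s)) sums zeta_series s"
    using summable_norm_cancel[OF zeta_series_abs_summable[OF s]] by (rule summable_sums)
  hence 1: "(\<lambda>n. (s - 1) * of_nat (Suc n) powr (-s)) sums ((s - 1) * zeta_series s)"
    by (rule sums_mult)
  have "(\<lambda>n. complex_of_nat n powr (1 - s)) \<longlonglongrightarrow> 0"
  proof (rule tendsto_norm_zero_cancel, rule Lim_transform_eventually)
    show "(\<lambda>n. real n powr (1 - Re s)) \<longlonglongrightarrow> 0"
      using s by (intro tendsto_neg_powr filterlim_real_sequentially) auto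
    show "\<forall>\<^sub>F n in sequentially. real n powr (1 - Re s) = norm (complex_of_nat n powr (1 - s))"
      using eventually_gt_at_top[of 0] by eventually_elim (simp add: norm_nat_powr)
  qed
  hence "(\<lambda>n. complex_of_nat (Suc n) powr (1 - s)) \<longlonglongrightarrow> 0" by (rule LIMSEQ_Suc)
  from telescope_sums[OF this] have 2: "(\<lambda>n. of_nat (Suc (Suc n)) powr (1 - s) - of_nat (Suc n) powr (1 - s)) sums (0 - 1)"
    by simp
  have "(\<lambda>n. zterm (Suc n) s) sums ((s - 1) * zeta_series s + (0 - 1))"
    using sums_add[OF 1 2] by (simp add: zterm_def algebra_simps)
  thus ?thesis unfolding szeta_def by (simp add: sums_iff)
qed

lemma mangoldt_le_powr:
  assumes "e > 0" "n > 0"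
  shows "mangoldt n \<le> real n powr e / e"
  using mangoldt_le[of n] ln_powr_bound[of "real n" e] assms by simp

lemma mangoldt_series_abs_summable:
  assumes "Re s > 1"
  shows "summable (\<lambda>n. norm (mangoldt (Suc n) * complex_of_nat (Suc n) powr (-s)))"
proof -
  define e where "e = (Re s - 1) / 2"
  have e: "e > 0" using assms by (simp add: e_def)
  show ?thesis
  proof (rule summable_comparison_test')
    show "summable (\<lambda>n. 1 / e * real (Suc n) powr (- (1 + e)))"
      using e by (intro summable_mult summable_Suc_powr) auto
    fix n
    have "norm (norm (mangoldt (Suc n) * complex_of_nat (Suc n) powr (-s))) = mangoldt (Suc n) * real (Suc n) powr (-Re s)"
      by (simp add: norm_mult norm_nat_powr mangoldt_nonneg del: of_nat_Suc)
    also have "\<dots> \<le> (real (Suc n) powr e / e) * real (Suc n) powr (-Re s)"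
      using e by (intro mult_right_mono mangoldt_le_powr) auto
    also have "\<dots> = 1 / e * (real (Suc n) powr e * real (Suc n) powr (-Re s))" by simp
    also have "real (Suc n) powr e * real (Suc n) powr (-Re s) = real (Suc n) powr (- (1 + e))"
      unfolding powr_add [symmetric] by (rule arg_cong[where f = "\<lambda>y. real (Suc n) powr y"]) (simp add: e_def field_simps)
    finally show "norm (norm (mangoldt (Suc n) * complex_of_nat (Suc n) powr (-s))) \<le> 1 / e * real (Suc n) powr (- (1 + e))" .
  qed
qed

lemma has_sum_product:
  fixes f :: "'a \<Rightarrow> complex" and g :: "'b \<Rightarrow> complex"
  assumes f: "(\<lambda>a. norm (f a)) summable_on A" "(f has_sum x) A" and g: "(\<lambda>a. norm (g a)) summable_on B" "(g has_sum y) B"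
  shows "((\<lambda>(a, b). f a * g b) has_sum (x * y)) (A \<times> B)"
proof -
  have "(\<lambda>z. norm ((\<lambda>(a, b). f a * g b) z)) summable_on (A \<times> B)"
  proof (rule summable_on_SigmaI)
    show "((\<lambda>b. norm ((\<lambda>(a, b). f a * g b) (a, b))) has_sum (norm (f a) * infsum (\<lambda>b. norm (g b)) B)) B" for a
      using g(1) by (auto simp: norm_mult intro!: has_sum_cmult_right has_sum_infsum)
    show "(\<lambda>a. norm (f a) * infsum (\<lambda>b. norm (g b)) B) summable_on A"
      using f(1) by (rule summable_on_cmult_left)
  qed auto
  hence "(\<lambda>(a, b). f a * g b) summable_on (A \<times> B)" by (rule abs_summable_summable)
  then obtain S where S: "((\<lambda>(a, b). f a * g b) has_sum S) (A \<times> B)" by (auto simp: summable_on_def)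
  have "((\<lambda>a. f a * y) has_sum S) A"
    by (rule has_sum_SigmaD[OF S]) (auto intro!: has_sum_cmult_right g)
  moreover have "((\<lambda>a. f a * y) has_sum (x * y)) A"
    by (intro has_sum_cmult_left f)
  ultimately show ?thesis using S has_sum_unique by metis
qed

lemma has_sum_pos_nat:
  fixes f :: "nat \<Rightarrow> complex"
  assumes "summable (\<lambda>n. norm (f (Suc n)))"
  shows "(\<lambda>a. norm (f a)) summable_on {0<..}" "(f has_sum (\<Sum>n. f (Suc n))) {0<..}"
proof -
  have bij: "bij_betw Suc UNIV {0<..}" 
    by (rule bij_betwI[of _ _ _ "\<lambda>n. n - 1"]) auto
  have "(\<lambda>n. norm (f (Suc n))) summable_on UNIV"
    using assms by (intro norm_summable_imp_summable_on) auto
  thus "(\<lambda>a. norm (f a)) summable_on {0<..}"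
    by (subst summable_on_reindex_bij_betw[OF bij, symmetric])
  have "((\<lambda>n. f (Suc n)) has_sum (\<Sum>n. f (Suc n))) UNIV"
    using assms summable_norm_cancel[OF assms] by (intro norm_summable_imp_has_sum) auto
  thus "(f has_sum (\<Sum>n. f (Suc n))) {0<..}"
    by (subst has_sum_reindex_bij_betw[OF bij, symmetric])
qed

text \<open>
  Multiplying the two absolutely convergent series and collecting the pairs \<open>(d, e)\<close> with
  \<open>d e = n\<close> turns the coefficients into divisor sums of the Mangoldt function, which are \<open>ln n\<close>.
  This takes the place of the Euler product.
\<close>
lemma zeta_times_mangoldt_series:
  fixes s :: complex
  assumes s: "Re s > 1"
  shows "(\<lambda>n. ln (real (Suc n)) * of_nat (Suc n) powr (-s)) sums (mangoldt_series s * zeta_series s)"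
proof -
  define f where "f = (\<lambda>n. mangoldt n * complex_of_nat n powr (-s))"
  define g where "g = (\<lambda>n. complex_of_nat n powr (-s))"
  have "((\<lambda>(a, b). f a * g b) has_sum (mangoldt_series s * zeta_series s)) ({0<..} \<times> {0<..})"
    unfolding mangoldt_series_def
    using has_sum_product[OF has_sum_pos_nat[of f] has_sum_pos_nat[of g]] s
      mangoldt_series_abs_summable[OF s] zeta_series_abs_summable[OF s]
    unfolding f_def g_def by simp
  also have "?this \<longleftrightarrow> ((\<lambda>(n, d). f d * g (n div d)) has_sum (mangoldt_series s * zeta_series s)) (SIGMA n:{0<..}. {d. d dvd n})"
    by (rule has_sum_reindex_bij_witness[where i = "\<lambda>(n, d). (d, n div d)" and j = "\<lambda>(a, b). (a * b, a)"])
       (auto elim!: dvdE)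
  finally have *: "((\<lambda>(n, d). f d * g (n div d)) has_sum (mangoldt_series s * zeta_series s)) (SIGMA n:{0<..}. {d. d dvd n})" .
  have "((\<lambda>n. ln (real n) * complex_of_nat n powr (-s)) has_sum (mangoldt_series s * zeta_series s)) {0<..}"
  proof (rule has_sum_SigmaD[OF *])
    fix n :: nat assume n: "n \<in> {0<..}"
    have "f d * g (n div d) = mangoldt d * of_nat n powr (-s)" if d: "d dvd n" for d
    proof -
      obtain e where e: "n = d * e" using d by blast
      have "complex_of_nat (d * e) powr (-s) = of_nat d powr (-s) * of_nat e powr (-s)"
        using powr_times_real[of "of_nat d" "of_nat e" "-s"] by simp
      thus ?thesis using e n unfolding f_def g_def by (simp add: mult_ac)
    qed
    hence "(\<Sum>d | d dvd n. f d * g (n div d)) = (\<Sum>d | d dvd n. mangoldt d) * of_nat n powr (-s)"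
      unfolding sum_distrib_right by (intro sum.cong) auto
    also have "\<dots> = ln (real n) * of_nat n powr (-s)"
      using n by (subst mangoldt_sum) auto
    finally show "((\<lambda>d. (\<lambda>(n, d). f d * g (n div d)) (n, d)) has_sum ln (real n) * complex_of_nat n powr - s) {d. d dvd n}"
      using n by (intro has_sum_finiteI) auto
  qed
  moreover have bij: "bij_betw Suc UNIV {0<..}" 
    by (rule bij_betwI[of _ _ _ "\<lambda>n. n - 1"]) auto
  ultimately have "((\<lambda>n. ln (real (Suc n)) * complex_of_nat (Suc n) powr (-s)) has_sum (mangoldt_series s * zeta_series s)) UNIV"
    by (subst has_sum_reindex_bij_betw[OF bij, where f = "\<lambda>n. ln (real n) * complex_of_nat n powr (-s)"])
  thus ?thesis by (rule has_sum_imp_sums)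
qed

lemma zeta_series_has_derivative:
  assumes s: "Re s > 1"
  shows "(zeta_series has_field_derivative -(mangoldt_series s * zeta_series s)) (at s)"
proof -
  let ?S = "{s. Re s > 1}"
  have "\<exists>g g'. \<forall>x\<in>?S. (\<lambda>n. complex_of_nat (Suc n) powr (-x)) sums g x \<and>
           (\<lambda>n. - ln (real (Suc n)) * complex_of_nat (Suc n) powr (-x)) sums g' x \<and> (g has_field_derivative g' x) (at x)"
  proof (rule series_and_derivative_comparison_complex)
    show "open ?S" by (simp add: open_halfspace_Re_gt)
    show "((\<lambda>x. complex_of_nat (Suc n) powr (-x)) has_field_derivative - ln (real (Suc n)) * complex_of_nat (Suc n) powr (-x)) (at x)" for n x
    proof -
      have "((\<lambda>z. complex_of_nat (Suc n) powr z) has_field_derivative Ln (of_nat (Suc n)) * of_nat (Suc n) powr (-x)) (at (-x))"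
        by (rule has_field_derivative_powr_right) (simp del: of_nat_Suc)
      from DERIV_chain2[OF this DERIV_minus[OF DERIV_ident]] show ?thesis
        by (simp add: Ln_of_nat del: of_nat_Suc)
    qed
    fix x assume x: "x \<in> ?S"
    define d where "d = (Re x - 1) / 2"
    have d: "d > 0" using x by (simp add: d_def)
    have "cmod (complex_of_nat (Suc n) powr (-y)) \<le> cmod (of_real (real (Suc n) powr (-(1+d))))" if "y \<in> ball x d" for n y
    proof -
      have "\<bar>Re x - Re y\<bar> \<le> norm (x - y)" using abs_Re_le_cmod[of "x - y"] by simp
      hence "Re y \<ge> 1 + d" using that by (auto simp: dist_norm d_def field_simps)
      thus ?thesis by (simp add: norm_nat_powr powr_mono del: of_nat_Suc)
    qed
    moreover have "summable (\<lambda>n. complex_of_real (real (Suc n) powr (-(1+d))))"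
      using d by (intro summable_of_real summable_Suc_powr) auto
    moreover have "range (\<lambda>n. complex_of_real (real (Suc n) powr (-(1+d)))) \<subseteq> \<real>\<^sub>\<ge>\<^sub>0"
      by auto
    ultimately show "\<exists>d h. 0 < d \<and> summable h \<and> range h \<subseteq> \<real>\<^sub>\<ge>\<^sub>0 \<and>
             (\<forall>\<^sub>F n in sequentially. \<forall>y\<in>ball x d \<inter> ?S. cmod (complex_of_nat (Suc n) powr (-y)) \<le> cmod (h n))"
      using d by (intro exI[of _ d] exI[of _ "\<lambda>n. complex_of_real (real (Suc n) powr (-(1+d)))"] conjI always_eventually allI ballI) simp_all
  qed
  then obtain g g' where g: "\<And>x. Re x > 1 \<Longrightarrow> (\<lambda>n. complex_of_nat (Suc n) powr (-x)) sums g x"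
    "\<And>x. Re x > 1 \<Longrightarrow> (\<lambda>n. - ln (real (Suc n)) * complex_of_nat (Suc n) powr (-x)) sums g' x"
    "\<And>x. Re x > 1 \<Longrightarrow> (g has_field_derivative g' x) (at x)" by auto
  have "g' s = -(mangoldt_series s * zeta_series s)"
    using sums_unique2[OF g(2)[OF s]] sums_minus[OF zeta_times_mangoldt_series[OF s]] by simp
  moreover have "(zeta_series has_field_derivative g' s) (at s)"
    using g(1) sums_unique
    by (intro has_field_derivative_transform_within_open[OF g(3)[OF s] open_halfspace_Re_gt[of 1]]) (use s in auto)
  ultimately show ?thesis by simp
qed

text \<open>
  The relation \<open>\<zeta>' = - L \<zeta>\<close> with the Mangoldt series \<open>L\<close>, written without division so that zeros
  of \<open>\<zeta>\<close> do not have to be excluded beforehand.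
\<close>
lemma deriv_szeta:
  assumes s: "Re s > 1"
  shows "deriv szeta s * (s - 1) = szeta s * (1 - (s - 1) * mangoldt_series s)"
proof -
  have "((\<lambda>s. s - 1) has_field_derivative 1) (at s)"
    by (auto intro!: derivative_eq_intros)
  from DERIV_mult[OF this zeta_series_has_derivative[OF s]]
  have "(szeta has_field_derivative 
          (1 * zeta_series s + (-(mangoldt_series s * zeta_series s)) * (s - 1))) (at s)"
    by (rule has_field_derivative_transform_within_open[OF _ open_halfspace_Re_gt[of 1]])
       (use s szeta_eq in auto)
  hence "deriv szeta s = zeta_series s * (1 - (s - 1) * mangoldt_series s)"
    by (auto dest!: DERIV_imp_deriv simp: algebra_simps)
  thus ?thesis using szeta_eq[OF s] by simp
qed

text \<open>
  The classical inequality \<open>3 + 4 cos \<theta> + cos 2\<theta> = 2 (1 + cos \<theta>)\<^sup>2 \<ge> 0\<close>, applied to every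
  term of the series.
\<close>
lemma three_four_one:
  assumes \<sigma>: "\<sigma> > 1"
  shows "3 * Re (mangoldt_series (of_real \<sigma>)) + 4 * Re (mangoldt_series (Complex \<sigma> t)) +
         Re (mangoldt_series (Complex \<sigma> (2 * t))) \<ge> 0"
proof -
  define a where "a = (\<lambda>n. mangoldt (Suc n) * real (Suc n) powr (-\<sigma>))"
  have *: "(\<lambda>n. a n * cos (u * ln (real (Suc n)))) sums Re (mangoldt_series (Complex \<sigma> u))" for u
  proof -
    have "(\<lambda>n. mangoldt (Suc n) * of_nat (Suc n) powr (-Complex \<sigma> u)) sums mangoldt_series (Complex \<sigma> u)"
      unfolding mangoldt_series_def
      using summable_norm_cancel[OF mangoldt_series_abs_summable[of "Complex \<sigma> u"]] \<sigma>
      by (intro summable_sums) auto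
    from sums_Re[OF this] show ?thesis
    proof (rule sums_cong[THEN iffD1, rotated])
      fix n
      have "complex_of_nat (Suc n) powr (-Complex \<sigma> u) = exp (- Complex \<sigma> u * of_real (ln (real (Suc n))))"
        by (simp add: powr_def Ln_of_nat del: of_nat_Suc)
      hence *: "Re (complex_of_nat (Suc n) powr (-Complex \<sigma> u)) = real (Suc n) powr (-\<sigma>) * cos (u * ln (real (Suc n)))"
        by (simp add: Re_exp powr_def del: of_nat_Suc)
      have "mangoldt (Suc n) * complex_of_nat (Suc n) powr - Complex \<sigma> u = 
            of_real (mangoldt (Suc n)) * complex_of_nat (Suc n) powr - Complex \<sigma> u"
        by (simp only: of_real_mangoldt)
      thus "Re (mangoldt (Suc n) * complex_of_nat (Suc n) powr - Complex \<sigma> u) = a n * cos (u * ln (real (Suc n)))"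
        by (simp only: Re_complex_of_real Im_complex_of_real times_complex.sel * a_def)
    qed
  qed
  have "(\<lambda>n. 3 * (a n * cos (0 * ln (real (Suc n)))) + 4 * (a n * cos (t * ln (real (Suc n)))) + a n * cos (2 * t * ln (real (Suc n))))
        sums (3 * Re (mangoldt_series (Complex \<sigma> 0)) + 4 * Re (mangoldt_series (Complex \<sigma> t)) +
         Re (mangoldt_series (Complex \<sigma> (2 * t))))"
    by (intro sums_add sums_mult *)
  moreover have "0 \<le> 3 * (a n * cos (0 * ln (real (Suc n)))) + 4 * (a n * cos (t * ln (real (Suc n)))) + a n * cos (2 * t * ln (real (Suc n)))" for n
  proof -
    have "3 * (a n * cos (0 * ln (real (Suc n)))) + 4 * (a n * cos (t * ln (real (Suc n)))) + a n * cos (2 * t * ln (real (Suc n)))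
       = a n * (3 + 4 * cos (t * ln (real (Suc n))) + cos (2 * (t * ln (real (Suc n)))))"
      by (simp add: algebra_simps)
    also have "\<dots> = a n * (2 * (1 + cos (t * ln (real (Suc n))))\<^sup>2)"
      by (simp only: cos_double_cos) (simp add: power2_eq_square algebra_simps)
    also have "\<dots> \<ge> 0" unfolding a_def by (intro mult_nonneg_nonneg mangoldt_nonneg) auto
    finally show ?thesis .
  qed
  ultimately have "0 \<le> 3 * Re (mangoldt_series (Complex \<sigma> 0)) + 4 * Re (mangoldt_series (Complex \<sigma> t)) +
         Re (mangoldt_series (Complex \<sigma> (2 * t)))"
    by (rule sums_le[OF _ sums_zero, rotated])
  moreover have "Complex \<sigma> 0 = of_real \<sigma>" by (simp add: complex_eq_iff)
  ultimately show ?thesis by simp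
qed

text \<open>
  Near \<open>s\<close> one can write \<open>f w = (w - s) ^ k * g w\<close> with \<open>g s \<noteq> 0\<close>, and then
  \<open>f' / f = k / (w - s) + g' / g\<close>. Approaching \<open>s\<close> from the right along a horizontal line isolates \<open>k\<close>.
\<close>
lemma log_deriv_tendsto_order:
  assumes f: "f holomorphic_on S" "open S" "connected S" and s: "s \<in> S" and nz: "z \<in> S" "f z \<noteq> 0"
  obtains k :: nat where "k = 0 \<longleftrightarrow> f s \<noteq> 0"
    "((\<lambda>e. of_real e * (deriv f (s + of_real e) / f (s + of_real e))) \<longlongrightarrow> of_nat k) (at_right 0)"
    "\<forall>\<^sub>F e in at_right 0. f (s + of_real e) \<noteq> 0"
proof -
  obtain k :: nat and g r where k: "k = 0 \<longleftrightarrow> f s \<noteq> 0" and r: "r > 0" "g holomorphic_on ball s r" "ball s r \<subseteq> S"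
    and g: "\<And>w. w \<in> ball s r \<Longrightarrow> f w = (w - s) ^ k * g w" "\<And>w. w \<in> ball s r \<Longrightarrow> g w \<noteq> 0"
  proof (cases "f s = 0")
    case True
    have "\<not> f constant_on S"
    proof
      assume "f constant_on S"
      then obtain c where "\<And>x. x \<in> S \<Longrightarrow> f x = c" unfolding constant_on_def by blast
      with True s nz show False by simp
    qed
    then obtain g r and n :: nat where "0 < n" "0 < r" "ball s r \<subseteq> S" "g holomorphic_on ball s r"
       "\<And>w. w \<in> ball s r \<Longrightarrow> f w = (w - s) ^ n * g w"
       "\<And>w. w \<in> ball s r \<Longrightarrow> g w \<noteq> 0"
      by (rule holomorphic_factor_zero_nonconstant[OF f s True]) (rule that)
    thus ?thesis using True by (intro that[of n r g]) auto
  next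
    case False
    have "continuous (at s) f"
      using f s holomorphic_on_imp_continuous_on continuous_on_eq_continuous_at by blast
    then obtain e where e: "e > 0" "\<And>w. dist s w < e \<Longrightarrow> f w \<noteq> 0"
      using continuous_at_avoid[of s f 0] False by blast
    obtain d where d: "d > 0" "ball s d \<subseteq> S" using f s openE by blast
    show ?thesis
      using False e d by (intro that[of 0 "min e d" f] holomorphic_on_subset[OF f(1)]) auto
  qed
  have ev: "\<forall>\<^sub>F e in at_right 0. 0 < e \<and> e < r"
    using eventually_at_right_less[of 0] eventually_at_right_real[of 0 r] r by (auto elim: eventually_mono)
  have mem: "s + of_real e \<in> ball s r" if "0 < e \<and> e < r" for e using that by (simp add: dist_norm)
  have "\<forall>\<^sub>F e in at_right 0. of_nat k + of_real e * (deriv g (s + of_real e) / g (s + of_real e)) =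
       of_real e * (deriv f (s + of_real e) / f (s + of_real e))"
    using ev
  proof eventually_elim
    case (elim e)
    let ?w = "s + of_real e"
    have w: "?w \<in> ball s r" using mem elim by blast
    have "(g has_field_derivative deriv g ?w) (at ?w)"
      using r w by (intro holomorphic_derivI[of _ "ball s r"]) auto
    hence "((\<lambda>w. (w - s) ^ k * g w) has_field_derivative 
            (of_nat k * (?w - s) ^ (k - 1)) * g ?w + (?w - s) ^ k * deriv g ?w) (at ?w)"
      by (auto intro!: derivative_eq_intros)
    hence "(f has_field_derivative 
            (of_nat k * (?w - s) ^ (k - 1)) * g ?w + (?w - s) ^ k * deriv g ?w) (at ?w)"
      by (rule has_field_derivative_transform_within_open[OF _ open_ball[of s r] w]) (simp add: g(1))
    hence "deriv f ?w = (of_nat k * of_real e ^ (k - 1)) * g ?w + of_real e ^ k * deriv g ?w"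
      by (auto dest!: DERIV_imp_deriv)
    moreover have "f ?w = of_real e ^ k * g ?w" using g(1)[OF w] by simp
    ultimately show ?case
      using g(2)[OF w] elim by (cases k) (auto simp: field_simps)
  qed
  moreover have "((\<lambda>e. of_nat k + of_real e * (deriv g (s + of_real e) / g (s + of_real e))) \<longlongrightarrow> 
                   of_nat k + of_real 0 * (deriv g (s + of_real 0) / g (s + of_real 0))) (at_right 0)"
  proof -
    have cont: "isCont h s" if "h holomorphic_on ball s r" for h
      using holomorphic_on_imp_continuous_on[OF that] continuous_on_eq_continuous_at[OF open_ball, of s r h] r(1)
      by simp
    have "isCont (deriv g) s" "isCont g s"
      by (intro cont holomorphic_deriv r open_ball)+
    moreover have "((\<lambda>e. s + of_real e) \<longlongrightarrow> s + of_real 0) (at_right 0)"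
      by (intro tendsto_intros)
    ultimately show ?thesis using g(2)[of s] r
      by (intro tendsto_intros isCont_tendsto_compose[of _ "deriv g"] isCont_tendsto_compose[of _ g]) auto
  qed
  hence "((\<lambda>e. of_nat k + of_real e * (deriv g (s + of_real e) / g (s + of_real e))) \<longlongrightarrow> of_nat k) (at_right 0)"
    by simp
  ultimately have "((\<lambda>e. of_real e * (deriv f (s + of_real e) / f (s + of_real e))) \<longlongrightarrow> of_nat k) (at_right 0)"
    by (rule Lim_transform_eventually[rotated])
  moreover have "\<forall>\<^sub>F e in at_right 0. f (s + of_real e) \<noteq> 0"
    using ev by eventually_elim (use g mem in auto)
  ultimately show ?thesis by (rule that[OF k])
qed

text \<open>
  The Mangoldt series is \<open>1 / (s - 1)\<close> minus the logarithmic derivative of \<^const>\<open>szeta\<close>, so its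
  residue counts the pole at \<open>1\<close> positively and zeros negatively.
\<close>
lemma mangoldt_series_residue:
  assumes s: "Re s \<ge> 1"
  obtains k :: nat where "k = 0 \<longleftrightarrow> szeta s \<noteq> 0"
    "((\<lambda>e. of_real e * mangoldt_series (s + of_real e)) \<longlongrightarrow> (if s = 1 then 1 else 0) - of_nat k) (at_right 0)"
proof -
  have cn: "connected {s. Re s > 0}" by (intro convex_connected convex_halfspace_Re_gt)
  obtain k :: nat where k: "k = 0 \<longleftrightarrow> szeta s \<noteq> 0"
    "((\<lambda>e. of_real e * (deriv szeta (s + of_real e) / szeta (s + of_real e))) \<longlongrightarrow> of_nat k) (at_right 0)"
    "\<forall>\<^sub>F e in at_right 0. szeta (s + of_real e) \<noteq> 0"
    by (rule log_deriv_tendsto_order[OF szeta_holomorphic open_halfspace_Re_gt cn, of s 1])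
       (use s szeta_1 in auto)
  have "((\<lambda>e. of_real e / (s + of_real e - 1)) \<longlongrightarrow> (if s = 1 then 1 else 0)) (at_right 0)"
  proof (cases "s = 1")
    case True
    have "\<forall>\<^sub>F e in at_right 0. 1 = complex_of_real e / (s + of_real e - 1)"
      using eventually_at_right_less[of 0] by eventually_elim (use True in auto)
    from Lim_transform_eventually[OF tendsto_const this] True show ?thesis by simp
  next
    case False
    have "((\<lambda>e. of_real e / (s + of_real e - 1)) \<longlongrightarrow> of_real 0 / (s + of_real 0 - 1)) (at_right 0)"
      using False by (intro tendsto_intros) auto
    thus ?thesis using False by simp
  qed
  from tendsto_diff[OF this k(2)]
  have "((\<lambda>e. of_real e / (s + of_real e - 1) - of_real e * (deriv szeta (s + of_real e) / szeta (s + of_real e))) \<longlongrightarrow>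
          (if s = 1 then 1 else 0) - of_nat k) (at_right 0)" .
  moreover have "\<forall>\<^sub>F e in at_right 0. of_real e / (s + of_real e - 1) - of_real e * (deriv szeta (s + of_real e) / szeta (s + of_real e)) =
      of_real e * mangoldt_series (s + of_real e)"
    using k(3) eventually_at_right_less[of 0]
  proof eventually_elim
    case (elim e)
    let ?w = "s + of_real e"
    have w: "Re ?w > 1" using s elim by simp
    hence "?w - 1 \<noteq> 0" by (metis eq_iff_diff_eq_0 less_irrefl one_complex.sel(1))
    hence q: "deriv szeta ?w / szeta ?w = 1 / (?w - 1) - mangoldt_series ?w"
      using deriv_szeta[OF w] elim by (simp add: field_simps)
    show ?case unfolding q by (simp add: right_diff_distrib)
  qed
  ultimately have "((\<lambda>e. of_real e * mangoldt_series (s + of_real e)) \<longlongrightarrow> (if s = 1 then 1 else 0) - of_nat k) (at_right 0)"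
    by (rule Lim_transform_eventually)
  thus ?thesis by (rule that[OF k(1)])
qed

text \<open>
  To the right of the line \<open>Re s = 1\<close> the Mangoldt series is bounded near \<open>s\<close>, so its residue, minus the
  order of the zero, is \<open>0\<close>. On the line, a zero of order \<open>k1\<close> at \<open>1 + it\<close> and of order
  \<open>k2 \<ge> 0\<close> at \<open>1 + 2it\<close> would give \<open>3 - 4 k1 - k2 \<ge> 0\<close> by the inequality above, which forces \<open>k1 = 0\<close>.
\<close>
lemma szeta_nonzero:
  assumes s: "Re s \<ge> 1"
  shows "szeta s \<noteq> 0"
proof (cases "Re s > 1")
  case True
  obtain k :: nat where k: "k = 0 \<longleftrightarrow> szeta s \<noteq> 0"
    "((\<lambda>e. of_real e * mangoldt_series (s + of_real e)) \<longlongrightarrow> (if s = 1 then 1 else 0) - of_nat k) (at_right 0)"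
    by (rule mangoldt_series_residue[OF s]) (rule that)
  define B where "B = (\<Sum>n. norm (mangoldt (Suc n) * complex_of_nat (Suc n) powr (-s)))"
  have B: "norm (mangoldt_series (s + of_real e)) \<le> B" if "e > 0" for e
  proof -
    have S: "summable (\<lambda>n. norm (mangoldt (Suc n) * complex_of_nat (Suc n) powr (-(s + of_real e))))"
      using True that by (intro mangoldt_series_abs_summable) auto
    have "norm (mangoldt_series (s + of_real e)) \<le> (\<Sum>n. norm (mangoldt (Suc n) * complex_of_nat (Suc n) powr (-(s + of_real e))))"
      unfolding mangoldt_series_def by (rule summable_norm[OF S])
    also have "\<dots> \<le> B" unfolding B_def
    proof (rule suminf_le[OF _ S mangoldt_series_abs_summable[OF True]])
      fix n
      show "norm (mangoldt (Suc n) * complex_of_nat (Suc n) powr (-(s + of_real e))) \<le> norm (mangoldt (Suc n) * complex_of_nat (Suc n) powr (-s))"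
        unfolding norm_mult norm_nat_powr[OF zero_less_Suc] using that
        by (intro mult_left_mono powr_mono) (auto simp: mangoldt_nonneg)
    qed
    finally show ?thesis .
  qed
  have "((\<lambda>e. of_real e * mangoldt_series (s + of_real e)) \<longlongrightarrow> 0) (at_right 0)"
  proof (rule Lim_null_comparison)
    show "\<forall>\<^sub>F e in at_right 0. norm (of_real e * mangoldt_series (s + of_real e)) \<le> e * B"
      using eventually_at_right_less[of 0]
      by eventually_elim (simp add: norm_mult B mult_left_mono)
    show "((\<lambda>e. e * B) \<longlongrightarrow> 0) (at_right 0)" by (auto intro!: tendsto_eq_intros)
  qed
  from tendsto_unique[OF _ this k(2)] True k(1) show ?thesis by (auto split: if_splits)
next
  case False
  hence Re: "Re s = 1" using s by simp
  define t where "t = Im s"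
  show ?thesis
  proof (cases "t = 0")
    case True
    hence "s = 1" using Re by (simp add: t_def complex_eq_iff)
    thus ?thesis by (simp add: szeta_1)
  next
    case t: False
    have seq: "s = Complex 1 t" using Re by (simp add: t_def complex_eq_iff)
    let ?r = "\<lambda>s::complex. if s = 1 then 1 else 0 :: complex"
    obtain k0 :: nat where k0: "k0 = 0 \<longleftrightarrow> szeta 1 \<noteq> 0"
      "((\<lambda>e. of_real e * mangoldt_series (1 + of_real e)) \<longlongrightarrow> ?r 1 - of_nat k0) (at_right 0)"
      by (rule mangoldt_series_residue[of 1], simp, rule that, assumption, assumption)
    obtain k1 :: nat where k1: "k1 = 0 \<longleftrightarrow> szeta s \<noteq> 0"
      "((\<lambda>e. of_real e * mangoldt_series (s + of_real e)) \<longlongrightarrow> ?r s - of_nat k1) (at_right 0)"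
      by (rule mangoldt_series_residue[OF s]) (rule that)
    obtain k2 :: nat where k2: 
      "((\<lambda>e. of_real e * mangoldt_series (Complex 1 (2 * t) + of_real e)) \<longlongrightarrow> ?r (Complex 1 (2 * t)) - of_nat k2) (at_right 0)"
      by (rule mangoldt_series_residue[of "Complex 1 (2 * t)"], simp, rule that, assumption)
    have r0: "?r s = 0" "?r (Complex 1 (2 * t)) = 0" using t by (auto simp: seq complex_eq_iff)
    have "((\<lambda>e. 3 * Re (of_real e * mangoldt_series (1 + of_real e)) + 4 * Re (of_real e * mangoldt_series (s + of_real e)) +
            Re (of_real e * mangoldt_series (Complex 1 (2 * t) + of_real e))) \<longlongrightarrow> 
            3 * Re (?r 1 - of_nat k0) + 4 * Re (?r s - of_nat k1) + Re (?r (Complex 1 (2 * t)) - of_nat k2)) (at_right 0)"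
      by (intro tendsto_add tendsto_mult tendsto_const tendsto_Re k0(2) k1(2) k2)
    moreover have "\<forall>\<^sub>F e in at_right 0. 0 \<le> 3 * Re (of_real e * mangoldt_series (1 + of_real e)) + 4 * Re (of_real e * mangoldt_series (s + of_real e)) +
            Re (of_real e * mangoldt_series (Complex 1 (2 * t) + of_real e))"
      using eventually_at_right_less[of 0]
    proof eventually_elim
      case (elim e)
      have eqs: "1 + complex_of_real e = of_real (1 + e)" "s + of_real e = Complex (1 + e) t"
        "Complex 1 (2 * t) + of_real e = Complex (1 + e) (2 * t)"
        by (auto simp: seq complex_eq_iff)
      have "0 \<le> e * (3 * Re (mangoldt_series (of_real (1 + e))) + 4 * Re (mangoldt_series (Complex (1 + e) t)) +
         Re (mangoldt_series (Complex (1 + e) (2 * t))))"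
        using elim three_four_one[of "1 + e" t] by (intro mult_nonneg_nonneg) auto
      thus ?case unfolding eqs by (simp add: algebra_simps)
    qed
    ultimately have "0 \<le> 3 * Re (?r 1 - of_nat k0) + 4 * Re (?r s - of_nat k1) + Re (?r (Complex 1 (2 * t)) - of_nat k2)"
      by (intro tendsto_lowerbound[of _ _ "at_right 0"]) auto
    hence "0 \<le> 3 - 4 * real k1 - real k2"
      unfolding r0 using k0(1) szeta_1 by simp
    hence "k1 = 0" by linarith
    thus ?thesis using k1(1) by blast
  qed
qed

section \<open>Newman's Tauberian theorem\<close>

lemma norm_part_circlepath: "z \<in> path_image (part_circlepath 0 R a b) \<Longrightarrow> R \<ge> 0 \<Longrightarrow> norm z = R"
  by (auto simp: path_image_def part_circlepath_def norm_mult)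

lemma Re_right_half_circle:
  assumes "z \<in> path_image (part_circlepath 0 R (-pi/2) (pi/2))" "R > 0"
  shows "Re z \<ge> 0"
proof -
  obtain t where t: "z = part_circlepath 0 R (-pi/2) (pi/2) t" "0 \<le> t" "t \<le> 1"
    using assms(1) by (auto simp: path_image_def)
  define x where "x = linepath (-pi/2) (pi/2) t"
  have "x \<in> closed_segment (-pi/2) (pi/2)" unfolding x_def using t by (auto simp: linepath_in_path)
  hence "-pi/2 \<le> x" "x \<le> pi/2" by (auto simp: closed_segment_eq_real_ivl)
  moreover have "z = R * exp (\<i> * of_real x)" using t by (simp add: part_circlepath_def x_def)
  ultimately show ?thesis using assms(2) cos_ge_zero[of x] by (simp add: Re_exp)
qed

lemma exp_half_circle_ends:
  "exp (\<i> * of_real (-pi/2)) = -\<i>" "exp (\<i> * of_real (pi/2)) = \<i>" "exp (\<i> * of_real (3*pi/2)) = -\<i>"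
proof -
  have "cis (3*pi/2) = cis (pi/2 + pi)" by simp
  also have "\<dots> = -\<i>" by (simp only: cis_mult[symmetric]) simp
  finally show "exp (\<i> * of_real (3*pi/2)) = -\<i>" by (simp only: cis_conv_exp)
  show "exp (\<i> * of_real (-pi/2)) = -\<i>" unfolding cis_conv_exp[symmetric] by simp
  show "exp (\<i> * of_real (pi/2)) = \<i>" unfolding cis_conv_exp[symmetric] by simp
qed

text \<open>
  Subtracting the constant \<open>H 0\<close> from \<open>H\<close> leaves a removable singularity, whose integral over the closed
  contour vanishes. The remaining integral of \<open>1 / z\<close> is computed from the primitive \<open>Ln z\<close> on the right
  half circle and \<open>Ln (-z)\<close> on \<open>P\<close>, which stays off the branch cut; each contributes \<open>\<pi> \<i>\<close>. The path \<open>P\<close> is kept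
  general because the formula is used both with the left half circle and with a thin box.
\<close>
lemma cauchy_formula_half_circle:
  assumes R: "R > 0" and W: "open W" "convex W" "0 \<in> W" and H: "H holomorphic_on W"
    and A: "path_image (part_circlepath 0 R (-pi/2) (pi/2)) \<subseteq> W"
    and P: "valid_path P" "pathstart P = \<i> * of_real R" "pathfinish P = -\<i> * of_real R" "path_image P \<subseteq> W - \<real>\<^sub>\<ge>\<^sub>0"
  shows "contour_integral (part_circlepath 0 R (-pi/2) (pi/2)) (\<lambda>z. H z / z) + contour_integral P (\<lambda>z. H z / z) = 
           2 * of_real pi * \<i> * H 0"
proof -
  let ?A = "part_circlepath 0 R (-pi/2) (pi/2)"
  define q where "q = (\<lambda>z. if z = 0 then deriv H 0 else (H z - H 0) / (z - 0))"
  have q: "q holomorphic_on W" unfolding q_def by (rule pole_lemma_open[OF H W(1)])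
  have A0: "Re z \<ge> 0 \<and> z \<noteq> 0" if "z \<in> path_image ?A" for z
    using Re_right_half_circle[OF that R] norm_part_circlepath[OF that] R by auto
  have ends: "pathstart ?A = -\<i> * of_real R" "pathfinish ?A = \<i> * of_real R"
    unfolding pathstart_part_circlepath pathfinish_part_circlepath exp_half_circle_ends by simp_all
  have LnR: "Ln (\<i> * of_real R) - Ln (-\<i> * of_real R) = \<i> * of_real pi"
    using Ln_times_of_real[of R \<i>] Ln_times_of_real[of R "-\<i>"] R by (simp add: mult.commute)
  have "((\<lambda>z. 1 / z) has_contour_integral (Ln (pathfinish ?A) - Ln (pathstart ?A))) ?A"
  proof (rule contour_integral_primitive[where S = "path_image ?A"])
    fix x assume "x \<in> path_image ?A"
    hence "x \<notin> \<real>\<^sub>\<le>\<^sub>0" using A0[of x] by (auto simp: complex_nonpos_Reals_iff complex_eq_iff)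
    thus "(Ln has_field_derivative 1 / x) (at x within path_image ?A)"
      by (auto intro!: derivative_eq_intros simp: field_simps)
  qed auto
  hence iA: "((\<lambda>z. 1 / z) has_contour_integral \<i> * of_real pi) ?A"
    unfolding ends LnR .
  have "((\<lambda>z. 1 / z) has_contour_integral (Ln (-pathfinish P) - Ln (-pathstart P))) P"
  proof (rule contour_integral_primitive[where S = "path_image P" and f = "\<lambda>z. Ln (-z)"])
    fix x assume "x \<in> path_image P"
    hence "x \<notin> \<real>\<^sub>\<ge>\<^sub>0" using P by auto
    hence "- x \<notin> \<real>\<^sub>\<le>\<^sub>0" "x \<noteq> 0" by auto
    thus "((\<lambda>z. Ln (-z)) has_field_derivative 1 / x) (at x within path_image P)"
      by (auto intro!: derivative_eq_intros simp: field_simps)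
  qed (use P in auto)
  hence iP: "((\<lambda>z. 1 / z) has_contour_integral \<i> * of_real pi) P"
    unfolding P using LnR by simp
  have qA: "q contour_integrable_on ?A" "q contour_integrable_on P"
    using A P by (auto intro!: contour_integrable_holomorphic_simple[OF q W(1)])
  have "(q has_contour_integral 0) (?A +++ P)"
    using P A ends by (intro Cauchy_theorem_convex_simple[OF q W(2)] valid_path_join) 
      (auto simp: path_image_join)
  moreover have "(q has_contour_integral (contour_integral ?A q + contour_integral P q)) (?A +++ P)"
    using qA P by (intro has_contour_integral_join has_contour_integral_integral) auto
  ultimately have q0: "contour_integral ?A q + contour_integral P q = 0"
    using has_contour_integral_unique by blast
  have split: "H z / z = q z + H 0 * (1 / z)" if "z \<noteq> 0" for z
    using that by (simp add: q_def field_simps)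
  have "((\<lambda>z. q z + H 0 * (1 / z)) has_contour_integral (contour_integral ?A q + H 0 * (\<i> * of_real pi))) ?A"
    by (intro has_contour_integral_add has_contour_integral_lmul has_contour_integral_integral qA iA)
  hence "((\<lambda>z. H z / z) has_contour_integral (contour_integral ?A q + H 0 * (\<i> * of_real pi))) ?A"
    by (rule has_contour_integral_eq) (use A0 split in auto)
  moreover have "((\<lambda>z. q z + H 0 * (1 / z)) has_contour_integral (contour_integral P q + H 0 * (\<i> * of_real pi))) P"
    by (intro has_contour_integral_add has_contour_integral_lmul has_contour_integral_integral qA iP)
  hence "((\<lambda>z. H z / z) has_contour_integral (contour_integral P q + H 0 * (\<i> * of_real pi))) P"
  proof (rule has_contour_integral_eq)
    fix z assume "z \<in> path_image P"
    hence "z \<noteq> 0" using P(4) by auto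
    thus "q z + H 0 * (1 / z) = H z / z" by (rule split[symmetric])
  qed
  ultimately show ?thesis
    using q0 by (simp add: contour_integral_unique algebra_simps)
qed

lemma powr_increment:
  assumes "n > 0"
  obtains z where "real n < z" "z < real (Suc n)" "real (Suc n) powr x - real n powr x = x * z powr (x - 1)"
proof -
  have "\<exists>z>real n. z < real (Suc n) \<and>
    real (Suc n) powr x - real n powr x = (real (Suc n) - real n) * (x * z powr (x - 1))"
    by (rule MVT2, simp, rule has_real_derivative_powr) (use assms in simp)
  thus ?thesis using that by auto
qed

lemma powr_neg_le_diff:
  assumes "n > 0" "x > 0"
  shows "real (Suc n) powr (-1 - x) \<le> (real n powr (-x) - real (Suc n) powr (-x)) / x"
proof -
  obtain z where z: "real n < z" "z < real (Suc n)"
    "real (Suc n) powr (-x) - real n powr (-x) = -x * z powr (-x - 1)"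
    by (rule powr_increment[OF assms(1)])
  have e: "-x - 1 = -1 - x" by simp
  have "real (Suc n) powr (-1 - x) \<le> z powr (-1 - x)"
    using z assms by (intro powr_mono2') auto
  hence "x * real (Suc n) powr (-1 - x) \<le> x * z powr (-1 - x)"
    using assms by (intro mult_left_mono) auto
  also have "\<dots> = real n powr (-x) - real (Suc n) powr (-x)"
    using z(3) unfolding e by simp
  finally show ?thesis using assms by (simp add: pos_le_divide_eq mult.commute)
qed

lemma powr_tail_le:
  assumes "N > 0" "x > 0" "N \<le> M"
  shows "(\<Sum>n = N..<M. real (Suc n) powr (-1 - x)) \<le> real N powr (-x) / x"
proof -
  have "(\<Sum>n = N..<M. real (Suc n) powr (-1 - x)) \<le> (real N powr (-x) - real M powr (-x)) / x"
    using assms(3)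
  proof (induction M rule: dec_induct)
    case (step M)
    thus ?case using powr_neg_le_diff[of M x] assms by (auto simp: diff_divide_distrib)
  qed auto
  also have "\<dots> \<le> real N powr (-x) / x" using assms by (intro divide_right_mono) auto
  finally show ?thesis .
qed

text \<open>
  Comparison with the integral of \<open>t powr (x - 1)\<close>. This function decreases for \<open>x \<le> 1\<close> and increases for
  \<open>x > 1\<close>; in the second case the last summand is not covered by the integral and gives the term \<open>1 / N\<close>.
\<close>
lemma powr_partial_sum_le:
  assumes x: "x > 0" and N: "N > 0"
  shows "(\<Sum>n<N. real (Suc n) powr (x - 1)) \<le> real N powr x * (1 / x + 1 / real N)"
proof (cases "x \<le> 1")
  case True
  have "(\<Sum>n<N. real (Suc n) powr (x - 1)) \<le> real N powr x / x"
  proof (induction N)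
    case (Suc N)
    have "real (Suc N) powr (x - 1) \<le> (real (Suc N) powr x - real N powr x) / x"
    proof (cases "N = 0")
      case True
      thus ?thesis using x \<open>x \<le> 1\<close> by simp
    next
      case False
      then obtain z where z: "real N < z" "z < real (Suc N)"
        "real (Suc N) powr x - real N powr x = x * z powr (x - 1)"
        using powr_increment[of N x] by blast
      have "real (Suc N) powr (x - 1) \<le> z powr (x - 1)"
        using z \<open>x \<le> 1\<close> by (intro powr_mono2') auto
      thus ?thesis using z x by (simp add: field_simps)
    qed
    thus ?case using Suc by (auto simp: diff_divide_distrib)
  qed auto
  also have "\<dots> \<le> real N powr x * (1 / x + 1 / real N)" by (simp add: algebra_simps)
  finally show ?thesis .
next
  case False
  have "(\<Sum>n<N. real n powr (x - 1)) \<le> real N powr x / x"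
  proof (induction N)
    case (Suc N)
    have "real N powr (x - 1) \<le> (real (Suc N) powr x - real N powr x) / x"
    proof (cases "N = 0")
      case True
      thus ?thesis using x by simp
    next
      case N: False
      then obtain z where z: "real N < z" "z < real (Suc N)"
        "real (Suc N) powr x - real N powr x = x * z powr (x - 1)"
        using powr_increment[of N x] by blast
      have "real N powr (x - 1) \<le> z powr (x - 1)"
        using z False by (intro powr_mono2) auto
      thus ?thesis using z x by (simp add: field_simps)
    qed
    thus ?case using Suc by (auto simp: diff_divide_distrib)
  qed auto
  moreover have "(\<Sum>n<N. real (Suc n) powr (x - 1)) = (\<Sum>n<N. real n powr (x - 1)) + real N powr (x - 1)"
    using False by (induction N) auto
  moreover have "real N powr (x - 1) = real N powr x * (1 / real N)"
    using N by (simp add: powr_diff)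
  ultimately show ?thesis by (simp add: algebra_simps)
qed

text \<open>
  On the circle \<open>1 / z = cnj z / R\<^sup>2\<close>, so the kernel is \<open>2 Re z / R\<^sup>2\<close>. It vanishes on the imaginary axis
  and so compensates the factor \<open>1 / Re z\<close> in the bounds for the Dirichlet series.
\<close>
lemma norm_newman_kernel:
  assumes "norm z = R" "R > 0"
  shows "norm (1 / z + z / of_real R ^ 2) = 2 * \<bar>Re z\<bar> / R\<^sup>2"
proof -
  have z: "z \<noteq> 0" using assms by auto
  have "z * cnj z = of_real R ^ 2" using assms complex_norm_square[of z] by simp
  hence "1 / z = cnj z / of_real R ^ 2" using z assms by (simp add: field_simps)
  hence "1 / z + z / of_real R ^ 2 = of_real (2 * Re z) / of_real R ^ 2"
    by (simp add: add_divide_distrib[symmetric] complex_add_cnj add.commute)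
  thus ?thesis by (simp add: norm_divide norm_power norm_mult)
qed

lemma Re_left_half_circle:
  assumes "z \<in> path_image (part_circlepath 0 R (pi/2) (3*pi/2))" "R > 0"
  shows "Re z \<le> 0"
proof -
  obtain t where t: "z = part_circlepath 0 R (pi/2) (3*pi/2) t" "0 \<le> t" "t \<le> 1"
    using assms(1) by (auto simp: path_image_def)
  define x where "x = linepath (pi/2) (3*pi/2) t"
  have "x \<in> closed_segment (pi/2) (3*pi/2)" unfolding x_def using t by (auto simp: linepath_in_path)
  hence "-pi/2 \<le> x - pi" "x - pi \<le> pi/2" by (auto simp: closed_segment_eq_real_ivl)
  hence "cos (x - pi) \<ge> 0" using cos_ge_zero[of "x - pi"] by simp
  hence "cos x \<le> 0" by simp
  moreover have "z = R * exp (\<i> * of_real x)" using t by (simp add: part_circlepath_def x_def)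
  ultimately show ?thesis using assms(2) by (simp add: Re_exp mult_nonneg_nonpos)
qed

lemma dirichlet_remainder_bound:
  fixes a :: "nat \<Rightarrow> complex"
  assumes a: "\<And>n. norm (a n) \<le> C" and z: "Re z > 0" and N: "N > 0"
    and f: "(\<lambda>n. a n * of_nat (Suc n) powr (-1 - z)) sums f"
  shows "norm (f - (\<Sum>n<N. a n * of_nat (Suc n) powr (-1 - z))) \<le> C * (real N powr (-Re z) / Re z)"
proof -
  define t where "t = (\<lambda>n. a n * of_nat (Suc n) powr (-1 - z))"
  have C: "C \<ge> 0" using order_trans[OF norm_ge_zero a[of 0]] .
  have "(\<lambda>M. norm ((\<Sum>n<M. t n) - (\<Sum>n<N. t n))) \<longlonglongrightarrow> norm (f - (\<Sum>n<N. t n))"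
    using f unfolding sums_def t_def by (intro tendsto_intros)
  moreover have "\<forall>\<^sub>F M in sequentially. norm ((\<Sum>n<M. t n) - (\<Sum>n<N. t n)) \<le> C * (real N powr (-Re z) / Re z)"
    using eventually_ge_at_top[of N]
  proof eventually_elim
    case (elim M)
    have "(\<Sum>n<M. t n) - (\<Sum>n<N. t n) = (\<Sum>n=N..<M. t n)"
      using elim sum_diff_nat_ivl[of 0 N M t] by (simp add: atLeast0LessThan)
    also have "norm \<dots> \<le> (\<Sum>n=N..<M. C * real (Suc n) powr (-1 - Re z))"
    proof (rule sum_norm_le)
      show "norm (t n) \<le> C * real (Suc n) powr (-1 - Re z)" for n
        unfolding t_def norm_mult norm_nat_powr[OF zero_less_Suc] using a by (auto intro: mult_right_mono)
    qed
    also have "\<dots> = C * (\<Sum>n=N..<M. real (Suc n) powr (-1 - Re z))"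
      by (simp add: sum_distrib_left)
    also have "\<dots> \<le> C * (real N powr (-Re z) / Re z)"
      using C N z elim by (intro mult_left_mono powr_tail_le) auto
    finally show ?case .
  qed
  ultimately show ?thesis unfolding t_def
    by (intro tendsto_upperbound[OF _ _ sequentially_bot]) auto
qed

lemma dirichlet_partial_sum_bound:
  fixes a :: "nat \<Rightarrow> complex"
  assumes a: "\<And>n. norm (a n) \<le> C" and z: "Re z < 0" and N: "N > 0"
  shows "norm (\<Sum>n<N. a n * of_nat (Suc n) powr (-1 - z)) \<le> C * (real N powr (-Re z) * (1 / (-Re z) + 1 / real N))"
proof -
  have C: "C \<ge> 0" using order_trans[OF norm_ge_zero a[of 0]] .
  have "norm (\<Sum>n<N. a n * of_nat (Suc n) powr (-1 - z)) \<le> (\<Sum>n<N. C * real (Suc n) powr (-Re z - 1))"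
  proof (rule sum_norm_le)
    have e: "- 1 - Re z = -Re z - 1" by simp
    show "norm (a n * of_nat (Suc n) powr (-1 - z)) \<le> C * real (Suc n) powr (-Re z - 1)" for n
      unfolding norm_mult norm_nat_powr[OF zero_less_Suc] using a[of n] by (simp add: e mult_right_mono)
  qed
  also have "\<dots> = C * (\<Sum>n<N. real (Suc n) powr (-Re z - 1))" by (simp add: sum_distrib_left)
  also have "\<dots> \<le> C * (real N powr (-Re z) * (1 / (-Re z) + 1 / real N))"
    using C z N by (intro mult_left_mono powr_partial_sum_le) auto
  finally show ?thesis .
qed

text \<open>
  The part of Newman's contour to the left of the imaginary axis, from \<open>\<i> R\<close> to \<open>-\<i> R\<close> through the
  vertical line \<open>Re z = -d\<close>.
\<close>
definition left_box_path :: "real \<Rightarrow> real \<Rightarrow> real \<Rightarrow> complex" where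
  "left_box_path R d = linepath (\<i> * of_real R) (Complex (-d) R) +++ 
     (linepath (Complex (-d) R) (Complex (-d) (-R)) +++ linepath (Complex (-d) (-R)) (-\<i> * of_real R))"

text \<open>
  Newman's contour argument. Let \<open>S\<close> be the partial sum of length \<open>N\<close> and let
  \<open>K z = N powr z * (1 / z + z / R\<^sup>2)\<close>. Cauchy's formula expresses \<open>f 0\<close> through an integral of \<open>f K\<close> over the
  right half circle and the box, and \<open>S 0\<close> through an integral of \<open>S K\<close> over the whole circle, since \<open>S\<close> is
  entire. On the right half circle only the remainder \<open>f - S\<close> matters, which is of size
  \<open>N powr (-Re z) / Re z\<close>; on the left one \<open>S\<close> is of size \<open>N powr (-Re z) / (-Re z)\<close>. In both cases the
  kernel cancels the singularity and the integral is of order \<open>1 / R + 1 / N\<close>. On the box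
  \<open>N powr z\<close> is bounded by \<open>1\<close> on the horizontal sides, which have length \<open>d\<close>, and by \<open>N powr (-d)\<close> on the
  vertical side.
\<close>
lemma newman_estimate:
  fixes a :: "nat \<Rightarrow> complex"
  assumes a: "\<And>n. norm (a n) \<le> C"
    and f: "\<And>z. Re z > 0 \<Longrightarrow> (\<lambda>n. a n * of_nat (Suc n) powr (-1 - z)) sums f z"
    and hol: "f holomorphic_on {z. -\<delta> < Re z \<and> \<bar>Im z\<bar> < R + 1}" 
    and R: "R > 0" and d: "0 < d" "d < \<delta>" "d \<le> R" and N: "N > 0"
    and M: "\<And>x. -d \<le> x \<Longrightarrow> x \<le> 0 \<Longrightarrow> norm (f (Complex x R)) * (1 / R + (R + d) / R\<^sup>2) \<le> M"
           "\<And>x. -d \<le> x \<Longrightarrow> x \<le> 0 \<Longrightarrow> norm (f (Complex x (-R))) * (1 / R + (R + d) / R\<^sup>2) \<le> M"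
    and M': "\<And>y. \<bar>y\<bar> \<le> R \<Longrightarrow> norm (f (Complex (-d) y)) * (1 / d + (R + d) / R\<^sup>2) \<le> M'"
  shows "2 * pi * norm (f 0 - (\<Sum>n<N. a n / of_nat (Suc n))) \<le> 
           4 * pi * C / R + 2 * pi * C / N + 2 * M * d + 2 * R * M' * real N powr (-d)"
proof -
  let ?H = "\<lambda>y. {z. -d \<le> Re z \<and> Re z \<le> 0 \<and> Im z = y}" and ?V = "{z. Re z = -d \<and> \<bar>Im z\<bar> \<le> R}"
  define K where "K = (\<lambda>z::complex. of_nat N powr z * (1 / z + z / of_real R ^ 2))"
  define S where "S = (\<lambda>z. \<Sum>n<N. a n * of_nat (Suc n) powr (-1 - z))"
  define A where "A = part_circlepath 0 R (-pi/2) (pi/2)"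
  define A' where "A' = part_circlepath 0 R (pi/2) (3*pi/2)"
  define B where "B = left_box_path R d"
  define W where "W = {z. -\<delta> < Re z \<and> \<bar>Im z\<bar> < R + 1}"
  have C: "C \<ge> 0" using order_trans[OF norm_ge_zero a[of 0]] .
  have W_eq: "W = {z. Re z > -\<delta>} \<inter> {z. Im z < R + 1} \<inter> {z. Im z > -(R + 1)}"
    unfolding W_def by auto
  have W: "open W" "convex W" "0 \<in> W"
    unfolding W_eq using R d
    by (auto intro!: open_Int convex_Int open_halfspace_Re_gt open_halfspace_Im_lt open_halfspace_Im_gt
          convex_halfspace_Re_gt convex_halfspace_Im_lt convex_halfspace_Im_gt)
  have S_hol: "S holomorphic_on UNIV"
    unfolding S_def by (intro holomorphic_intros)
  have K_eq: "g z * K z = g z * of_nat N powr z * (1 + z\<^sup>2 / of_real R ^ 2) / z" if "z \<noteq> 0" for g z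
    using that by (simp add: K_def field_simps power2_eq_square)
  have A_W: "path_image A \<subseteq> W"
  proof
    fix z assume z: "z \<in> path_image A"
    have "norm z = R" "Re z \<ge> 0" using z R Re_right_half_circle[of z R] norm_part_circlepath[of z R "-pi/2" "pi/2"] unfolding A_def by simp_all
    thus "z \<in> W" using abs_Im_le_cmod[of z] d by (auto simp: W_def)
  qed
  have A_nz: "0 \<notin> path_image A" "0 \<notin> path_image A'"
    unfolding A_def A'_def using R norm_part_circlepath by force+
  have A'_nn: "path_image A' \<inter> \<real>\<^sub>\<ge>\<^sub>0 = {}"
  proof -
    have "z \<notin> \<real>\<^sub>\<ge>\<^sub>0" if "z \<in> path_image A'" for z
    proof -
      have "norm z = R" "Re z \<le> 0" using that R Re_left_half_circle[of z R] norm_part_circlepath[of z R "pi/2" "3*pi/2"] unfolding A'_def by simp_all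
      thus ?thesis using R by (auto simp: complex_nonneg_Reals_iff cmod_def)
    qed
    thus ?thesis by blast
  qed
  have A'_ends: "pathstart A' = \<i> * of_real R" "pathfinish A' = -\<i> * of_real R" "valid_path A'"
    unfolding A'_def pathstart_part_circlepath pathfinish_part_circlepath exp_half_circle_ends by simp_all
  \<comment> \<open>the sides of the box stay in \<open>W\<close> and avoid the nonnegative real axis\<close>
  have seg_h: "closed_segment (\<i> * of_real y) (Complex (-d) y) \<subseteq> ?H y" for y
  proof -
    have "convex ({z. Re z \<ge> -d} \<inter> {z. Re z \<le> 0} \<inter> {z. Im z \<ge> y} \<inter> {z. Im z \<le> y})"
      by (intro convex_Int convex_halfspace_Re_ge convex_halfspace_Re_le convex_halfspace_Im_ge convex_halfspace_Im_le)
    also have "({z. Re z \<ge> -d} \<inter> {z. Re z \<le> 0} \<inter> {z. Im z \<ge> y} \<inter> {z. Im z \<le> y}) = ?H y"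
      by auto
    finally show ?thesis using d by (intro closed_segment_subset) auto
  qed
  have seg_v: "closed_segment (Complex (-d) R) (Complex (-d) (-R)) \<subseteq> ?V"
  proof -
    have "convex ({z. Re z \<ge> -d} \<inter> {z. Re z \<le> -d} \<inter> {z. Im z \<ge> -R} \<inter> {z. Im z \<le> R})"
      by (intro convex_Int convex_halfspace_Re_ge convex_halfspace_Re_le convex_halfspace_Im_ge convex_halfspace_Im_le)
    also have "({z. Re z \<ge> -d} \<inter> {z. Re z \<le> -d} \<inter> {z. Im z \<ge> -R} \<inter> {z. Im z \<le> R}) = ?V"
      by auto
    finally show ?thesis using d R by (intro closed_segment_subset) auto
  qed
  let ?l1 = "linepath (\<i> * of_real R) (Complex (-d) R)" and ?l2 = "linepath (Complex (-d) R) (Complex (-d) (-R))"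
  let ?l3 = "linepath (Complex (-d) (-R)) (-\<i> * of_real R)"
  have l1: "path_image ?l1 \<subseteq> ?H R"
    using seg_h[of R] by simp
  have l3: "path_image ?l3 \<subseteq> ?H (-R)"
    using seg_h[of "-R"] by (simp add: closed_segment_commute)
  have l2: "path_image ?l2 \<subseteq> ?V"
    using seg_v by simp
  have B_im: "path_image B \<subseteq> path_image ?l1 \<union> path_image ?l2 \<union> path_image ?l3"
    unfolding B_def left_box_path_def using path_image_join_subset[of ?l1 "?l2 +++ ?l3"] path_image_join_subset[of ?l2 ?l3] by blast
  have B_W: "path_image B \<subseteq> W - \<real>\<^sub>\<ge>\<^sub>0"
  proof -
    have s: "?H R \<subseteq> W - \<real>\<^sub>\<ge>\<^sub>0" "?H (-R) \<subseteq> W - \<real>\<^sub>\<ge>\<^sub>0"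
       "?V \<subseteq> W - \<real>\<^sub>\<ge>\<^sub>0"
      using d R by (auto simp: W_def complex_nonneg_Reals_iff)
    show ?thesis
      by (intro order_trans[OF B_im] Un_least order_trans[OF l1 s(1)] order_trans[OF l2 s(3)] order_trans[OF l3 s(2)])
  qed
  have B_valid: "valid_path B" "pathstart B = \<i> * of_real R" "pathfinish B = -\<i> * of_real R"
    unfolding B_def left_box_path_def by (auto intro!: valid_path_join)
  have formula: "contour_integral A (\<lambda>z. g z * K z) + contour_integral P (\<lambda>z. g z * K z) = 2 * of_real pi * \<i> * g 0"
    if g: "g holomorphic_on X" "open X" "convex X" "0 \<in> X" "path_image A \<subseteq> X"
      and P: "valid_path P" "pathstart P = \<i> * of_real R" "pathfinish P = -\<i> * of_real R" "path_image P \<subseteq> X - \<real>\<^sub>\<ge>\<^sub>0"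
    for g X P
  proof -
    let ?H = "\<lambda>z. g z * of_nat N powr z * (1 + z\<^sup>2 / of_real R ^ 2)"
    have "?H holomorphic_on X" using N R by (intro holomorphic_intros g) auto
    from cauchy_formula_half_circle[OF R g(2-4) this, of P] g(5) P
    have "contour_integral A (\<lambda>z. ?H z / z) + contour_integral P (\<lambda>z. ?H z / z) = 2 * of_real pi * \<i> * ?H 0"
      unfolding A_def by blast
    moreover have "contour_integral A (\<lambda>z. g z * K z) = contour_integral A (\<lambda>z. ?H z / z)"
      using A_nz K_eq[of _ g] by (intro contour_integral_eq) metis
    moreover have "0 \<notin> path_image P" using P(4) by auto
    hence "contour_integral P (\<lambda>z. g z * K z) = contour_integral P (\<lambda>z. ?H z / z)"
      using K_eq[of _ g] by (intro contour_integral_eq) metis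
    ultimately show ?thesis using N by simp
  qed
  let ?fK = "\<lambda>z. f z * K z" and ?SK = "\<lambda>z. S z * K z"
  have f_hol: "f holomorphic_on W" using hol by (simp add: W_def)
  have F1: "contour_integral A ?fK + contour_integral B ?fK = 2 * of_real pi * \<i> * f 0"
    by (rule formula[OF f_hol W A_W B_valid B_W])
  have F2: "contour_integral A ?SK + contour_integral A' ?SK = 2 * of_real pi * \<i> * S 0"
    by (rule formula[OF S_hol]) (use A'_ends A'_nn in auto)
  have K_hol: "K holomorphic_on UNIV - {0}"
    unfolding K_def using N R by (intro holomorphic_intros) auto
  have int: "(\<lambda>z. g z * K z) contour_integrable_on l"
    if "g holomorphic_on X" "open X" "valid_path l" "path_image l \<subseteq> X - {0}" for g X l
  proof (rule contour_integrable_holomorphic_simple)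
    show "(\<lambda>z. g z * K z) holomorphic_on (X - {0})"
      by (intro holomorphic_intros holomorphic_on_subset[OF that(1)] holomorphic_on_subset[OF K_hol]) auto
  qed (use that in auto)
  have intA: "?fK contour_integrable_on A" "?SK contour_integrable_on A"
    by (rule int[OF f_hol W(1)], use A_W A_nz in \<open>auto simp: A_def\<close>)
       (rule int[OF S_hol open_UNIV], use A_nz in \<open>auto simp: A_def\<close>)
  have intA': "?SK contour_integrable_on A'"
    by (rule int[OF S_hol open_UNIV]) (use A_nz in \<open>auto simp: A'_def\<close>)
  have diff: "contour_integral A (\<lambda>z. f z * K z - S z * K z) = contour_integral A ?fK - contour_integral A ?SK"
    by (rule contour_integral_diff[OF intA])
  have main: "2 * of_real pi * \<i> * (f 0 - S 0) = contour_integral A (\<lambda>z. f z * K z - S z * K z) + 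
     contour_integral B ?fK - contour_integral A' ?SK"
    unfolding right_diff_distrib F1[symmetric] F2[symmetric] diff by simp
  \<comment> \<open>the remainder is unbounded near the imaginary axis, but the kernel vanishes there\<close>
  have norm_K: "norm (K z) = real N powr Re z * (2 * \<bar>Re z\<bar> / R\<^sup>2)" if "norm z = R" for z
    unfolding K_def norm_mult using norm_newman_kernel[OF that R] N by (simp add: norm_nat_powr)
  have bA: "norm (contour_integral A (\<lambda>z. f z * K z - S z * K z)) \<le> (2 * C / R\<^sup>2) * R * \<bar>pi/2 - (-pi/2)\<bar>"
    unfolding A_def
  proof (rule contour_integral_bound_part_circlepath)
    show "(\<lambda>z. f z * K z - S z * K z) contour_integrable_on part_circlepath 0 R (- pi / 2) (pi / 2)"
      using contour_integrable_diff[OF intA] unfolding A_def .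
    fix z assume z: "z \<in> path_image (part_circlepath 0 R (- pi / 2) (pi / 2))"
    have nz: "norm z = R" "Re z \<ge> 0" using z R Re_right_half_circle[of z R] norm_part_circlepath[of z R "-pi/2" "pi/2"] by simp_all
    show "norm (f z * K z - S z * K z) \<le> 2 * C / R\<^sup>2"
    proof (cases "Re z = 0")
      case True
      hence "K z = 0" using norm_K[OF nz(1)] by simp
      thus ?thesis using C by simp
    next
      case False
      hence x: "Re z > 0" using nz by simp
      have "norm (f z * K z - S z * K z) = norm (f z - S z) * norm (K z)"
        by (simp add: algebra_simps flip: norm_mult)
      also have "\<dots> \<le> (C * (real N powr (-Re z) / Re z)) * (real N powr Re z * (2 * \<bar>Re z\<bar> / R\<^sup>2))"
        unfolding norm_K[OF nz(1)] S_def
        by (intro mult_right_mono dirichlet_remainder_bound[OF a x N f[OF x]]) auto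
      also have "\<dots> = 2 * C / R\<^sup>2" using x N by (simp add: powr_minus field_simps)
      finally show ?thesis .
    qed
  qed (use C R in auto)
  \<comment> \<open>for \<open>Re z < 0\<close> the partial sum grows like \<open>N powr (-Re z)\<close>, which \<open>N powr z\<close> cancels\<close>
  have bA': "norm (contour_integral A' ?SK) \<le> (2 * C / R\<^sup>2 * (1 + R / N)) * R * \<bar>3*pi/2 - pi/2\<bar>"
    unfolding A'_def
  proof (rule contour_integral_bound_part_circlepath)
    show "?SK contour_integrable_on part_circlepath 0 R (pi / 2) (3 * pi / 2)"
      using intA' unfolding A'_def .
    fix z assume z: "z \<in> path_image (part_circlepath 0 R (pi / 2) (3 * pi / 2))"
    have nz: "norm z = R" "Re z \<le> 0" using z R Re_left_half_circle[of z R] norm_part_circlepath[of z R "pi/2" "3*pi/2"] by simp_all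
    show "norm (S z * K z) \<le> 2 * C / R\<^sup>2 * (1 + R / N)"
    proof (cases "Re z = 0")
      case True
      hence "K z = 0" using norm_K[OF nz(1)] by simp
      thus ?thesis using C R by simp
    next
      case False
      hence x: "Re z < 0" using nz by simp
      have xR: "-Re z \<le> R" using abs_Re_le_cmod[of z] nz by simp
      have "norm (S z * K z) = norm (S z) * norm (K z)" by (simp add: norm_mult)
      also have "\<dots> \<le> (C * (real N powr (-Re z) * (1 / (-Re z) + 1 / real N))) * (real N powr Re z * (2 * \<bar>Re z\<bar> / R\<^sup>2))"
        unfolding norm_K[OF nz(1)] S_def
        by (intro mult_right_mono dirichlet_partial_sum_bound[OF a x N]) auto
      also have "\<dots> = 2 * C / R\<^sup>2 * (1 + (-Re z) / N)" using x N R by (simp add: powr_minus field_simps)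
      also have "\<dots> \<le> 2 * C / R\<^sup>2 * (1 + R / N)"
        using C xR by (intro mult_left_mono add_left_mono divide_right_mono) auto
      finally show ?thesis .
    qed
  qed (use C R in auto)
  \<comment> \<open>on the box only \<open>f\<close> and the kernel are estimated, so the bounds depend on \<open>N\<close> through \<open>N powr z\<close> alone\<close>
  have intL: "?fK contour_integrable_on l" if "path_image l \<subseteq> path_image ?l1 \<union> path_image ?l2 \<union> path_image ?l3" "valid_path l" for l
  proof -
    have s: "?H R \<subseteq> W - {0}" "?H (-R) \<subseteq> W - {0}" "?V \<subseteq> W - {0}"
      using d R by (auto simp: W_def)
    have "path_image ?l1 \<union> path_image ?l2 \<union> path_image ?l3 \<subseteq> W - {0}"
      by (intro Un_least order_trans[OF l1 s(1)] order_trans[OF l2 s(3)] order_trans[OF l3 s(2)])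
    with that show ?thesis by (intro int[OF f_hol W(1)]) auto
  qed
  have K_le: "norm (K z) \<le> real N powr Re z * (1 / r + (R + d) / R\<^sup>2)" if "0 < r" "r \<le> norm z" "norm z \<le> R + d" for z r
  proof -
    have "norm (1 / z + z / of_real R ^ 2) \<le> norm (1 / z) + norm (z / of_real R ^ 2)" by (rule norm_triangle_ineq)
    also have "\<dots> = 1 / norm z + norm z / R\<^sup>2" by (simp add: norm_divide norm_power)
    also have "\<dots> \<le> 1 / r + (R + d) / R\<^sup>2"
      using that by (intro add_mono divide_right_mono divide_left_mono mult_pos_pos) auto
    finally show ?thesis unfolding K_def norm_mult using N by (auto simp: norm_nat_powr intro: mult_left_mono)
  qed
  have Npow: "real N powr x \<le> 1" if "x \<le> 0" for x
    using that N powr_mono[of x 0 "real N"] by simp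
  have M0: "M \<ge> 0" "M' \<ge> 0"
    using M(1)[of 0] M'[of 0] d R 
    by (auto intro!: order_trans[OF _ M(1)[of 0]] order_trans[OF _ M'[of 0]])
  have bh: "norm (f z * K z) \<le> M" if "-d \<le> Re z" "Re z \<le> 0" "Im z = R \<or> Im z = -R" for z
  proof -
    have zz: "z = Complex (Re z) R \<or> z = Complex (Re z) (-R)" using that by (auto simp: complex_eq_iff)
    have n: "R \<le> norm z" "norm z \<le> R + d"
      using abs_Im_le_cmod[of z] cmod_le[of z] that R by auto
    have "norm (f z * K z) \<le> norm (f z) * (real N powr Re z * (1 / R + (R + d) / R\<^sup>2))"
      unfolding norm_mult using n R by (intro mult_left_mono K_le) auto
    also have "\<dots> \<le> norm (f z) * (1 * (1 / R + (R + d) / R\<^sup>2))"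
      using R d that by (intro mult_left_mono mult_right_mono Npow) auto
    also have "\<dots> \<le> M" using M[of "Re z"] zz that by auto
    finally show ?thesis .
  qed
  have b1: "norm (contour_integral ?l1 ?fK) \<le> M * d"
  proof -
    have "norm (contour_integral ?l1 ?fK) \<le> M * norm (Complex (-d) R - \<i> * of_real R)"
      using M0 l1 bh by (intro contour_integral_bound_linepath intL) auto
    also have "Complex (-d) R - \<i> * of_real R = of_real (-d)" by (simp add: complex_eq_iff)
    finally show ?thesis using d by simp
  qed
  have b3: "norm (contour_integral ?l3 ?fK) \<le> M * d"
  proof -
    have "norm (contour_integral ?l3 ?fK) \<le> M * norm (-\<i> * of_real R - Complex (-d) (-R))"
      using M0 l3 bh by (intro contour_integral_bound_linepath intL) auto
    also have "-\<i> * of_real R - Complex (-d) (-R) = of_real d" by (simp add: complex_eq_iff)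
    finally show ?thesis using d by simp
  qed
  have b2: "norm (contour_integral ?l2 ?fK) \<le> (M' * real N powr (-d)) * (2 * R)"
  proof -
    have "norm (contour_integral ?l2 ?fK) \<le> (M' * real N powr (-d)) * norm (Complex (-d) (-R) - Complex (-d) R)"
    proof (intro contour_integral_bound_linepath intL)
      fix z assume "z \<in> closed_segment (Complex (-d) R) (Complex (-d) (-R))"
      hence z: "Re z = -d" "\<bar>Im z\<bar> \<le> R" using seg_v by auto
      have zz: "z = Complex (-d) (Im z)" using z by (simp add: complex_eq_iff)
      have n: "d \<le> norm z" "norm z \<le> R + d"
        using abs_Re_le_cmod[of z] cmod_le[of z] z d by auto
      have "norm (f z * K z) \<le> norm (f z) * (real N powr Re z * (1 / d + (R + d) / R\<^sup>2))"
        unfolding norm_mult using n d by (intro mult_left_mono K_le) auto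
      also have "\<dots> = (norm (f (Complex (-d) (Im z))) * (1 / d + (R + d) / R\<^sup>2)) * real N powr (-d)"
        using z zz by (simp add: mult_ac)
      also have "\<dots> \<le> M' * real N powr (-d)" using M'[OF z(2)] by (intro mult_right_mono) auto
      finally show "norm (f z * K z) \<le> M' * real N powr (-d)" .
    qed (use M0 in auto)
    also have "Complex (-d) (-R) - Complex (-d) R = of_real (-2 * R) * \<i>" by (simp add: complex_eq_iff)
    finally show ?thesis using R by (simp add: norm_mult)
  qed
  have "contour_integral B ?fK = contour_integral ?l1 ?fK + 
     (contour_integral ?l2 ?fK + contour_integral ?l3 ?fK)"
    unfolding B_def left_box_path_def
    by (subst contour_integral_join contour_integrable_join; 
        (intro contour_integrable_joinI intL valid_path_join conjI)?; (auto)?)+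
  hence "norm (contour_integral B ?fK) \<le> norm (contour_integral ?l1 ?fK) + 
     (norm (contour_integral ?l2 ?fK) + norm (contour_integral ?l3 ?fK))"
    by (metis (no_types, lifting) norm_triangle_le norm_triangle_ineq add_left_mono)
  hence bB: "norm (contour_integral B ?fK) \<le> M * d + ((M' * real N powr (-d)) * (2 * R) + M * d)"
    using b1 b2 b3 by linarith
  have S0: "S 0 = (\<Sum>n<N. a n / of_nat (Suc n))"
    unfolding S_def by (intro sum.cong) (auto simp: powr_minus divide_inverse simp del: of_nat_Suc)
  have "2 * pi * norm (f 0 - S 0) = norm (2 * of_real pi * \<i> * (f 0 - S 0))"
    by (simp add: norm_mult)
  also have "\<dots> \<le> norm (contour_integral A (\<lambda>z. f z * K z - S z * K z)) + 
     norm (contour_integral B ?fK) + norm (contour_integral A' ?SK)"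
    unfolding main by (intro norm_triangle_le_diff norm_triangle_le add_mono order_refl) 
  also have "\<dots> \<le> (2 * C / R\<^sup>2) * R * \<bar>pi/2 - (-pi/2)\<bar> + (M * d + ((M' * real N powr (-d)) * (2 * R) + M * d)) + 
      (2 * C / R\<^sup>2 * (1 + R / N)) * R * \<bar>3*pi/2 - pi/2\<bar>"
    by (intro add_mono bA bA' bB)
  also have "\<bar>pi/2 - (-pi/2)\<bar> = pi" by simp
  also have "\<bar>3*pi/2 - pi/2\<bar> = pi" by simp
  also have "(2 * C / R\<^sup>2) * R * pi = 2 * pi * C / R" using R by (simp add: field_simps power2_eq_square)
  also have "(2 * C / R\<^sup>2 * (1 + R / N)) * R * pi = 2 * pi * C / R + 2 * pi * C / N" 
    using R N by (simp add: field_simps power2_eq_square)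
  finally show ?thesis unfolding S0 by (simp add: algebra_simps)
qed

text \<open>
  In the estimate above choose first \<open>R\<close> large, then \<open>d\<close> small (the bound \<open>M\<close> on the horizontal sides does
  not grow when \<open>d\<close> shrinks), and finally \<open>N\<close> large.
\<close>
theorem newman_tauberian:
  fixes a :: "nat \<Rightarrow> complex"
  assumes a: "\<And>n. norm (a n) \<le> C"
    and U: "open U" "{z. Re z \<ge> 1} \<subseteq> U" and G: "G holomorphic_on U"
    and sums: "\<And>z. Re z > 1 \<Longrightarrow> (\<lambda>n. a n * of_nat (Suc n) powr (-z)) sums G z"
  shows "(\<lambda>n. a n / of_nat (Suc n)) sums G 1"
proof -
  define f where "f = (\<lambda>z. G (1 + z))"
  have C: "C \<ge> 0" using order_trans[OF norm_ge_zero a[of 0]] .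
  have f: "(\<lambda>n. a n * of_nat (Suc n) powr (-1 - z)) sums f z" if "Re z > 0" for z
    using sums[of "1 + z"] that by (simp add: f_def)
  define V where "V = (\<lambda>z. 1 + z) -` U"
  have V: "open V" unfolding V_def using U(1) by (intro open_vimage continuous_intros)
  have V2: "{z. Re z \<ge> 0} \<subseteq> V"
  proof
    fix z assume "z \<in> {z. Re z \<ge> 0}"
    hence "1 + z \<in> {z. Re z \<ge> 1}" by simp
    thus "z \<in> V" using U(2) unfolding V_def by blast
  qed
  have fV: "f holomorphic_on V"
    unfolding f_def by (rule holomorphic_on_compose_gen[OF _ G, of "\<lambda>z. 1 + z", unfolded o_def])
       (auto simp: V_def intro!: holomorphic_intros)
  have "(\<lambda>N. \<Sum>n<N. a n / of_nat (Suc n)) \<longlonglongrightarrow> f 0"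
  proof (rule tendstoI)
    fix eps :: real assume eps: "eps > 0"
    define R where "R = 8 * C / eps + 1"
    have R: "R > 0" "2 * C / R \<le> eps / 4" 
      using C eps by (auto simp: R_def field_simps add_pos_nonneg)
    let ?I = "(\<lambda>y. Complex 0 y) ` {-(R+1)..R+1}"
    have "compact ?I" 
      by (intro compact_continuous_image continuous_on_Complex continuous_intros compact_Icc)
    moreover have "?I \<subseteq> V" using V2 by auto
    ultimately obtain \<delta> where \<delta>: "\<delta> > 0" "(\<Union>x\<in>?I. ball x \<delta>) \<subseteq> V"
      using compact_subset_open_imp_ball_epsilon_subset[OF _ V] by metis
    have box: "{z. -\<delta> < Re z \<and> \<bar>Im z\<bar> < R + 1} \<subseteq> V"
    proof safe
      fix z assume z: "-\<delta> < Re z" "\<bar>Im z\<bar> < R + 1"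
      show "z \<in> V"
      proof (cases "Re z \<ge> 0")
        case True thus ?thesis using V2 by auto
      next
        case False
        have "z - Complex 0 (Im z) = of_real (Re z)" by (simp add: complex_eq_iff)
        hence "dist (Complex 0 (Im z)) z < \<delta>" using z False by (simp add: dist_norm norm_minus_commute)
        moreover have "Complex 0 (Im z) \<in> ?I" using z by (intro imageI) auto
        ultimately have "z \<in> (\<Union>x\<in>?I. ball x \<delta>)" by (meson UN_I mem_ball)
        thus ?thesis using \<delta>(2) by blast
      qed
    qed
    have hol: "f holomorphic_on {z. -\<delta> < Re z \<and> \<bar>Im z\<bar> < R + 1}"
      by (rule holomorphic_on_subset[OF fV box])
    hence cont: "continuous_on {z. -\<delta> < Re z \<and> \<bar>Im z\<bar> < R + 1} f"
      by (rule holomorphic_on_imp_continuous_on)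
    define d0 where "d0 = min (\<delta> / 2) R"
    have d0: "0 < d0" "d0 < \<delta>" "d0 \<le> R" using \<delta> R by (auto simp: d0_def)
    have "\<exists>M. \<forall>x\<in>{-d0..0}. norm (f (Complex x y)) \<le> M" if "\<bar>y\<bar> \<le> R" for y
    proof -
      have "compact ((\<lambda>x. f (Complex x y)) ` {-d0..0})"
        using d0 that by (intro compact_continuous_image compact_Icc continuous_on_compose2[OF cont] 
            continuous_on_Complex continuous_intros) auto
      thus ?thesis using compact_imp_bounded bounded_iff by (metis imageI)
    qed
    note bdd = this
    obtain Ma where "\<forall>x\<in>{-d0..0}. norm (f (Complex x R)) \<le> Ma" using bdd[of R] R by auto
    moreover obtain Mb where "\<forall>x\<in>{-d0..0}. norm (f (Complex x (-R))) \<le> Mb" using bdd[of "-R"] R by auto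
    ultimately have M: 
      "\<And>x. -d0 \<le> x \<Longrightarrow> x \<le> 0 \<Longrightarrow> norm (f (Complex x R)) \<le> Ma" 
      "\<And>x. -d0 \<le> x \<Longrightarrow> x \<le> 0 \<Longrightarrow> norm (f (Complex x (-R))) \<le> Mb" by simp_all
    define M where "M = max Ma Mb * (1 / R + (R + R) / R\<^sup>2)"
    define d where "d = min d0 (eps / (4 * (\<bar>M\<bar> + 1)))"
    have d: "0 < d" "d < \<delta>" "d \<le> R" "d \<le> d0" using d0 eps by (auto simp: d_def)
    have Md: "M * d \<le> eps / 4"
    proof -
      have "M * d \<le> (\<bar>M\<bar> + 1) * (eps / (4 * (\<bar>M\<bar> + 1)))"
        using d eps by (intro mult_mono) (auto simp: d_def)
      also have "(\<bar>M\<bar> + 1) * (eps / (4 * (\<bar>M\<bar> + 1))) = eps / 4"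
        using mult_divide_mult_cancel_left[of "\<bar>M\<bar> + 1" eps 4] by (simp add: mult.commute)
      finally show ?thesis .
    qed
    have "compact ((\<lambda>y. f (Complex (-d) y)) ` {-R..R})"
      using d by (intro compact_continuous_image compact_Icc continuous_on_compose2[OF cont] 
            continuous_on_Complex continuous_intros) auto
    then obtain M1 where M1: "\<And>y. \<bar>y\<bar> \<le> R \<Longrightarrow> norm (f (Complex (-d) y)) \<le> M1"
      using compact_imp_bounded bounded_iff by (metis (no_types, lifting) abs_le_iff atLeastAtMost_iff imageI minus_le_iff)
    define M' where "M' = M1 * (1 / d + (R + d) / R\<^sup>2)"
    have est: "2 * pi * norm (f 0 - (\<Sum>n<N. a n / of_nat (Suc n))) \<le> 
           4 * pi * C / R + 2 * pi * C / N + 2 * M * d + 2 * R * M' * real N powr (-d)" if "N > 0" for N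
    proof (rule newman_estimate[OF a f hol R(1) d(1-3) that])
      have Ma0: "max Ma Mb \<ge> 0" using M(1)[of 0] d0 by (smt (verit) norm_ge_zero)
      show "norm (f (Complex x R)) * (1 / R + (R + d) / R\<^sup>2) \<le> M" if "-d \<le> x" "x \<le> 0" for x
        unfolding M_def using M(1)[of x] that d R Ma0
        by (intro mult_mono add_mono divide_right_mono) auto
      show "norm (f (Complex x (-R))) * (1 / R + (R + d) / R\<^sup>2) \<le> M" if "-d \<le> x" "x \<le> 0" for x
        unfolding M_def using M(2)[of x] that d R Ma0
        by (intro mult_mono add_mono divide_right_mono) auto
      show "norm (f (Complex (-d) y)) * (1 / d + (R + d) / R\<^sup>2) \<le> M'" if "\<bar>y\<bar> \<le> R" for y
        unfolding M'_def using M1[OF that] d R by (intro mult_right_mono) auto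
    qed
    have "(\<lambda>N. 2 * pi * C / real N + 2 * R * M' * real N powr (-d)) \<longlonglongrightarrow> 0 + 2 * R * M' * 0"
      using d by (intro tendsto_intros tendsto_neg_powr filterlim_real_sequentially lim_const_over_n) auto
    hence "\<forall>\<^sub>F N in sequentially. 2 * pi * C / real N + 2 * R * M' * real N powr (-d) < eps"
      using order_tendstoD(2)[of _ 0 _ eps] eps by simp
    thus "\<forall>\<^sub>F N in sequentially. dist (\<Sum>n<N. a n / of_nat (Suc n)) (f 0) < eps"
      using eventually_gt_at_top[of 0]
    proof eventually_elim
      case (elim N)
      let ?D = "norm (f 0 - (\<Sum>n<N. a n / of_nat (Suc n)))"
      have "4 * pi * C / R = 2 * pi * (2 * C / R)" by simp
      also have "\<dots> \<le> 2 * pi * (eps / 4)" using R by (intro mult_left_mono) auto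
      finally have "2 * pi * ?D < 2 * pi * (eps / 4) + eps + 2 * (eps / 4)"
        using est[OF elim(2)] elim(1) Md by simp
      also have "\<dots> < 2 * pi * (eps / 4) + 2 * pi * (3 * eps / 4)" 
      proof -
        have "pi * eps > 2 * eps" using pi_gt3 eps by (intro mult_strict_right_mono) auto
        thus ?thesis using eps by (simp only: times_divide_eq_right)
      qed
      also have "\<dots> = 2 * pi * eps" by simp
      finally have "?D < eps" by simp
      thus ?case by (simp add: dist_norm norm_minus_commute)
    qed
  qed
  thus ?thesis by (simp add: sums_def f_def)
qed

section \<open>Primes in short intervals\<close>

definition psi :: "nat \<Rightarrow> real" where
  "psi n = (\<Sum>k=1..n. mangoldt k)"

lemma psi_0 [simp]: "psi 0 = 0"
  and psi_Suc: "psi (Suc n) = psi n + mangoldt (Suc n)"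
  by (simp_all add: psi_def)

lemma psi_mono: "m \<le> n \<Longrightarrow> psi m \<le> psi n"
  unfolding psi_def by (intro sum_mono2) (auto simp: mangoldt_nonneg)

lemma psi_nonneg: "psi n \<ge> 0"
  using psi_mono[of 0 n] by simp

text \<open>
  Sum the identity \<open>ln n = \<Sum>d dvd n. mangoldt d\<close>: the number \<open>d\<close> divides \<open>n div d\<close> of the numbers up to
  \<open>n\<close>. The range of summation extends to \<open>N\<close> so that \<open>n\<close> and \<open>2 n\<close> can be compared term by term.
\<close>
lemma ln_fact_eq_mangoldt_sum: 
  assumes "n \<le> N"
  shows "ln (fact n) = (\<Sum>d=1..N. mangoldt d * real (n div d))"
  using assms
proof (induction n)
  case (Suc n)
  have "ln (fact (Suc n)) = ln (real (Suc n)) + ln (fact n)"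
    by (simp add: ln_mult del: of_nat_Suc)
  also have "ln (real (Suc n)) = (\<Sum>d | d dvd Suc n. mangoldt d)"
    using mangoldt_sum[of "Suc n", where ?'a = real] by simp
  also have "\<dots> = (\<Sum>d\<in>{1..N}. if d dvd Suc n then mangoldt d else 0)"
    using Suc.prems by (subst sum.inter_filter[symmetric]) 
      (auto intro!: sum.cong dest: dvd_imp_le simp: Suc_le_eq intro: Nat.gr0I)
  also have "ln (fact n) = (\<Sum>d=1..N. mangoldt d * real (n div d))"
    using Suc by simp
  also have "(\<Sum>d\<in>{1..N}. if d dvd Suc n then mangoldt d else 0) + (\<Sum>d=1..N. mangoldt d * real (n div d)) =
             (\<Sum>d=1..N. mangoldt d * real (Suc n div d))"
    unfolding sum.distrib[symmetric]
    by (intro sum.cong) (auto simp: div_Suc dvd_eq_mod_eq_0 algebra_simps)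
  finally show ?case .
qed auto

text \<open>
  Chebyshev's argument: each \<open>d\<close> in \<open>(n, 2n]\<close> contributes its full weight to
  \<open>ln ((2n)! / n!\<^sup>2)\<close>, the other \<open>d\<close> contribute nonnegatively, and the central binomial coefficient is at
  most \<open>4 ^ n\<close>.
\<close>
lemma psi_double_le: "psi (2 * n) - psi n \<le> 2 * real n * ln 2"
proof -
  have "psi (2 * n) - psi n = (\<Sum>k\<in>{1..2*n}. if k \<in> {n<..2*n} then mangoldt k else 0)"
  proof -
    have "psi (2 * n) = psi n + (\<Sum>k\<in>{n<..2*n}. mangoldt k)"
      unfolding psi_def by (subst sum.union_disjoint[symmetric]) (auto intro!: sum.cong)
    moreover have "(\<Sum>k\<in>{n<..2*n}. mangoldt k :: real) = (\<Sum>k\<in>{1..2*n}. if k \<in> {n<..2*n} then mangoldt k else 0)"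
      by (subst sum.inter_filter[symmetric]) (auto intro!: sum.cong)
    ultimately show ?thesis by simp
  qed
  also have "\<dots> \<le> (\<Sum>d=1..2*n. mangoldt d * (real (2 * n div d) - 2 * real (n div d)))"
  proof (rule sum_mono)
    fix d assume d: "d \<in> {1..2*n}"
    have "2 * (n div d) * d \<le> 2 * n"
      using div_times_less_eq_dividend[of n d] by simp
    hence 1: "2 * (n div d) \<le> 2 * n div d"
      using d by (simp add: less_eq_div_iff_mult_less_eq)
    show "(if d \<in> {n<..2*n} then mangoldt d else 0) \<le> mangoldt d * (real (2 * n div d) - 2 * real (n div d))"
    proof (cases "d \<in> {n<..2*n}")
      case True
      hence "n div d = 0" "2 * n div d = 1" by (auto simp: div_nat_eqI)
      thus ?thesis using True by simp
    next
      case False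
      have "real (2 * (n div d)) \<le> real (2 * n div d)" using 1 of_nat_le_iff by blast
      thus ?thesis using False by (auto intro!: mult_nonneg_nonneg simp: mangoldt_nonneg)
    qed
  qed
  also have "\<dots> = (\<Sum>d=1..2*n. mangoldt d * real (2 * n div d)) - 2 * (\<Sum>d=1..2*n. mangoldt d * real (n div d))"
    by (simp add: right_diff_distrib sum_subtractf sum_distrib_left mult_ac)
  also have "\<dots> = ln (fact (2 * n)) - 2 * ln (fact n)"
    using ln_fact_eq_mangoldt_sum[of "2*n" "2*n"] ln_fact_eq_mangoldt_sum[of n "2*n"] by simp
  also have "\<dots> = ln (real (2 * n choose n))"
  proof -
    have "fact n * fact n * (2 * n choose n) = (fact (2 * n) :: nat)"
      using binomial_fact_lemma[of n "2*n"] by simp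
    hence "fact n * fact n * real (2 * n choose n) = fact (2 * n)"
      by (metis of_nat_fact of_nat_mult)
    hence "ln (fact (2 * n)) = ln (fact n * fact n * real (2 * n choose n))" by simp
    also have "\<dots> = 2 * ln (fact n) + ln (real (2 * n choose n))"
      by (simp add: ln_mult)
    finally show ?thesis by simp
  qed
  also have "\<dots> \<le> ln (2 ^ (2 * n))"
  proof -
    have "2 * n choose n \<le> (\<Sum>k\<le>2*n. 2 * n choose k)"
      by (rule member_le_sum) auto
    also have "\<dots> = 2 ^ (2 * n)" by (rule choose_row_sum)
    finally have "real (2 * n choose n) \<le> real (2 ^ (2 * n))" by (simp only: of_nat_le_iff)
    thus ?thesis by (simp add: ln_mono)
  qed
  also have "\<dots> = 2 * real n * ln 2" by (simp add: ln_realpow)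
  finally show ?thesis .
qed

lemma psi_le: "psi n \<le> 4 * real n"
proof (induction n rule: less_induct)
  case (less n)
  show ?case
  proof (cases "n \<le> 2")
    case True
    hence "n = 0 \<or> n = 1 \<or> n = 2" by linarith
    moreover have "mangoldt (Suc (Suc 0)) = ln (2::real)"
      using mangoldt_prime[OF two_is_prime_nat, where ?'a = real] by (simp add: numeral_2_eq_2)
    ultimately show ?thesis using ln_le_minus_one[of "2::real"]
      by (auto simp: psi_def numeral_2_eq_2)
  next
    case False
    define m where "m = (n + 1) div 2"
    have m: "m < n" "n \<le> 2 * m" "2 * m \<le> n + 1" using False by (auto simp: m_def)
    have "psi n \<le> psi (2 * m)" using m by (intro psi_mono)
    also have "\<dots> \<le> psi m + 2 * real m * ln 2" using psi_double_le[of m] by simp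
    also have "\<dots> \<le> 4 * real m + 2 * real m * 1"
      using less[OF m(1)] ln_le_minus_one[of "2::real"] by (intro add_mono mult_left_mono) auto
    also have "\<dots> \<le> 4 * real n" using m False by simp
    finally show ?thesis .
  qed
qed

definition psi_error :: "nat \<Rightarrow> real" where "psi_error n = psi n - real n"

lemma psi_error_bound: "\<bar>psi_error n\<bar> \<le> 4 * real n"
  using psi_le[of n] psi_nonneg[of n] by (auto simp: psi_error_def abs_if)

text \<open>
  Summation by parts of \<open>\<Sum> (mangoldt n - 1) n powr (-s)\<close> produces the differences
  \<open>n powr (-s) - (n + 1) powr (-s)\<close>, which are \<open>s n powr (-s - 1)\<close> up to \<^term>\<open>zterm n (s + 1)\<close>.
\<close>
lemma psi_error_series:
  fixes s :: complex
  assumes s: "Re s > 1"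
  defines "W \<equiv> (\<Sum>n. of_real (psi_error (Suc n)) * zterm (Suc n) (s + 1))"
  shows "(\<lambda>n. of_real (psi_error (Suc n) / real (Suc n)) * of_nat (Suc n) powr (-s)) sums
           ((mangoldt_series s - zeta_series s + W) / s)"
proof -
  define A where "A = (\<lambda>n. complex_of_real (psi_error n))"
  define u where "u = (\<lambda>n. complex_of_nat n powr (-s))"
  have "(\<lambda>n. mangoldt (Suc n) * u (Suc n) - u (Suc n)) sums (mangoldt_series s - zeta_series s)"
    unfolding mangoldt_series_def u_def
    using summable_norm_cancel[OF mangoldt_series_abs_summable[OF s]] summable_norm_cancel[OF zeta_series_abs_summable[OF s]]
    by (intro sums_diff summable_sums)
  also have "(\<lambda>n. mangoldt (Suc n) * u (Suc n) - u (Suc n)) = (\<lambda>n. (A (Suc n) - A n) * u (Suc n))"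
    by (simp add: A_def psi_error_def psi_Suc algebra_simps fun_eq_iff)
  finally have "(\<lambda>N. \<Sum>n<N. (A (Suc n) - A n) * u (Suc n)) \<longlonglongrightarrow> mangoldt_series s - zeta_series s"
    by (simp add: sums_def)
  moreover have "(\<lambda>N. A N * u (Suc N)) \<longlonglongrightarrow> 0"
  proof (rule Lim_null_comparison)
    show "\<forall>\<^sub>F N in sequentially. norm (A N * u (Suc N)) \<le> 4 * real (Suc N) powr (1 - Re s)"
    proof (intro always_eventually allI)
      fix N
      have "norm (A N * u (Suc N)) \<le> (4 * real (Suc N)) * real (Suc N) powr (-Re s)"
        unfolding norm_mult u_def norm_nat_powr[OF zero_less_Suc] A_def 
        using psi_error_bound[of N] by (intro mult_mono) auto
      also have "\<dots> = 4 * real (Suc N) powr (1 - Re s)"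
        using powr_add[of "real (Suc N)" 1 "-Re s"] by simp
      finally show "norm (A N * u (Suc N)) \<le> 4 * real (Suc N) powr (1 - Re s)" .
    qed
    have "(\<lambda>N. 4 * real N powr (1 - Re s)) \<longlonglongrightarrow> 4 * 0"
      using s by (intro tendsto_intros tendsto_neg_powr filterlim_real_sequentially) auto
    thus "(\<lambda>N. 4 * real (Suc N) powr (1 - Re s)) \<longlonglongrightarrow> 0"
      using LIMSEQ_Suc by fastforce
  qed
  ultimately have "(\<lambda>N. (\<Sum>n<N. (A (Suc n) - A n) * u (Suc n)) - A N * u (Suc N)) \<longlonglongrightarrow> mangoldt_series s - zeta_series s - 0"
    by (rule tendsto_diff)
  moreover have "(\<Sum>n<N. (A (Suc n) - A n) * u (Suc n)) - A N * u (Suc N) = (\<Sum>n<N. A (Suc n) * (u (Suc n) - u (Suc (Suc n))))" for N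
    by (induction N) (simp_all add: A_def psi_error_def algebra_simps)
  ultimately have 1: "(\<lambda>n. A (Suc n) * (u (Suc n) - u (Suc (Suc n)))) sums (mangoldt_series s - zeta_series s)"
    by (simp add: sums_def)
  have "summable (\<lambda>n. norm (A (Suc n) * zterm (Suc n) (s + 1)))"
    by (rule holomorphic_zterm_series(2)[of A 4 1]) (use psi_error_bound s in \<open>auto simp: A_def\<close>)
  hence 2: "(\<lambda>n. A (Suc n) * zterm (Suc n) (s + 1)) sums W"
    unfolding W_def A_def by (intro summable_sums) (rule summable_norm_cancel)
  have eq: "A (Suc n) * (u (Suc n) - u (Suc (Suc n))) + A (Suc n) * zterm (Suc n) (s + 1) =
          s * (of_real (psi_error (Suc n) / real (Suc n)) * of_nat (Suc n) powr (-s))" for n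
  proof -
    have e: "-1 - s = -s - 1" by simp
    have pw: "complex_of_nat (Suc n) powr (-1 - s) = of_nat (Suc n) powr (-s) / of_nat (Suc n)"
      unfolding e by (subst powr_diff) (simp del: of_nat_Suc)
    have zt: "zterm (Suc n) (s + 1) = s * complex_of_nat (Suc n) powr (-1 - s) + u (Suc (Suc n)) - u (Suc n)"
      by (simp add: zterm_def u_def algebra_simps del: of_nat_Suc)
    show ?thesis unfolding zt pw by (simp add: A_def u_def algebra_simps del: of_nat_Suc)
  qed
  have "s \<noteq> 0" using s by auto
  from sums_divide[OF sums_add[OF 1 2], of s] show ?thesis
    by (simp only: eq nonzero_mult_div_cancel_left[OF \<open>s \<noteq> 0\<close>])
qed

text \<open>
  This is the prime number theorem in the form of a convergent series. The Dirichlet series of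
  \<open>psi_error n / n\<close> continues across \<open>Re s = 1\<close>: the Mangoldt series minus the zeta function equals
  \<open>- F' / F - (F - 1) / (s - 1)\<close> for \<open>F\<close> = \<^const>\<open>szeta\<close>, where \<open>F\<close> has no zeros and \<open>F 1 = 1\<close> makes the
  second quotient regular. Newman's theorem applies.
\<close>
theorem psi_error_summable: "summable (\<lambda>n. psi_error (Suc n) / real (Suc n) ^ 2)"
proof -
  define Q where "Q = (\<lambda>s. if s = 1 then deriv szeta 1 else (szeta s - szeta 1) / (s - 1))"
  define W where "W = (\<lambda>s. \<Sum>n. complex_of_real (psi_error (Suc n)) * zterm (Suc n) s)"
  define G where "G = (\<lambda>s. (- deriv szeta s / szeta s - Q s + W (s + 1)) / s)"
  define U where "U = {s. Re s > 0} \<inter> szeta -` (-{0})"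
  have o: "open {s. Re s > 0}" by (rule open_halfspace_Re_gt)
  have U: "open U"
    unfolding U_def using holomorphic_on_imp_continuous_on[OF szeta_holomorphic] o
    by (intro continuous_open_preimage) auto
  have U1: "{z. Re z \<ge> 1} \<subseteq> U" using szeta_nonzero by (auto simp: U_def)
  have Q: "Q holomorphic_on {s. Re s > 0}"
    unfolding Q_def by (rule pole_lemma_open[OF szeta_holomorphic o])
  have W: "W holomorphic_on {s. Re s > 1}"
    unfolding W_def by (rule holomorphic_zterm_series(1)[of _ 4]) (use psi_error_bound in auto)
  have W': "(\<lambda>s. W (s + 1)) holomorphic_on {s. Re s > 0}"
    by (rule holomorphic_on_compose_gen[OF _ W, of "\<lambda>s. s + 1", unfolded o_def]) (auto intro!: holomorphic_intros)
  have D: "deriv szeta holomorphic_on {s. Re s > 0}" 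
    by (rule holomorphic_deriv[OF szeta_holomorphic o])
  have sub: "U \<subseteq> {s. Re s > 0}" by (auto simp: U_def)
  have G: "G holomorphic_on U"
    unfolding G_def using U holomorphic_on_subset[OF Q sub] holomorphic_on_subset[OF W' sub] holomorphic_on_subset[OF D sub]
      holomorphic_on_subset[OF szeta_holomorphic sub]
    by (intro holomorphic_intros) (auto simp: U_def)
  have "(\<lambda>n. complex_of_real (psi_error (Suc n) / real (Suc n)) / of_nat (Suc n)) sums G 1"
  proof (rule newman_tauberian[OF _ U U1 G])
    show "norm (complex_of_real (psi_error (Suc n) / real (Suc n))) \<le> 4" for n
      unfolding norm_of_real abs_divide
      using psi_error_bound[of "Suc n"] by (simp add: divide_le_eq del: of_nat_Suc)
    fix s assume s: "Re s > 1"
    have ne: "s \<noteq> 1" "szeta s \<noteq> 0" using s szeta_nonzero[of s] by auto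
    have "mangoldt_series s = 1 / (s - 1) - deriv szeta s / szeta s"
      using deriv_szeta[OF s] ne by (simp add: field_simps)
    moreover have "zeta_series s = szeta s / (s - 1)"
      using szeta_eq[OF s] ne by simp
    moreover have "Q s = szeta s / (s - 1) - 1 / (s - 1)"
      using ne by (simp add: Q_def szeta_1 diff_divide_distrib)
    ultimately have "G s = (mangoldt_series s - zeta_series s + W (s + 1)) / s"
      by (simp add: G_def)
    thus "(\<lambda>n. complex_of_real (psi_error (Suc n) / real (Suc n)) * of_nat (Suc n) powr (-s)) sums G s"
      using psi_error_series[OF s] by (simp add: W_def)
  qed
  from sums_Re[OF this] have "summable (\<lambda>n. Re (complex_of_real (psi_error (Suc n) / real (Suc n)) / of_nat (Suc n)))"
    by (rule sums_summable)
  moreover have "Re (complex_of_real (psi_error (Suc n) / real (Suc n)) / of_nat (Suc n)) = psi_error (Suc n) / real (Suc n) ^ 2" for n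
  proof -
    have "complex_of_real (psi_error (Suc n) / real (Suc n)) / of_nat (Suc n) = of_real (psi_error (Suc n) / real (Suc n) / real (Suc n))"
      by (simp del: of_nat_Suc)
    thus ?thesis by (simp add: power2_eq_square del: of_nat_Suc)
  qed
  ultimately show ?thesis by (simp only:)
qed

text \<open>
  Only proper prime powers \<open>p ^ j\<close> with \<open>j \<ge> 2\<close> contribute; they have \<open>p \<le> sqrt b\<close> and \<open>j \<le> log 2 b\<close>.
\<close>
lemma psi_increment_without_primes:
  assumes "a \<le> b" "b \<ge> 1" and no: "\<And>p. prime p \<Longrightarrow> \<not> (a < p \<and> p \<le> b)"
  shows "psi b - psi a \<le> (sqrt (real b) + 1) * (log 2 (real b) + 1) * ln (real b)"
proof -
  define P where "P = {k\<in>{a<..b}. primepow k}"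
  define I where "I = {..nat \<lfloor>sqrt (real b)\<rfloor>} \<times> {..nat \<lfloor>log 2 (real b)\<rfloor>}"
  have sub: "P \<subseteq> (\<lambda>(p, j). p ^ j) ` I"
  proof
    fix k assume "k \<in> P"
    then obtain p j where pj: "prime p" "j > 0" "k = p ^ j" and k: "a < k" "k \<le> b"
      by (auto simp: P_def primepow_def)
    have "j \<noteq> 1" using no[OF pj(1)] pj k by auto
    hence j: "j \<ge> 2" using pj by simp
    have p: "p \<ge> 2" using pj prime_ge_2_nat by blast
    have "p ^ 2 \<le> p ^ j" using p j by (intro power_increasing) auto
    hence "p ^ 2 \<le> b" using k pj by simp
    hence "real p ^ 2 \<le> real b" by (metis of_nat_le_iff of_nat_power)
    hence 1: "real p \<le> sqrt (real b)" by (rule real_le_rsqrt)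
    have "2 ^ j \<le> p ^ j" using p by (intro power_mono) auto
    from this k(2) have "2 ^ j \<le> b" unfolding pj(3) by (rule order_trans)
    hence "2 ^ j \<le> real b" by (metis of_nat_le_iff of_nat_numeral of_nat_power)
    hence 2: "real j \<le> log 2 (real b)" using assms(2) by (intro le_log_of_power) auto
    have "p \<le> nat \<lfloor>sqrt (real b)\<rfloor>" "j \<le> nat \<lfloor>log 2 (real b)\<rfloor>"
      using 1 2 by (auto simp: le_nat_floor)
    thus "k \<in> (\<lambda>(p, j). p ^ j) ` I" using pj by (auto simp: I_def intro!: image_eqI[of _ _ "(p, j)"])
  qed
  have cardP: "real (card P) \<le> (sqrt (real b) + 1) * (log 2 (real b) + 1)"
  proof -
    have "card P \<le> card ((\<lambda>(p, j). p ^ j) ` I)" using sub by (intro card_mono) (auto simp: I_def)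
    also have "\<dots> \<le> card I" by (intro card_image_le) (auto simp: I_def)
    also have "\<dots> = (nat \<lfloor>sqrt (real b)\<rfloor> + 1) * (nat \<lfloor>log 2 (real b)\<rfloor> + 1)" by (simp add: I_def)
    finally have "real (card P) \<le> real ((nat \<lfloor>sqrt (real b)\<rfloor> + 1) * (nat \<lfloor>log 2 (real b)\<rfloor> + 1))"
      by (simp only: of_nat_le_iff)
    also have "\<dots> = (real (nat \<lfloor>sqrt (real b)\<rfloor>) + 1) * (real (nat \<lfloor>log 2 (real b)\<rfloor>) + 1)"
      by (simp only: of_nat_mult of_nat_add of_nat_1)
    also have "\<dots> \<le> (sqrt (real b) + 1) * (log 2 (real b) + 1)"
      using assms(2) by (intro mult_mono add_mono of_nat_floor) auto
    finally show ?thesis .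
  qed
  have "psi b = psi a + (\<Sum>k\<in>{a<..b}. mangoldt k)"
    unfolding psi_def using assms(1) by (subst sum.union_disjoint[symmetric]) (auto intro!: sum.cong)
  also have "(\<Sum>k\<in>{a<..b}. mangoldt k :: real) = (\<Sum>k\<in>P. mangoldt k)"
    by (rule sum.mono_neutral_right) (auto simp: P_def mangoldt_def)
  also have "\<dots> \<le> (\<Sum>k\<in>P. ln (real b))"
  proof (rule sum_mono)
    fix k assume k: "k \<in> P"
    hence "k > 0" "k \<le> b" by (auto simp: P_def)
    thus "mangoldt k \<le> ln (real b)"
      using mangoldt_le[of k] by (intro order_trans[OF mangoldt_le]) auto
  qed
  also have "\<dots> = real (card P) * ln (real b)" by simp
  also have "\<dots> \<le> (sqrt (real b) + 1) * (log 2 (real b) + 1) * ln (real b)"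
    using cardP assms(2) by (intro mult_right_mono) auto
  finally show ?thesis by simp
qed

text \<open>
  Without primes in \<open>(n, (1 + d) n]\<close> the function \<^const>\<open>psi\<close> is nearly constant there. If its value is at
  least \<open>(1 + d / 2) n\<close>, then \<open>psi k - k\<close> is of order \<open>d n\<close> on the first quarter of the interval; otherwise
  \<open>k - psi k\<close> is of that order on the last quarter. Either way a block of the convergent series
  \<open>\<Sum> (psi k - k) / k\<^sup>2\<close> is bounded away from \<open>0\<close>, contradicting Cauchy's criterion.
\<close>
theorem eventually_prime_in_short_interval:
  fixes d :: real
  assumes d: "0 < d" "d \<le> 1"
  shows "\<forall>\<^sub>F n in sequentially. \<exists>p. prime p \<and> n < p \<and> real p \<le> (1 + d) * real n"
proof -
  define b where "b = (\<lambda>n. psi_error n / real n ^ 2)"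
  define h where "h = (\<lambda>x::real. (sqrt (2 * x) + 1) * (log 2 (2 * x) + 1) * ln (2 * x))"
  have "summable b"
    using psi_error_summable by (subst summable_Suc_iff[symmetric]) (simp add: b_def)
  then obtain N0 where N0: "\<And>m n. m \<ge> N0 \<Longrightarrow> \<bar>sum b {m..<n}\<bar> < d\<^sup>2 / 256"
    unfolding summable_Cauchy using d by (metis divide_pos_pos real_norm_def zero_less_numeral zero_less_power)
  have "\<forall>\<^sub>F x in at_top. h x \<le> (d / 8) * x"
    unfolding h_def using d by real_asymp
  hence "\<forall>\<^sub>F n in sequentially. h (real n) \<le> (d / 8) * real n"
    by (rule eventually_compose_filterlim[OF _ filterlim_real_sequentially])
  moreover have "\<forall>\<^sub>F n in sequentially. n \<ge> N0 \<and> real n \<ge> 8 / d \<and> n \<ge> 1"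
    using eventually_ge_at_top[of N0] eventually_ge_at_top[of "nat \<lceil>8 / d\<rceil>"] eventually_ge_at_top[of 1]
    by eventually_elim linarith
  ultimately show ?thesis
  proof eventually_elim
    case (elim n)
    hence n: "n \<ge> N0" "d * real n \<ge> 8" "n \<ge> 1" using d by (auto simp: field_simps)
    show ?case
    proof (rule ccontr)
      assume no: "\<not> (\<exists>p. prime p \<and> n < p \<and> real p \<le> (1 + d) * real n)"
      define E where "E = d / 8 * real n"
      have n2: "real k \<le> 2 * real n" if "real k \<le> (1 + d) * real n" for k
      proof -
        have "(1 + d) * real n \<le> 2 * real n" using d by (intro mult_right_mono) auto
        thus ?thesis using that by linarith
      qed
      have inc: "psi k \<le> psi n + E" if "n \<le> k" "real k \<le> (1 + d) * real n" for k
      proof -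
        have "psi k - psi n \<le> (sqrt (real k) + 1) * (log 2 (real k) + 1) * ln (real k)"
        proof (rule psi_increment_without_primes)
          fix p :: nat assume "prime p"
          thus "\<not> (n < p \<and> p \<le> k)" using no that by (meson of_nat_le_iff order_trans)
        qed (use that n in auto)
        also have "\<dots> \<le> h (real n)"
          unfolding h_def using n2[OF that(2)] n that(1) 
          by (intro mult_mono add_mono mult_nonneg_nonneg) auto
        also have "\<dots> \<le> E" using elim by (simp add: E_def)
        finally show ?thesis by simp
      qed
      define m where "m = nat \<lfloor>d * real n / 4\<rfloor>"
      have "real m > d * real n / 4 - 1" unfolding m_def by linarith
      hence m2: "real m \<ge> d * real n / 8" using n(2) by linarith
      have m1: "real m \<le> d * real n / 4"
        unfolding m_def using n(2) by (intro of_nat_floor) linarith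
      note m = m1 m2
      show False
      proof (cases "psi n \<ge> (1 + d / 2) * real n")
        case True
        have "d\<^sup>2 / 128 \<le> real m * (d / (16 * real n))"
        proof -
          have "d\<^sup>2 / 128 = (d * real n / 8) * (d / (16 * real n))"
            using n by (simp add: power2_eq_square)
          also have "\<dots> \<le> real m * (d / (16 * real n))" using m d by (intro mult_right_mono) auto
          finally show ?thesis .
        qed
        also have "\<dots> = (\<Sum>k=n..<n+m. d / (16 * real n))" by simp
        also have "\<dots> \<le> sum b {n..<n+m}"
        proof (rule sum_mono)
          fix k assume k: "k \<in> {n..<n+m}"
          hence k': "n \<le> k" "real k \<le> (1 + d / 4) * real n" using m by (auto simp: algebra_simps)
          have "(1 + d / 4) * real n \<le> (1 + d) * real n" using d by (intro mult_right_mono) auto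
          with k'(2) have k2: "real k \<le> 2 * real n" by (intro n2) (rule order_trans)
          have "psi_error k \<ge> d * real n / 4"
            using psi_mono[OF k'(1)] k'(2) True by (simp add: psi_error_def algebra_simps)
          hence "(d * real n / 4) / (2 * real n)\<^sup>2 \<le> psi_error k / real k ^ 2"
            using k2 n k' d by (intro frac_le power_mono) auto
          also have "(d * real n / 4) / (2 * real n)\<^sup>2 = d / (16 * real n)" using n by (simp add: power2_eq_square)
          finally show "d / (16 * real n) \<le> b k" by (simp add: b_def)
        qed
        also have "\<dots> < d\<^sup>2 / 256" using N0[of n "n + m"] n by linarith
        finally show False using d by simp
      next
        case False
        define l where "l = nat \<lceil>(1 + 3 * d / 4) * real n\<rceil>"
        define m' where "m' = nat \<lfloor>(1 + d) * real n\<rfloor>"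
        have l: "real l \<ge> (1 + 3 * d / 4) * real n" "real l \<le> (1 + 3 * d / 4) * real n + 1"
          using d by (auto simp: l_def) 
        have m': "real m' \<le> (1 + d) * real n" "real m' \<ge> (1 + d) * real n - 1"
          using d by (auto simp: m'_def)
        have "1 * real n \<le> (1 + 3 * d / 4) * real n" using d by (intro mult_right_mono) auto
        with l(1) have "real l \<ge> real n" by linarith
        hence ln: "l \<ge> n" by simp
        have cnt: "real (Suc m' - l) \<ge> d * real n / 8"
        proof -
          have "real (Suc m') - real l \<ge> d * real n / 8" using l m' n by (simp add: algebra_simps)
          thus ?thesis by linarith
        qed
        have "d\<^sup>2 / 256 \<le> real (Suc m' - l) * (d / (32 * real n))"
        proof -
          have "d\<^sup>2 / 256 = (d * real n / 8) * (d / (32 * real n))"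
            using n by (simp add: power2_eq_square)
          also have "\<dots> \<le> real (Suc m' - l) * (d / (32 * real n))" using cnt d by (intro mult_right_mono) auto
          finally show ?thesis .
        qed
        also have "\<dots> = (\<Sum>k=l..<Suc m'. d / (32 * real n))" by simp
        also have "\<dots> \<le> (\<Sum>k=l..<Suc m'. - b k)"
        proof (rule sum_mono)
          fix k assume k: "k \<in> {l..<Suc m'}"
          hence k': "n \<le> k" "real k \<le> (1 + d) * real n" using m' ln by auto
          have kl: "real k \<ge> (1 + 3 * d / 4) * real n" using k l by auto
          have k2: "real k \<le> 2 * real n" using n2 k' by blast
          have "- psi_error k \<ge> d * real n / 8"
            using inc[OF k'] kl False by (simp add: psi_error_def E_def algebra_simps)
          hence "(d * real n / 8) / (2 * real n)\<^sup>2 \<le> (- psi_error k) / real k ^ 2"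
            using k2 n k' d by (intro frac_le power_mono) auto
          also have "(d * real n / 8) / (2 * real n)\<^sup>2 = d / (32 * real n)" using n by (simp add: power2_eq_square)
          finally show "d / (32 * real n) \<le> - b k" by (simp add: b_def)
        qed
        also have "\<dots> = - sum b {l..<Suc m'}" by (simp add: sum_negf)
        also have "\<dots> < d\<^sup>2 / 256" using N0[of l "Suc m'"] n ln by linarith
        finally show False by simp
      qed
    qed
  qed
qed

text \<open>
  The form needed below: \<open>D\<close> may be arbitrarily small compared with \<open>m\<close>, and the prime still overshoots \<open>D / 2\<close>
  by at most a small multiple of \<open>m\<close>.
\<close>
lemma eventually_prime_near:
  fixes eps :: real
  assumes eps: "0 < eps" "eps \<le> 1"
  shows "\<forall>\<^sub>F m in sequentially. \<forall>D\<le>3*m. \<exists>p. prime p \<and> D < 2 * p \<and> 2 * real p \<le> real D + 2 * eps * real m"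
proof -
  obtain N where N: "\<And>n. n \<ge> N \<Longrightarrow> \<exists>p. prime p \<and> n < p \<and> real p \<le> (1 + eps / 4) * real n"
    using eventually_prime_in_short_interval[of "eps / 4"] eps by (auto simp: eventually_sequentially)
  have "\<forall>\<^sub>F m in sequentially. m \<ge> nat \<lceil>2 * (real N + 2) / eps\<rceil>" by (rule eventually_ge_at_top)
  thus ?thesis
  proof eventually_elim
    case (elim m)
    hence "real m \<ge> 2 * (real N + 2) / eps" by linarith
    hence m: "eps * real m / 2 \<ge> real N + 2" using eps by (simp add: field_simps)
    define t where "t = nat \<lfloor>eps * real m / 2\<rfloor>"
    have t: "real t \<le> eps * real m / 2" "t \<ge> N" "t \<ge> 1"
      using m by (auto simp: t_def le_nat_floor) linarith+
    show ?case
    proof (intro allI impI)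
      fix D assume D: "D \<le> 3 * m"
      define n where "n = D div 2 + t"
      obtain p where p: "prime p" "n < p" "real p \<le> (1 + eps / 4) * real n"
        using N[of n] t by (auto simp: n_def)
      have "D < 2 * p" using p(2) t(3) unfolding n_def by linarith
      have "real (D div 2) \<le> real D / 2" by linarith
      hence n1: "real n \<le> real D / 2 + eps * real m / 2" using t(1) by (simp add: n_def)
      have "eps * real m \<le> 1 * real m" using eps by (intro mult_right_mono) auto
      hence n2: "real n \<le> 2 * real m" using n1 D by linarith
      have "eps / 4 * real n \<le> eps / 4 * (2 * real m)" using n2 eps by (intro mult_left_mono) auto
      hence "2 * real p \<le> real D + 2 * eps * real m" using p(3) n1 by (simp add: algebra_simps)
      thus "\<exists>p. prime p \<and> D < 2 * p \<and> 2 * real p \<le> real D + 2 * eps * real m"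
        using p \<open>D < 2 * p\<close> by blast
    qed
  qed
qed

section \<open>The polynomial method for sign vectors\<close>

text \<open>
  The functions \<open>f w\<close> are linearly independent modulo \<open>p\<close>, since their matrix of values is
  diagonal with nonzero diagonal; hence there are at most as many of them as basis functions \<open>g e\<close>. In
  place of linear algebra over the field with \<open>p\<close> elements, the proof counts: if \<open>S\<close> were larger than \<open>E\<close>, two of
  the \<open>p ^ card S\<close> coefficient vectors would give linear combinations of the \<open>f w\<close> with the same
  coefficients modulo \<open>p\<close>, and their difference would be a nontrivial relation.
\<close>
lemma card_le_if_diagonal_mod_prime:
  fixes f :: "'a \<Rightarrow> 'a \<Rightarrow> int" and c :: "'a \<Rightarrow> 'e \<Rightarrow> int" and p :: nat
  assumes p: "prime p" and fin: "finite S" "finite E"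
    and f: "\<And>w v. w \<in> S \<Longrightarrow> v \<in> S \<Longrightarrow> f w v = (\<Sum>e\<in>E. c w e * g e v)"
    and diag: "\<And>w. w \<in> S \<Longrightarrow> \<not> int p dvd f w w"
    and off: "\<And>w v. w \<in> S \<Longrightarrow> v \<in> S \<Longrightarrow> w \<noteq> v \<Longrightarrow> int p dvd f w v"
  shows "card S \<le> card E"
proof (rule ccontr)
  assume "\<not> card S \<le> card E"
  hence less: "card E < card S" by simp
  have p1: "p > 1" using p prime_gt_1_nat by blast
  define L where "L = S \<rightarrow>\<^sub>E {0..<int p}"
  define \<Phi> where "\<Phi> = (\<lambda>l. \<lambda>e\<in>E. (\<Sum>w\<in>S. l w * c w e) mod int p)"
  have "\<Phi> ` L \<subseteq> E \<rightarrow>\<^sub>E {0..<int p}"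
    using p1 by (auto simp: \<Phi>_def)
  hence "card (\<Phi> ` L) \<le> card (E \<rightarrow>\<^sub>E {0..<int p})"
    using fin by (intro card_mono finite_PiE) auto
  also have "\<dots> = p ^ card E" using fin by (simp add: card_funcsetE)
  also have "\<dots> < p ^ card S" using p1 less by (intro power_strict_increasing) auto
  also have "\<dots> = card L" using fin by (simp add: L_def card_funcsetE)
  finally have "\<not> inj_on \<Phi> L" by (rule pigeonhole)
  then obtain l l' where l: "l \<in> L" "l' \<in> L" "l \<noteq> l'" "\<Phi> l = \<Phi> l'"
    unfolding inj_on_def by blast
  define \<mu> where "\<mu> = (\<lambda>w. l w - l' w)"
  obtain w0 where w0: "w0 \<in> S" "l w0 \<noteq> l' w0"
    using l PiE_ext[of l S _ l'] unfolding L_def by metis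
  have "l w0 \<in> {0..<int p}" "l' w0 \<in> {0..<int p}" using l w0 by (auto simp: L_def)
  hence "\<bar>\<mu> w0\<bar> < int p" "\<mu> w0 \<noteq> 0" using w0 by (auto simp: \<mu>_def)
  hence ndvd: "\<not> int p dvd \<mu> w0" using zdvd_not_zless[of "\<bar>\<mu> w0\<bar>" "int p"] by simp
  have coeff: "int p dvd (\<Sum>w\<in>S. \<mu> w * c w e)" if "e \<in> E" for e
  proof -
    have "\<Phi> l e = \<Phi> l' e" using l by simp
    hence "(\<Sum>w\<in>S. l w * c w e) mod int p = (\<Sum>w\<in>S. l' w * c w e) mod int p"
      using that by (simp add: \<Phi>_def)
    hence "int p dvd (\<Sum>w\<in>S. l w * c w e) - (\<Sum>w\<in>S. l' w * c w e)"
      by (simp add: mod_eq_dvd_iff)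
    thus ?thesis by (simp add: \<mu>_def left_diff_distrib sum_subtractf)
  qed
  have "(\<Sum>w\<in>S. \<mu> w * f w w0) = (\<Sum>w\<in>S. \<Sum>e\<in>E. \<mu> w * c w e * g e w0)"
    using f w0 by (intro sum.cong) (auto simp: sum_distrib_left mult_ac)
  also have "\<dots> = (\<Sum>e\<in>E. (\<Sum>w\<in>S. \<mu> w * c w e) * g e w0)"
    by (subst sum.swap) (simp add: sum_distrib_right)
  also have "int p dvd \<dots>" using coeff by (intro dvd_sum) auto
  finally have "int p dvd (\<Sum>w\<in>S. \<mu> w * f w w0)" .
  moreover have "(\<Sum>w\<in>S. \<mu> w * f w w0) = \<mu> w0 * f w0 w0 + (\<Sum>w\<in>S-{w0}. \<mu> w * f w w0)"
    using fin w0 by (simp add: sum.remove)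
  moreover have "int p dvd (\<Sum>w\<in>S-{w0}. \<mu> w * f w w0)"
    using off w0 by (intro dvd_sum) auto
  ultimately have "int p dvd \<mu> w0 * f w0 w0"
    by (simp add: dvd_add_left_iff)
  thus False using ndvd diag[OF w0(1)] p by (simp add: prime_dvd_mult_iff)
qed

definition sign_cube :: "nat \<Rightarrow> (nat \<Rightarrow> int) set" where
  "sign_cube m = {..<m} \<rightarrow>\<^sub>E {-1, 0, 1}"

text \<open>
  On sign vectors \<open>x ^ 3 = x\<close>, so only exponents up to \<open>2\<close> are needed to describe polynomial
  functions of total degree \<open>k\<close>.
\<close>
definition exponents :: "nat \<Rightarrow> nat \<Rightarrow> (nat \<Rightarrow> nat) set" where
  "exponents m k = {e \<in> {..<m} \<rightarrow>\<^sub>E {0, 1, 2}. (\<Sum>i<m. e i) \<le> k}"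

definition monomial :: "nat \<Rightarrow> (nat \<Rightarrow> nat) \<Rightarrow> (nat \<Rightarrow> int) \<Rightarrow> int" where
  "monomial m e v = (\<Prod>i<m. v i ^ e i)"

definition representable :: "nat \<Rightarrow> nat \<Rightarrow> ((nat \<Rightarrow> int) \<Rightarrow> int) \<Rightarrow> bool" where
  "representable m k f \<longleftrightarrow> (\<exists>c. \<forall>v\<in>sign_cube m. f v = (\<Sum>e\<in>exponents m k. c e * monomial m e v))"

lemma finite_exponents: "finite (exponents m k)"
  unfolding exponents_def by (rule finite_subset[of _ "{..<m} \<rightarrow>\<^sub>E {0, 1, 2}"]) (auto intro: finite_PiE)

lemma finite_sign_cube: "finite (sign_cube m)"
  unfolding sign_cube_def by (auto intro: finite_PiE)

lemma representable_cong:
  "representable m k f \<Longrightarrow> (\<And>v. v \<in> sign_cube m \<Longrightarrow> f v = g v) \<Longrightarrow> representable m k g"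
  unfolding representable_def by fastforce

lemma representable_monomial:
  assumes "e \<in> exponents m k"
  shows "representable m k (\<lambda>v. c * monomial m e v)"
  unfolding representable_def
proof (intro exI ballI)
  fix v
  show "c * monomial m e v = (\<Sum>e'\<in>exponents m k. (if e' = e then c else 0) * monomial m e' v)"
    using assms finite_exponents by (simp add: if_distrib[of "\<lambda>x. x * _"] sum.delta cong: if_cong)
qed

lemma representable_add:
  assumes "representable m k f" "representable m k g"
  shows "representable m k (\<lambda>v. f v + g v)"
proof -
  obtain c d where "\<forall>v\<in>sign_cube m. f v = (\<Sum>e\<in>exponents m k. c e * monomial m e v)"
    "\<forall>v\<in>sign_cube m. g v = (\<Sum>e\<in>exponents m k. d e * monomial m e v)"
    using assms unfolding representable_def by blast
  thus ?thesis unfolding representable_def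
    by (intro exI[of _ "\<lambda>e. c e + d e"]) (simp add: distrib_right sum.distrib)
qed

lemma representable_scale:
  assumes "representable m k f"
  shows "representable m k (\<lambda>v. a * f v)"
proof -
  obtain c where "\<forall>v\<in>sign_cube m. f v = (\<Sum>e\<in>exponents m k. c e * monomial m e v)"
    using assms unfolding representable_def by blast
  thus ?thesis unfolding representable_def
    by (intro exI[of _ "\<lambda>e. a * c e"]) (simp add: sum_distrib_left mult_ac)
qed

lemma representable_sum:
  assumes "finite A" "\<And>a. a \<in> A \<Longrightarrow> representable m k (f a)"
  shows "representable m k (\<lambda>v. \<Sum>a\<in>A. f a v)"
  using assms
proof (induction A rule: finite_induct)
  case empty
  show ?case unfolding representable_def by (intro exI[of _ "\<lambda>_. 0"]) simp
next
  case (insert a A)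
  have "representable m k (\<lambda>v. f a v + (\<Sum>a\<in>A. f a v))"
    using insert by (intro representable_add) auto
  thus ?case using insert by simp
qed

lemma representable_1: "representable m k (\<lambda>_. 1)"
proof -
  define e :: "nat \<Rightarrow> nat" where "e = (\<lambda>i\<in>{..<m}. 0)"
  have "e \<in> exponents m k" by (auto simp: e_def exponents_def)
  from representable_monomial[OF this, of 1] show ?thesis
    by (rule representable_cong) (auto simp: monomial_def e_def intro!: prod.neutral)
qed

text \<open>
  Multiplication by \<open>v i\<close> raises the exponent of \<open>v i\<close> by one, except that \<open>v i ^ 3\<close> is replaced by \<open>v i\<close>.
\<close>
lemma representable_mult_var:
  assumes "representable m k f" "i < m"
  shows "representable m (Suc k) (\<lambda>v. v i * f v)"
proof -
  obtain c where c: "\<forall>v\<in>sign_cube m. f v = (\<Sum>e\<in>exponents m k. c e * monomial m e v)"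
    using assms unfolding representable_def by blast
  define \<phi> where "\<phi> = (\<lambda>e. e(i := if e i = 2 then 1 else e i + 1 :: nat))"
  have \<phi>: "\<phi> e \<in> exponents m (Suc k)" if "e \<in> exponents m k" for e
  proof -
    have e: "e \<in> {..<m} \<rightarrow>\<^sub>E {0, 1, 2}" "(\<Sum>j<m. e j) \<le> k" using that by (auto simp: exponents_def)
    have in3: "e j \<in> {0, 1, 2}" if "j < m" for j using PiE_mem[OF e(1), of j] that by blast
    have "\<phi> e \<in> {..<m} \<rightarrow>\<^sub>E {0, 1, 2}"
    proof (rule PiE_I)
      show "\<phi> e j \<in> {0, 1, 2}" if "j \<in> {..<m}" for j
        using in3[of j] that by (auto simp: \<phi>_def)
      show "\<phi> e j = undefined" if "j \<notin> {..<m}" for j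
        using that assms(2) PiE_arb[OF e(1) that] by (auto simp: \<phi>_def)
    qed
    moreover have "(\<Sum>j<m. \<phi> e j) \<le> Suc (\<Sum>j<m. e j)"
    proof -
      have "(\<Sum>j<m. \<phi> e j) = \<phi> e i + (\<Sum>j\<in>{..<m}-{i}. \<phi> e j)"
        using assms(2) by (subst sum.remove[of _ i]) auto
      also have "(\<Sum>j\<in>{..<m}-{i}. \<phi> e j) = (\<Sum>j\<in>{..<m}-{i}. e j)"
        by (intro sum.cong) (auto simp: \<phi>_def)
      also have "\<phi> e i \<le> Suc (e i)" by (simp add: \<phi>_def)
      also have "Suc (e i) + (\<Sum>j\<in>{..<m}-{i}. e j) = Suc (\<Sum>j<m. e j)"
        using assms(2) by (subst sum.remove[of "{..<m}" i]) auto
      finally show ?thesis by simp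
    qed
    ultimately show ?thesis using e(2) by (simp add: exponents_def)
  qed
  have step: "v i * monomial m e v = monomial m (\<phi> e) v" if "e \<in> exponents m k" "v \<in> sign_cube m" for e v
  proof -
    have "v i \<in> {-1, 0, 1}" using that assms(2) by (auto simp: sign_cube_def PiE_def Pi_def)
    moreover have "e i \<in> {0, 1, 2}" using that assms(2) by (auto simp: exponents_def PiE_def Pi_def)
    ultimately have vi: "v i * v i ^ e i = v i ^ \<phi> e i" by (auto simp: \<phi>_def)
    have "monomial m e v = v i ^ e i * (\<Prod>j\<in>{..<m}-{i}. v j ^ e j)"
      unfolding monomial_def using assms(2) by (subst prod.remove[of _ i]) auto
    moreover have "monomial m (\<phi> e) v = v i ^ \<phi> e i * (\<Prod>j\<in>{..<m}-{i}. v j ^ \<phi> e j)"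
      unfolding monomial_def using assms(2) by (subst prod.remove[of _ i]) auto
    moreover have "(\<Prod>j\<in>{..<m}-{i}. v j ^ \<phi> e j) = (\<Prod>j\<in>{..<m}-{i}. v j ^ e j)"
      by (intro prod.cong) (auto simp: \<phi>_def)
    ultimately show ?thesis using vi by (metis mult.assoc)
  qed
  have "representable m (Suc k) (\<lambda>v. \<Sum>e\<in>exponents m k. c e * monomial m (\<phi> e) v)"
    using \<phi> by (intro representable_sum representable_monomial finite_exponents)
  thus ?thesis
  proof (rule representable_cong)
    fix v assume v: "v \<in> sign_cube m"
    have "v i * f v = (\<Sum>e\<in>exponents m k. v i * (c e * monomial m e v))"
      using c v by (simp add: sum_distrib_left)
    also have "\<dots> = (\<Sum>e\<in>exponents m k. c e * monomial m (\<phi> e) v)"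
      by (intro sum.cong refl) (simp add: step[OF _ v, symmetric] mult.left_commute)
    finally show "(\<Sum>e\<in>exponents m k. c e * monomial m (\<phi> e) v) = v i * f v" ..
  qed
qed

lemma representable_Suc: "representable m k f \<Longrightarrow> representable m (Suc k) f"
proof -
  assume "representable m k f"
  then obtain c where c: "\<forall>v\<in>sign_cube m. f v = (\<Sum>e\<in>exponents m k. c e * monomial m e v)"
    unfolding representable_def by blast
  have "representable m (Suc k) (\<lambda>v. \<Sum>e\<in>exponents m k. c e * monomial m e v)"
    by (intro representable_sum finite_exponents representable_monomial) (auto simp: exponents_def)
  thus "representable m (Suc k) f" by (rule representable_cong) (use c in auto)
qed

definition inner_int :: "nat \<Rightarrow> (nat \<Rightarrow> int) \<Rightarrow> (nat \<Rightarrow> int) \<Rightarrow> int" where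
  "inner_int m v w = (\<Sum>i<m. v i * w i)"

lemma representable_linear_prod:
  "representable m n (\<lambda>v. \<Prod>j=1..n. (K - inner_int m w v - int j))"
proof (induction n)
  case 0
  show ?case using representable_1 by simp
next
  case (Suc n)
  let ?f = "\<lambda>v. \<Prod>j=1..n. (K - inner_int m w v - int j)"
  have "representable m (Suc n) (\<lambda>v. (K - int (Suc n)) * ?f v + (\<Sum>i<m. (- w i) * (v i * ?f v)))"
    by (intro representable_add representable_scale representable_Suc representable_sum representable_mult_var Suc) auto
  thus ?case
  proof (rule representable_cong)
    fix v
    show "(K - int (Suc n)) * ?f v + (\<Sum>i<m. (- w i) * (v i * ?f v)) = (\<Prod>j=1..Suc n. (K - inner_int m w v - int j))"
      by (simp add: inner_int_def sum_distrib_right sum_negf algebra_simps)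
  qed
qed

text \<open>
  The Frankl--Wilson method. For \<open>d = K - inner_int m w v\<close> the polynomial \<open>\<Prod>j=1..p-1. (d - j)\<close> of
  degree \<open>p - 1\<close> is divisible by \<open>p\<close> unless \<open>p\<close> divides \<open>d\<close>. In the range \<open>0 \<le> d < 2 p\<close> this leaves
  \<open>d = 0\<close>, which is the diagonal, and the forbidden value \<open>d = p\<close>.
\<close>
lemma card_le_exponents_if_avoiding:
  assumes p: "prime p" and S: "S \<subseteq> sign_cube m"
    and K: "\<And>v. v \<in> S \<Longrightarrow> inner_int m v v = K"
    and range: "\<And>v w. v \<in> S \<Longrightarrow> w \<in> S \<Longrightarrow> v \<noteq> w \<Longrightarrow> 0 < K - inner_int m v w \<and> K - inner_int m v w < 2 * int p"
    and avoid: "\<And>v w. v \<in> S \<Longrightarrow> w \<in> S \<Longrightarrow> K - inner_int m v w \<noteq> int p"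
  shows "card S \<le> card (exponents m (p - 1))"
proof -
  define f where "f = (\<lambda>w v. \<Prod>j=1..p-1. (K - inner_int m w v - int j))"
  have "\<forall>w. \<exists>c. \<forall>v\<in>sign_cube m. f w v = (\<Sum>e\<in>exponents m (p-1). c e * monomial m e v)"
    using representable_linear_prod[of m "p-1" K] unfolding f_def representable_def by blast
  then obtain c where c: "\<And>w v. v \<in> sign_cube m \<Longrightarrow> f w v = (\<Sum>e\<in>exponents m (p-1). c w e * monomial m e v)"
    by metis
  have p1: "p > 1" using p prime_gt_1_nat by blast
  show ?thesis
  proof (rule card_le_if_diagonal_mod_prime[OF p, where f = f and c = c and g = "monomial m"])
    show "finite S" using S finite_sign_cube finite_subset by blast
    show "finite (exponents m (p - 1))" by (rule finite_exponents)
    show "f w v = (\<Sum>e\<in>exponents m (p-1). c w e * monomial m e v)" if "v \<in> S" for w v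
      using c that S by blast
    fix w assume w: "w \<in> S"
    show "\<not> int p dvd f w w"
    proof
      assume "int p dvd f w w"
      hence "\<exists>j\<in>{1..p-1}. int p dvd K - inner_int m w w - int j"
        unfolding f_def using p by (subst (asm) prime_dvd_prod_iff) auto
      then obtain j where j: "j \<in> {1..p-1}" "int p dvd - int j" using K[OF w] by auto
      hence "p dvd j" by simp
      thus False using j p1 by (auto dest: dvd_imp_le)
    qed
    fix v assume v: "v \<in> S" "w \<noteq> v"
    define d where "d = K - inner_int m w v"
    have d: "0 < d" "d < 2 * int p" "d \<noteq> int p" using range[OF w v] avoid[OF w v(1)] by (auto simp: d_def)
    define j where "j = nat (d mod int p)"
    have "d mod int p \<noteq> 0"
    proof
      assume "d mod int p = 0"
      then obtain q where q: "d = int p * q" by (auto elim: dvdE)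
      hence "q > 0" "q < 2" using d p1 by (auto simp: zero_less_mult_iff)
      hence "q = 1" by simp
      thus False using q d by simp
    qed
    moreover have "0 \<le> d mod int p" "d mod int p < int p" using p1 by auto
    ultimately have j: "j \<in> {1..p-1}" "int j = d mod int p" by (auto simp: j_def)
    have "int p dvd d - int j" unfolding j(2) by simp
    hence "int p dvd K - inner_int m w v - int j" by (simp add: d_def)
    also have "\<dots> dvd f w v" unfolding f_def using j by (intro dvd_prodI) auto
    finally show "int p dvd f w v" .
  qed
qed

text \<open>
  Rankin's trick: weight each exponent vector \<open>e\<close> by \<open>z ^ (\<Sum>i<m. e i)\<close>, which is at least \<open>z ^ k\<close> on the set,
  and sum over all exponent vectors.
\<close>
lemma card_exponents_le:
  fixes z :: real
  assumes z: "0 < z" "z \<le> 1"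
  shows "real (card (exponents m k)) * z ^ k \<le> (1 + z + z\<^sup>2) ^ m"
proof -
  have "real (card (exponents m k)) * z ^ k = (\<Sum>e\<in>exponents m k. z ^ k)" by simp
  also have "\<dots> \<le> (\<Sum>e\<in>exponents m k. \<Prod>i<m. z ^ e i)"
  proof (rule sum_mono)
    fix e assume "e \<in> exponents m k"
    hence "(\<Sum>i<m. e i) \<le> k" by (simp add: exponents_def)
    hence "z ^ k \<le> z ^ (\<Sum>i<m. e i)" using z by (intro power_decreasing) auto
    thus "z ^ k \<le> (\<Prod>i<m. z ^ e i)" by (simp add: power_sum)
  qed
  also have "\<dots> \<le> (\<Sum>e\<in>{..<m} \<rightarrow>\<^sub>E {0, 1, 2}. \<Prod>i<m. z ^ e i)"
  proof (rule sum_mono2)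
    show "finite ({..<m} \<rightarrow>\<^sub>E {0, 1, 2::nat})" by (intro finite_PiE) auto
    show "exponents m k \<subseteq> {..<m} \<rightarrow>\<^sub>E {0, 1, 2}" unfolding exponents_def by blast
    show "0 \<le> (\<Prod>i<m. z ^ e i)" for e using z by (intro prod_nonneg) auto
  qed
  also have "\<dots> = (\<Prod>i<m. \<Sum>t\<in>{0, 1, 2::nat}. z ^ t)"
    by (subst prod_sum_PiE) auto
  also have "\<dots> = (1 + z + z\<^sup>2) ^ m" by (simp add: add.assoc)
  finally show ?thesis .
qed

definition vectors_of_type :: "nat \<Rightarrow> nat \<Rightarrow> nat \<Rightarrow> (nat \<Rightarrow> int) set" where
  "vectors_of_type m a b = {v \<in> sign_cube m. card {i. i < m \<and> v i = 1} = a \<and> card {i. i < m \<and> v i = -1} = b}"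

lemma sum_indicator_lessThan:
  fixes m :: nat
  shows "(\<Sum>i<m. if P i then 1 else 0) = (of_nat (card {i. i < m \<and> P i}) :: int)"
proof -
  have "(\<Sum>i<m. if P i then 1 else 0) = (\<Sum>i\<in>{i\<in>{..<m}. P i}. 1 :: int)"
    by (subst sum.inter_filter) auto
  also have "{i\<in>{..<m}. P i} = {i. i < m \<and> P i}" by auto
  finally show ?thesis by simp
qed

lemma sign_cube_cases: "v \<in> sign_cube m \<Longrightarrow> i < m \<Longrightarrow> v i = -1 \<or> v i = 0 \<or> v i = 1"
  by (auto simp: sign_cube_def PiE_def Pi_def)

lemma inner_int_self_vectors_of_type:
  assumes "v \<in> vectors_of_type m a b"
  shows "inner_int m v v = int a + int b"
proof -
  have "inner_int m v v = (\<Sum>i<m. (if v i = 1 then 1 else 0) + (if v i = -1 then 1 else 0))"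
    unfolding inner_int_def using assms sign_cube_cases[of v m]
    by (intro sum.cong) (fastforce simp: vectors_of_type_def)+
  also have "\<dots> = int a + int b"
    using assms by (simp add: sum.distrib sum_indicator_lessThan vectors_of_type_def)
  finally show ?thesis .
qed

text \<open>
  A coordinate contributes \<open>-1\<close> to the inner product only where one of the vectors is \<open>-1\<close>, which happens at
  most \<open>2 b\<close> times.
\<close>
lemma inner_int_vectors_of_type_lower:
  assumes "v \<in> vectors_of_type m a b" "w \<in> vectors_of_type m a b"
  shows "int a + int b - inner_int m v w \<le> int a + 3 * int b"
proof -
  have "- inner_int m v w = (\<Sum>i<m. - (v i * w i))" by (simp add: inner_int_def sum_negf)
  also have "\<dots> \<le> (\<Sum>i<m. (if v i = -1 then 1 else 0) + (if w i = -1 then 1 else 0))"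
  proof (rule sum_mono)
    fix i assume "i \<in> {..<m}"
    hence "v i = -1 \<or> v i = 0 \<or> v i = 1" "w i = -1 \<or> w i = 0 \<or> w i = 1"
      using assms sign_cube_cases by (auto simp: vectors_of_type_def)
    thus "- (v i * w i) \<le> (if v i = -1 then 1 else 0) + (if w i = -1 then 1 else 0)" by auto
  qed
  also have "\<dots> = 2 * int b"
    using assms by (simp add: sum.distrib sum_indicator_lessThan vectors_of_type_def)
  finally show ?thesis by simp
qed

abbreviation sq_dist :: "nat \<Rightarrow> (nat \<Rightarrow> int) \<Rightarrow> (nat \<Rightarrow> int) \<Rightarrow> int" where
  "sq_dist m v w \<equiv> \<Sum>i<m. (v i - w i)\<^sup>2"

lemma sum_square_diff_vectors_of_type:
  assumes "v \<in> vectors_of_type m a b" "w \<in> vectors_of_type m a b"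
  shows "sq_dist m v w = 2 * (int a + int b - inner_int m v w)"
proof -
  have "sq_dist m v w = inner_int m v v + inner_int m w w - 2 * inner_int m v w"
    by (simp add: inner_int_def power2_diff sum.distrib sum_subtractf sum_distrib_left power2_eq_square algebra_simps)
  thus ?thesis using assms by (simp add: inner_int_self_vectors_of_type)
qed

text \<open>
  For vectors of the same type, half the squared distance is the integer \<open>d = a + b - inner_int m v w\<close>
  between \<open>0\<close> and \<open>a + 3 b\<close>. A prime above \<open>(a + 3 b) / 2\<close> therefore has no multiple among the possible values
  other than \<open>0\<close> and itself.
\<close>
lemma independent_vectors_of_type_card_le:
  assumes p: "prime p" "a + 3 * b < 2 * p" and S: "S \<subseteq> vectors_of_type m a b"
    and avoid: "\<And>v w. v \<in> S \<Longrightarrow> w \<in> S \<Longrightarrow> sq_dist m v w \<noteq> 2 * int p"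
  shows "card S \<le> card (exponents m (p - 1))"
proof (rule card_le_exponents_if_avoiding[OF p(1), where K = "int a + int b"])
  show "S \<subseteq> sign_cube m" using S by (auto simp: vectors_of_type_def)
  show "inner_int m v v = int a + int b" if "v \<in> S" for v
    using that S inner_int_self_vectors_of_type by blast
  fix v w assume vw: "v \<in> S" "w \<in> S"
  hence t: "v \<in> vectors_of_type m a b" "w \<in> vectors_of_type m a b" using S by auto
  show "int a + int b - inner_int m v w \<noteq> int p"
    using avoid[OF vw] sum_square_diff_vectors_of_type[OF t] by simp
  assume ne: "v \<noteq> w"
  have "sq_dist m v w \<noteq> 0"
  proof
    assume "sq_dist m v w = 0"
    hence "\<forall>i\<in>{..<m}. (v i - w i)\<^sup>2 = 0" by (subst (asm) sum_nonneg_eq_0_iff) auto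
    hence "v = w" using t by (intro PiE_ext[of v "{..<m}" _ w]) (auto simp: vectors_of_type_def sign_cube_def)
    thus False using ne by simp
  qed
  moreover have "sq_dist m v w \<ge> 0" by (intro sum_nonneg) auto
  ultimately have "sq_dist m v w > 0" by (simp add: order_less_le)
  hence "0 < 2 * (int a + int b - inner_int m v w)"
    by (simp only: sum_square_diff_vectors_of_type[OF t])
  hence "0 < int a + int b - inner_int m v w" by (simp only: zero_less_mult_iff) simp
  moreover have "int a + int b - inner_int m v w < 2 * int p"
    using inner_int_vectors_of_type_lower[OF t] p(2) by linarith
  ultimately show "0 < int a + int b - inner_int m v w \<and> int a + int b - inner_int m v w < 2 * int p" by blast
qed

text \<open>
  Expand \<open>(1 + x + x ^ 3) ^ m\<close> as a sum over sign vectors in which an entry \<open>1\<close> has weight \<open>x\<close> and an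
  entry \<open>-1\<close> has weight \<open>x ^ 3\<close>. All vectors of one type have the same weight \<open>x ^ (a + 3 b)\<close>, with
  the exponent that bounds half the squared distances, and there are at most \<open>(m + 1)\<^sup>2\<close> types. Choosing the
  type by averaging avoids entropy estimates for multinomial coefficients.
\<close>
lemma large_vectors_of_type_exists:
  fixes x :: real
  assumes x: "0 < x"
  obtains a b where "a + 3 * b \<le> 3 * m" "vectors_of_type m a b \<noteq> {}"
    "(1 + x + x ^ 3) ^ m \<le> real (card (vectors_of_type m a b)) * x ^ (a + 3 * b) * real (m + 1) ^ 2"
proof -
  define wt :: "int \<Rightarrow> real" where "wt = (\<lambda>t. if t = 1 then x else if t = -1 then x ^ 3 else 1)"
  have "(1 + x + x ^ 3) ^ m = (\<Prod>i<m. \<Sum>t\<in>{-1, 0, 1}. wt t)"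
    by (simp add: wt_def algebra_simps)
  also have "\<dots> = (\<Sum>v\<in>sign_cube m. \<Prod>i<m. wt (v i))"
    unfolding sign_cube_def by (subst prod_sum_PiE) auto
  also have "\<dots> = (\<Sum>ab\<in>{..m} \<times> {..m}. \<Sum>v\<in>{v\<in>sign_cube m. (card {i. i < m \<and> v i = 1}, card {i. i < m \<and> v i = -1}) = ab}. \<Prod>i<m. wt (v i))"
  proof (rule sum.group[symmetric])
    have "card {i. i < m \<and> P i} \<le> m" for P
      using card_mono[of "{..<m}" "{i. i < m \<and> P i}"] by auto
    thus "(\<lambda>v. (card {i. i < m \<and> v i = 1}, card {i. i < m \<and> v i = -1})) ` sign_cube m \<subseteq> {..m} \<times> {..m}"
      by auto
  qed (auto simp: finite_sign_cube)
  also have "\<dots> = (\<Sum>ab\<in>{..m} \<times> {..m}. real (card (vectors_of_type m (fst ab) (snd ab))) * x ^ (fst ab + 3 * snd ab))"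
  proof (rule sum.cong[OF refl])
    fix ab :: "nat \<times> nat"
    obtain a b where ab: "ab = (a, b)" by (cases ab)
    have "{v\<in>sign_cube m. (card {i. i < m \<and> v i = 1}, card {i. i < m \<and> v i = -1}) = ab} = vectors_of_type m a b"
      by (auto simp: vectors_of_type_def ab)
    moreover have "(\<Prod>i<m. wt (v i)) = x ^ (a + 3 * b)" if "v \<in> vectors_of_type m a b" for v
    proof -
      have "(\<Prod>i<m. wt (v i)) = (\<Prod>i<m. (if v i = 1 then x else 1) * (if v i = -1 then x ^ 3 else 1))"
        by (intro prod.cong) (auto simp: wt_def)
      also have "\<dots> = (\<Prod>i\<in>{i\<in>{..<m}. v i = 1}. x) * (\<Prod>i\<in>{i\<in>{..<m}. v i = -1}. x ^ 3)"
        by (simp add: prod.distrib flip: prod.inter_filter)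
      also have "\<dots> = x ^ card {i\<in>{..<m}. v i = 1} * (x ^ 3) ^ card {i\<in>{..<m}. v i = -1}" by simp
      also have "{i\<in>{..<m}. v i = 1} = {i. i < m \<and> v i = 1}" by auto
      also have "{i\<in>{..<m}. v i = -1} = {i. i < m \<and> v i = -1}" by auto
      finally show ?thesis using that by (simp add: vectors_of_type_def power_add power_mult)
    qed
    ultimately show "(\<Sum>v\<in>{v\<in>sign_cube m. (card {i. i < m \<and> v i = 1}, card {i. i < m \<and> v i = -1}) = ab}. \<Prod>i<m. wt (v i)) =
       real (card (vectors_of_type m (fst ab) (snd ab))) * x ^ (fst ab + 3 * snd ab)"
      by (simp add: ab)
  qed
  finally have eq: "(1 + x + x ^ 3) ^ m = \<dots>" .
  have "\<exists>ab\<in>{..m} \<times> {..m}. (1 + x + x ^ 3) ^ m \<le> real (card (vectors_of_type m (fst ab) (snd ab))) * x ^ (fst ab + 3 * snd ab) * real (m + 1) ^ 2"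
  proof (rule ccontr)
    assume "\<not> ?thesis"
    hence "real (card (vectors_of_type m (fst ab) (snd ab))) * x ^ (fst ab + 3 * snd ab) < (1 + x + x ^ 3) ^ m / real (m + 1) ^ 2"
      if "ab \<in> {..m} \<times> {..m}" for ab
      using that by (auto simp: not_le field_simps)
    hence "(\<Sum>ab\<in>{..m} \<times> {..m}. real (card (vectors_of_type m (fst ab) (snd ab))) * x ^ (fst ab + 3 * snd ab)) <
           (\<Sum>ab\<in>{..m} \<times> {..m}. (1 + x + x ^ 3) ^ m / real (m + 1) ^ 2)"
      by (intro sum_strict_mono) auto
    also have "\<dots> = real (card ({..m} \<times> {..m})) * ((1 + x + x ^ 3) ^ m / real (m + 1) ^ 2)" by simp
    also have "real (card ({..m} \<times> {..m})) = real (m + 1) ^ 2" by (simp add: power2_eq_square algebra_simps)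
    also have "real (m + 1) ^ 2 * ((1 + x + x ^ 3) ^ m / real (m + 1) ^ 2) = (1 + x + x ^ 3) ^ m" by simp
    finally show False using eq by simp
  qed
  then obtain a b where ab: "(1 + x + x ^ 3) ^ m \<le> real (card (vectors_of_type m a b)) * x ^ (a + 3 * b) * real (m + 1) ^ 2"
    by auto
  have "(1 + x + x ^ 3) ^ m > 0" using x by (intro zero_less_power add_pos_pos) auto
  hence ne: "vectors_of_type m a b \<noteq> {}" using ab by auto
  then obtain v where v: "v \<in> vectors_of_type m a b" by blast
  have "a + b = card ({i. i < m \<and> v i = 1} \<union> {i. i < m \<and> v i = -1})"
    using v by (subst card_Un_disjoint) (auto simp: vectors_of_type_def)
  also have "\<dots> \<le> card {..<m}" by (intro card_mono) auto
  finally have "a + 3 * b \<le> 3 * m" by simp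
  with that ne ab show ?thesis by blast
qed

abbreviation psi2_ratio :: "real \<Rightarrow> real" where
  "psi2_ratio x \<equiv> (1 + x + x ^ 3) / (1 + x\<^sup>2 + x ^ 4)"

text \<open>
  Raigorodskii's set of points in dimension \<open>m\<close>: a set without two points at distance \<open>sqrt (2 p)\<close>
  contains at most a fraction of about \<open>B powr (-m)\<close> of \<open>V\<close>. Counting exponent vectors with the weight \<open>z = x\<^sup>2\<close> gives the
  factor \<open>x ^ (2 p)\<close>, which matches the factor \<open>x ^ D\<close> from the size of \<open>V\<close> up to the error
  \<open>x powr (2 eps m)\<close> caused by the gap between \<open>D\<close> and \<open>2 p\<close>. This is why primes in short intervals are needed.
\<close>
lemma avoiding_family_exists:
  fixes x eps :: real
  assumes x: "0 < x" "x \<le> 1" and eps: "0 < eps" "eps \<le> 1"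
  defines "B \<equiv> psi2_ratio x * x powr (2 * eps)"
  shows "\<forall>\<^sub>F m in sequentially. \<exists>V p. V \<subseteq> sign_cube m \<and> V \<noteq> {} \<and> p > 0 \<and>
           (\<forall>S\<subseteq>V. (\<forall>v\<in>S. \<forall>w\<in>S. sq_dist m v w \<noteq> 2 * int p) \<longrightarrow>
              real (card S) * B ^ m \<le> real (m + 1) ^ 2 * real (card V))"
  using eventually_prime_near[OF eps]
proof eventually_elim
  case (elim m)
  let ?P = "1 + x + x ^ 3" and ?Q = "1 + x\<^sup>2 + x ^ 4"
  obtain a b where ab: "a + 3 * b \<le> 3 * m" "vectors_of_type m a b \<noteq> {}"
    "?P ^ m \<le> real (card (vectors_of_type m a b)) * x ^ (a + 3 * b) * real (m + 1) ^ 2"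
    by (rule large_vectors_of_type_exists[OF x(1)])
  define D where "D = a + 3 * b"
  define V where "V = vectors_of_type m a b"
  obtain p where p: "prime p" "D < 2 * p" "2 * real p \<le> real D + 2 * eps * real m"
    using elim ab(1) unfolding D_def by blast
  have pos: "?P > 0" "?Q > 0" using x by (auto intro!: add_pos_pos)
  have p0: "p > 0" using p(1) by (rule prime_gt_0_nat)
  have "real (card S) * B ^ m \<le> real (m + 1) ^ 2 * real (card V)"
    if S: "S \<subseteq> V" "\<forall>v\<in>S. \<forall>w\<in>S. sq_dist m v w \<noteq> 2 * int p" for S
  proof -
    have "card S \<le> card (exponents m (p - 1))"
      using S p unfolding V_def D_def by (intro independent_vectors_of_type_card_le[of p a b]) auto
    hence "real (card S) * (x\<^sup>2) ^ (p - 1) \<le> real (card (exponents m (p - 1))) * (x\<^sup>2) ^ (p - 1)"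
      using x by (intro mult_right_mono) auto
    also have "\<dots> \<le> (1 + x\<^sup>2 + (x\<^sup>2)\<^sup>2) ^ m"
      using x by (intro card_exponents_le) (auto simp: power_le_one)
    finally have 1: "real (card S) * (x\<^sup>2) ^ (p - 1) \<le> ?Q ^ m" by simp
    have "x ^ D * (x powr (2 * eps)) ^ m = x powr (real D + 2 * eps * real m)"
      using x by (simp add: powr_add powr_realpow powr_powr flip: powr_realpow)
    also have "\<dots> \<le> x powr (2 * real p)"
      using x p(3) by (intro powr_mono') auto
    also have "\<dots> = (x\<^sup>2) ^ p"
      using x powr_realpow[of x "2 * p"] by (simp add: power_mult)
    also have "\<dots> \<le> (x\<^sup>2) ^ (p - 1)"
      using x by (intro power_decreasing) (auto simp: power_le_one)
    finally have 2: "x ^ D * (x powr (2 * eps)) ^ m \<le> (x\<^sup>2) ^ (p - 1)" .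
    have 3: "real (card S) * (x ^ D * (x powr (2 * eps)) ^ m) \<le> ?Q ^ m"
      using mult_left_mono[OF 2, of "real (card S)"] 1 by simp
    have "real (card S) * B ^ m = real (card S) * (x powr (2 * eps)) ^ m / ?Q ^ m * ?P ^ m"
      by (simp add: B_def power_mult_distrib power_divide)
    also have "\<dots> \<le> real (card S) * (x powr (2 * eps)) ^ m / ?Q ^ m * (real (card V) * x ^ D * real (m + 1) ^ 2)"
      using ab(3) pos unfolding V_def D_def by (intro mult_left_mono) auto
    also have "\<dots> = (real (card S) * (x ^ D * (x powr (2 * eps)) ^ m)) / ?Q ^ m * (real (m + 1) ^ 2 * real (card V))"
      by simp
    also have "\<dots> \<le> 1 * (real (m + 1) ^ 2 * real (card V))"
      using 3 pos by (intro mult_right_mono) (auto simp: divide_le_eq)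
    finally show ?thesis by simp
  qed
  moreover have "V \<subseteq> sign_cube m" by (auto simp: V_def vectors_of_type_def)
  ultimately show ?case using ab(2) p0 unfolding V_def by (intro exI[of _ "vectors_of_type m a b"] exI[of _ p]) auto
qed

section \<open>Corners in products\<close>

text \<open>
  Call \<open>x \<in> C\<close> bad in direction \<open>j\<close> if \<open>C\<close> contains no neighbour of \<open>x\<close> that differs from \<open>x\<close> only in
  coordinate \<open>j\<close>. On each line in direction \<open>j\<close> the bad points form an independent set, so there are at most
  \<open>\<alpha>\<close> of them per line. A point that is bad in no direction is the apex of a corner.
\<close>
lemma corner_exists:
  fixes V :: "'a set" and k :: nat and \<alpha> :: real
  assumes V: "finite V" and C: "C \<subseteq> {..<k} \<rightarrow>\<^sub>E V"
    and indep: "\<And>S. S \<subseteq> V \<Longrightarrow> (\<forall>v\<in>S. \<forall>w\<in>S. \<not> adj v w) \<Longrightarrow> real (card S) \<le> \<alpha>"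
    and big: "real (card C) > real k * \<alpha> * real (card V) ^ (k - 1)"
  obtains x y where "x \<in> C" "\<And>j. j < k \<Longrightarrow> adj (x j) (y j) \<and> x(j := y j) \<in> C"
proof -
  define bad where "bad = (\<lambda>j. {x\<in>C. \<forall>y. adj (x j) y \<longrightarrow> x(j := y) \<notin> C})"
  have finC: "finite C" using C by (rule finite_subset) (use V in \<open>auto intro: finite_PiE\<close>)
  have card_bad: "real (card (bad j)) \<le> \<alpha> * real (card V) ^ (k - 1)" if j: "j < k" for j
  proof -
    define r where "r = (\<lambda>x :: nat \<Rightarrow> 'a. restrict x ({..<k} - {j}))"
    let ?Z = "({..<k} - {j}) \<rightarrow>\<^sub>E V"
    have finZ: "finite ?Z" using V by (intro finite_PiE) auto
    have "card (bad j) = (\<Sum>x\<in>bad j. 1)" by simp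
    also have "\<dots> = (\<Sum>z\<in>?Z. \<Sum>x\<in>{x\<in>bad j. r x = z}. 1)"
    proof (rule sum.group[symmetric])
      show "finite (bad j)" using finC by (simp add: bad_def)
      show "r ` bad j \<subseteq> ?Z" using C by (force simp: r_def bad_def PiE_iff)
    qed (rule finZ)
    finally have "real (card (bad j)) = (\<Sum>z\<in>?Z. real (card {x\<in>bad j. r x = z}))" by simp
    also have "\<dots> \<le> (\<Sum>z\<in>?Z. \<alpha>)"
    proof (rule sum_mono)
      fix z
      let ?F = "{x\<in>bad j. r x = z}"
      have upd: "w = v(j := w j)" if "v \<in> ?F" "w \<in> ?F" for v w
      proof
        fix i
        have vw: "v \<in> {..<k} \<rightarrow>\<^sub>E V" "w \<in> {..<k} \<rightarrow>\<^sub>E V" using that C by (auto simp: bad_def)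
        have "r v i = r w i" using that by simp
        thus "w i = (v(j := w j)) i"
          using PiE_arb[OF vw(1), of i] PiE_arb[OF vw(2), of i] by (auto simp: r_def restrict_def split: if_splits)
      qed
      have "inj_on (\<lambda>x. x j) ?F"
      proof (rule inj_onI)
        fix v w assume vw: "v \<in> ?F" "w \<in> ?F" "v j = w j"
        show "v = w" using upd[OF vw(1,2)] vw(3) by (metis fun_upd_triv)
      qed
      hence "card ?F = card ((\<lambda>x. x j) ` ?F)" by (simp add: card_image)
      moreover have "real (card ((\<lambda>x. x j) ` ?F)) \<le> \<alpha>"
      proof (rule indep)
        show "(\<lambda>x. x j) ` ?F \<subseteq> V" using C j by (force simp: bad_def PiE_iff)
        show "\<forall>v\<in>(\<lambda>x. x j) ` ?F. \<forall>w\<in>(\<lambda>x. x j) ` ?F. \<not> adj v w"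
        proof safe
          fix v w assume vw: "v \<in> bad j" "w \<in> bad j" "r w = r v" "z = r v" and adj: "adj (v j) (w j)"
          have "v(j := w j) = w" using upd[of v w] vw by simp
          moreover have "v(j := w j) \<notin> C" using vw(1) adj by (auto simp: bad_def)
          ultimately show False using vw(2) by (auto simp: bad_def)
        qed
      qed
      ultimately show "real (card ?F) \<le> \<alpha>" by simp
    qed
    also have "\<dots> = real (card ?Z) * \<alpha>" by simp
    also have "card ?Z = card V ^ (k - 1)" using j by (simp add: card_funcsetE)
    finally show ?thesis by (simp add: mult.commute)
  qed
  have "C - (\<Union>j<k. bad j) \<noteq> {}"
  proof
    assume "C - (\<Union>j<k. bad j) = {}"
    hence "card C \<le> card (\<Union>j<k. bad j)" by (intro card_mono) (auto simp: bad_def finC)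
    also have "\<dots> \<le> (\<Sum>j<k. card (bad j))" by (intro card_UN_le) auto
    finally have "real (card C) \<le> real (\<Sum>j<k. card (bad j))" by (simp only: of_nat_le_iff)
    also have "\<dots> = (\<Sum>j<k. real (card (bad j)))" by simp
    also have "\<dots> \<le> (\<Sum>j<k. \<alpha> * real (card V) ^ (k - 1))" by (intro sum_mono card_bad) auto
    also have "\<dots> = real k * \<alpha> * real (card V) ^ (k - 1)" by simp
    finally show False using big by simp
  qed
  then obtain x where x: "x \<in> C" "\<And>j. j < k \<Longrightarrow> x \<notin> bad j" by blast
  hence "\<forall>j. \<exists>y. j < k \<longrightarrow> adj (x j) y \<and> x(j := y) \<in> C" by (auto simp: bad_def)
  then obtain y where "\<And>j. j < k \<Longrightarrow> adj (x j) (y j) \<and> x(j := y j) \<in> C" by metis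
  with x(1) show ?thesis by (rule that)
qed

text \<open>
  The product of \<open>k\<close> copies of a configuration in dimension \<open>m\<close>, the \<open>j\<close>-th copy scaled by \<open>s j\<close> and placed in the
  coordinates \<open>j * m, \<dots>, j * m + m - 1\<close>.
\<close>
definition block_point :: "nat \<Rightarrow> nat \<Rightarrow> (nat \<Rightarrow> real) \<Rightarrow> (nat \<Rightarrow> nat \<Rightarrow> int) \<Rightarrow> nat \<Rightarrow> real" where
  "block_point m k s x = (\<lambda>i. if i < k * m then s (i div m) * real_of_int (x (i div m) (i mod m)) else 0)"

lemma block_point_in_Euclidean_space:
  "k * m \<le> n \<Longrightarrow> block_point m k s x \<in> topspace (Euclidean_space n)"
  by (auto simp: topspace_Euclidean_space block_point_def)

lemma euclid_dist_block_point:
  assumes "k * m \<le> n"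
  shows "euclid_dist n (block_point m k s x) (block_point m k s y) =
           sqrt (\<Sum>j<k. (s j)\<^sup>2 * real_of_int (\<Sum>i<m. (x j i - y j i)\<^sup>2))"
proof -
  let ?d = "\<lambda>i. (block_point m k s x i - block_point m k s y i)\<^sup>2"
  have "(\<Sum>i<n. ?d i) = (\<Sum>i<k*m. ?d i)"
    using assms by (intro sum.mono_neutral_right) (auto simp: block_point_def)
  also have "\<dots> = (\<Sum>j<k. \<Sum>i = j * m..<j * m + m. ?d i)"
    by (rule sum.nat_group[symmetric])
  also have "\<dots> = (\<Sum>j<k. (s j)\<^sup>2 * real_of_int (\<Sum>i<m. (x j i - y j i)\<^sup>2))"
  proof (rule sum.cong[OF refl])
    fix j assume j: "j \<in> {..<k}"
    have "(\<Sum>i = j * m..<j * m + m. ?d i) = (\<Sum>i<m. ?d (i + j * m))"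
      using sum.shift_bounds_nat_ivl[of ?d 0 "j * m" m] by (simp add: atLeast0LessThan add.commute)
    also have "\<dots> = (\<Sum>i<m. (s j)\<^sup>2 * real_of_int ((x j i - y j i)\<^sup>2))"
    proof (rule sum.cong[OF refl])
      fix i assume i: "i \<in> {..<m}"
      have "i + j * m < Suc j * m" using i by simp
      also have "\<dots> \<le> k * m" using j by (intro mult_right_mono) auto
      finally have "i + j * m < k * m" .
      moreover have "(i + j * m) div m = j" "(i + j * m) mod m = i" using i by auto
      ultimately show "?d (i + j * m) = (s j)\<^sup>2 * real_of_int ((x j i - y j i)\<^sup>2)"
        by (simp add: block_point_def power_mult_distrib flip: right_diff_distrib)
    qed
    finally show "(\<Sum>i = j * m..<j * m + m. ?d i) = (s j)\<^sup>2 * real_of_int (\<Sum>i<m. (x j i - y j i)\<^sup>2)"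
      by (simp add: sum_distrib_left)
  qed
  finally show ?thesis by (simp add: euclid_dist_def L2_set_def)
qed

lemma euclid_dist_corner:
  fixes y :: "nat \<Rightarrow> nat \<Rightarrow> int"
  assumes n: "k * m \<le> n" and p: "p > 0" and s: "\<And>j. s j = c j / sqrt (2 * real p)"
    and y: "\<And>j. j < k \<Longrightarrow> (\<Sum>i<m. (x j i - y j i)\<^sup>2) = 2 * int p"
  shows "j < k \<Longrightarrow> euclid_dist n (block_point m k s x) (block_point m k s (x(j := y j))) = sqrt ((c j)\<^sup>2)"
    and "j < k \<Longrightarrow> j' < k \<Longrightarrow> j \<noteq> j' \<Longrightarrow> 
      euclid_dist n (block_point m k s (x(j := y j))) (block_point m k s (x(j' := y j'))) = sqrt ((c j)\<^sup>2 + (c j')\<^sup>2)"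
proof -
  have sc: "(s j)\<^sup>2 * real_of_int (2 * int p) = (c j)\<^sup>2" for j
    using p by (simp add: s power_divide)
  show "euclid_dist n (block_point m k s x) (block_point m k s (x(j := y j))) = sqrt ((c j)\<^sup>2)" if "j < k"
  proof -
    have "(\<Sum>l<k. (s l)\<^sup>2 * real_of_int (\<Sum>i<m. (x l i - (x(j := y j)) l i)\<^sup>2)) = 
          (\<Sum>l<k. if l = j then (c j)\<^sup>2 else 0)"
    proof (rule sum.cong[OF refl])
      fix l
      show "(s l)\<^sup>2 * real_of_int (\<Sum>i<m. (x l i - (x(j := y j)) l i)\<^sup>2) = (if l = j then (c j)\<^sup>2 else 0)"
        by (cases "l = j") (simp_all add: y[OF that] sc[simplified] del: of_int_sum)
    qed
    thus ?thesis using that by (simp add: euclid_dist_block_point[OF n] del: of_int_sum)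
  qed
  show "euclid_dist n (block_point m k s (x(j := y j))) (block_point m k s (x(j' := y j'))) = sqrt ((c j)\<^sup>2 + (c j')\<^sup>2)"
    if "j < k" "j' < k" "j \<noteq> j'"
  proof -
    have y': "(\<Sum>i<m. (y j i - x j i)\<^sup>2) = 2 * int p" using y[OF that(1)] by (simp add: power2_commute)
    have "(\<Sum>l<k. (s l)\<^sup>2 * real_of_int (\<Sum>i<m. ((x(j := y j)) l i - (x(j' := y j')) l i)\<^sup>2)) = 
          (\<Sum>l<k. (if l = j then (c j)\<^sup>2 else 0) + (if l = j' then (c j')\<^sup>2 else 0))"
    proof (rule sum.cong[OF refl])
      fix l
      show "(s l)\<^sup>2 * real_of_int (\<Sum>i<m. ((x(j := y j)) l i - (x(j' := y j')) l i)\<^sup>2) =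
          (if l = j then (c j)\<^sup>2 else 0) + (if l = j' then (c j')\<^sup>2 else 0)"
        using that(3) by (cases "l = j"; cases "l = j'") (simp_all add: y[OF that(2)] y' sc[simplified] del: of_int_sum)
    qed
    thus ?thesis using that by (simp add: euclid_dist_block_point[OF n] sum.distrib del: of_int_sum)
  qed
qed

section \<open>Triangles in orthogonal corners\<close>

text \<open>
  The points \<open>Q j\<close> are obtained from the apex \<open>P\<close> by steps of length \<open>c j\<close> in pairwise orthogonal
  directions.
\<close>
definition orthogonal_corner :: "nat \<Rightarrow> nat \<Rightarrow> (nat \<Rightarrow> real) \<Rightarrow> (nat \<Rightarrow> real) \<Rightarrow> (nat \<Rightarrow> nat \<Rightarrow> real) \<Rightarrow> bool" where
  "orthogonal_corner n k c P Q \<longleftrightarrow>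
     P \<in> topspace (Euclidean_space n) \<and> (\<forall>j<k. Q j \<in> topspace (Euclidean_space n)) \<and>
     (\<forall>j<k. euclid_dist n P (Q j) = sqrt ((c j)\<^sup>2)) \<and>
     (\<forall>j<k. \<forall>j'<k. j \<noteq> j' \<longrightarrow> euclid_dist n (Q j) (Q j') = sqrt ((c j)\<^sup>2 + (c j')\<^sup>2))"

text \<open>
  The step lengths are chosen for \<open>M\<close> alone, before the dimension, because the coloring argument supplies
  corners with arbitrary prescribed legs in all large dimensions.
\<close>
definition corner_embeddable :: "nat \<Rightarrow> 'a::euclidean_space set \<Rightarrow> bool" where
  "corner_embeddable k M \<longleftrightarrow> (\<exists>c. \<forall>n P Q. orthogonal_corner n k c P Q \<longrightarrow>
     (\<exists>S \<subseteq> insert P (Q ` {..<k}). isometric_copy n M S))"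

lemma euclid_dist_self [simp]: "euclid_dist n P P = 0"
  by (simp add: euclid_dist_def L2_set_def)

lemma euclid_dist_commute: "euclid_dist n P Q = euclid_dist n Q P"
  by (simp add: euclid_dist_def L2_set_def power2_commute)

lemma isometric_copy_triple:
  assumes d: "a \<noteq> b" "b \<noteq> c" "a \<noteq> c"
    and P: "{P, Q, S} \<subseteq> topspace (Euclidean_space n)"
    and e: "euclid_dist n P Q = dist a b" "euclid_dist n Q S = dist b c" "euclid_dist n P S = dist a c"
  shows "isometric_copy n {a, b, c} {P, Q, S}"
proof -
  define f where "f = (\<lambda>z. if z = a then P else if z = b then Q else S)"
  have f: "f a = P" "f b = Q" "f c = S" using d by (auto simp: f_def)
  have iso: "\<forall>x\<in>{a, b, c}. \<forall>y\<in>{a, b, c}. euclid_dist n (f x) (f y) = dist x y"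
    using e by (auto simp: f euclid_dist_commute[of n Q P] euclid_dist_commute[of n S] dist_commute)
  have "inj_on f {a, b, c}"
  proof (rule inj_onI)
    fix x y assume xy: "x \<in> {a, b, c}" "y \<in> {a, b, c}" "f x = f y"
    have "dist x y = euclid_dist n (f x) (f y)" using iso xy(1,2) by metis
    thus "x = y" using xy(3) by simp
  qed
  hence "bij_betw f {a, b, c} {P, Q, S}" by (auto simp: bij_betw_def f)
  thus ?thesis using iso P unfolding isometric_copy_def by blast
qed

lemma dist_square: "(dist a b)\<^sup>2 = (a - b) \<bullet> (a - b)"
  by (simp add: dist_norm power2_norm_eq_inner)

lemma angle_arg_bounds:
  fixes u v :: "'a::euclidean_space"
  shows "-1 \<le> (u \<bullet> v) / (norm u * norm v)" "(u \<bullet> v) / (norm u * norm v) \<le> 1"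
  using Cauchy_Schwarz_ineq2[of u v]
  by (cases "norm u * norm v = 0"; auto simp: divide_simps abs_le_iff split: if_splits; smt (verit))+

text \<open>
  The apex of a corner with two legs is the vertex with the right angle.
\<close>
lemma right_triangle_corner_embeddable:
  fixes R :: "'a::euclidean_space set"
  assumes "right_triangle R"
  shows "corner_embeddable 2 R"
proof -
  obtain a b c where R: "R = {a, b, c}" "\<not> collinear {a, b, c}" "angle a b c = pi / 2"
    using assms unfolding right_triangle_def by blast
  have d: "a \<noteq> b" "b \<noteq> c" "a \<noteq> c" using R(2) by (auto simp: collinear_2 insert_commute)
  have "cos (angle a b c) = 0" unfolding R(3) by simp
  hence "((a - b) \<bullet> (c - b)) / (norm (a - b) * norm (c - b)) = 0"
    unfolding angle_def using angle_arg_bounds[of "a - b" "c - b"] by (simp add: cos_arccos)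
  hence orth: "(a - b) \<bullet> (c - b) = 0" using d by simp
  define l where "l = (\<lambda>j::nat. if j = 0 then dist b a else dist b c)"
  have "(dist a c)\<^sup>2 = (dist b a)\<^sup>2 + (dist b c)\<^sup>2"
    using orth by (simp add: dist_square inner_diff_left inner_diff_right inner_commute algebra_simps)
  hence ac: "dist a c = sqrt ((dist b a)\<^sup>2 + (dist b c)\<^sup>2)" by (metis real_sqrt_unique zero_le_dist)
  show ?thesis unfolding corner_embeddable_def
  proof (intro exI[of _ l] allI impI)
    fix n :: nat and P :: "nat \<Rightarrow> real" and Q :: "nat \<Rightarrow> nat \<Rightarrow> real"
    assume "orthogonal_corner n 2 l P Q"
    hence H: "P \<in> topspace (Euclidean_space n)" "\<forall>j<2. Q j \<in> topspace (Euclidean_space n)"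
       "\<forall>j<2. euclid_dist n P (Q j) = sqrt ((l j)\<^sup>2)"
       "\<forall>j<2. \<forall>j'<2. j \<noteq> j' \<longrightarrow> euclid_dist n (Q j) (Q j') = sqrt ((l j)\<^sup>2 + (l j')\<^sup>2)"
      unfolding orthogonal_corner_def by blast+
    have "isometric_copy n {a, b, c} {Q 0, P, Q 1}"
    proof (rule isometric_copy_triple[OF d])
      show "{Q 0, P, Q 1} \<subseteq> topspace (Euclidean_space n)" using H by auto
      show "euclid_dist n (Q 0) P = dist a b" using H(3)[rule_format, of 0] 
        by (simp add: l_def euclid_dist_commute[of n "Q 0"] dist_commute)
      show "euclid_dist n P (Q 1) = dist b c" using H(3)[rule_format, of 1] by (simp add: l_def)
      show "euclid_dist n (Q 0) (Q 1) = dist a c" using H(4)[rule_format, of 0 1] ac by (simp add: l_def)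
    qed
    moreover have "{Q 0, P, Q 1} \<subseteq> insert P (Q ` {..<2})" by auto
    ultimately show "\<exists>S\<subseteq>insert P (Q ` {..<2}). isometric_copy n R S" unfolding R(1) by blast
  qed
qed

lemma acute_inner_pos:
  fixes a b c :: "'a::euclidean_space"
  assumes "b \<noteq> a" "c \<noteq> a" "angle b a c < pi / 2"
  shows "(b - a) \<bullet> (c - a) > 0"
proof -
  let ?t = "((b - a) \<bullet> (c - a)) / (norm (b - a) * norm (c - a))"
  have t: "-1 \<le> ?t" "?t \<le> 1" by (rule angle_arg_bounds)+
  have "?t > 0"
  proof (rule ccontr)
    assume "\<not> ?t > 0"
    hence "arccos 0 \<le> arccos ?t" using t by (intro arccos_le_arccos) auto
    thus False using assms(3) by (simp add: angle_def)
  qed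
  have N: "norm (b - a) * norm (c - a) > 0" using assms by simp
  have pos: "t > 0" if "t / N > 0" "N > 0" for t N :: real
    using that by (simp add: zero_less_divide_iff)
  show ?thesis by (rule pos[OF \<open>?t > 0\<close> N])
qed

text \<open>
  An acute triangle is spanned by the three end points of a corner with three legs. The squared
  leg at the vertex \<open>a\<close> is the inner product \<open>(b - a) \<bullet> (c - a)\<close>, which is positive because the angle is acute, and the
  inner products at two vertices add up to the squared length of the side between them.
\<close>
lemma acute_triangle_corner_embeddable:
  fixes A :: "'a::euclidean_space set"
  assumes "acute_triangle A"
  shows "corner_embeddable 3 A"
proof -
  obtain a b c where A: "A = {a, b, c}" "\<not> collinear {a, b, c}" 
    "angle b a c < pi / 2" "angle a b c < pi / 2" "angle a c b < pi / 2"
    using assms unfolding acute_triangle_def by blast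
  have d: "a \<noteq> b" "b \<noteq> c" "a \<noteq> c" using A(2) by (auto simp: collinear_2 insert_commute)
  have pos: "(b - a) \<bullet> (c - a) > 0" "(a - b) \<bullet> (c - b) > 0" "(a - c) \<bullet> (b - c) > 0"
    using A d by (auto intro!: acute_inner_pos)
  define l where "l = (\<lambda>j::nat. if j = 0 then sqrt ((b - a) \<bullet> (c - a)) else if j = 1 then sqrt ((a - b) \<bullet> (c - b)) else sqrt ((a - c) \<bullet> (b - c)))"
  have l2: "(l 0)\<^sup>2 = (b - a) \<bullet> (c - a)" "(l 1)\<^sup>2 = (a - b) \<bullet> (c - b)" "(l 2)\<^sup>2 = (a - c) \<bullet> (b - c)"
    using pos by (simp_all add: l_def)
  have "(dist a b)\<^sup>2 = (l 0)\<^sup>2 + (l 1)\<^sup>2" "(dist b c)\<^sup>2 = (l 1)\<^sup>2 + (l 2)\<^sup>2" "(dist a c)\<^sup>2 = (l 0)\<^sup>2 + (l 2)\<^sup>2"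
    unfolding l2 by (simp_all add: dist_square inner_diff_left inner_diff_right inner_commute algebra_simps)
  hence D: "dist a b = sqrt ((l 0)\<^sup>2 + (l 1)\<^sup>2)" "dist b c = sqrt ((l 1)\<^sup>2 + (l 2)\<^sup>2)" "dist a c = sqrt ((l 0)\<^sup>2 + (l 2)\<^sup>2)"
    by (metis real_sqrt_unique zero_le_dist)+
  show ?thesis unfolding corner_embeddable_def
  proof (intro exI[of _ l] allI impI)
    fix n :: nat and P :: "nat \<Rightarrow> real" and Q :: "nat \<Rightarrow> nat \<Rightarrow> real"
    assume "orthogonal_corner n 3 l P Q"
    hence H: "\<forall>j<3. Q j \<in> topspace (Euclidean_space n)"
       "\<forall>j<3. \<forall>j'<3. j \<noteq> j' \<longrightarrow> euclid_dist n (Q j) (Q j') = sqrt ((l j)\<^sup>2 + (l j')\<^sup>2)"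
      unfolding orthogonal_corner_def by blast+
    have "isometric_copy n {a, b, c} {Q 0, Q 1, Q 2}"
    proof (rule isometric_copy_triple[OF d])
      show "{Q 0, Q 1, Q 2} \<subseteq> topspace (Euclidean_space n)" using H by auto
      show "euclid_dist n (Q 0) (Q 1) = dist a b" using H(2)[rule_format, of 0 1] D by simp
      show "euclid_dist n (Q 1) (Q 2) = dist b c" using H(2)[rule_format, of 1 2] D by simp
      show "euclid_dist n (Q 0) (Q 2) = dist a c" using H(2)[rule_format, of 0 2] D by simp
    qed
    moreover have "{Q 0, Q 1, Q 2} \<subseteq> insert P (Q ` {..<3})" by auto
    ultimately show "\<exists>S\<subseteq>insert P (Q ` {..<3}). isometric_copy n A S" unfolding A(1) by blast
  qed
qed

section \<open>The value of psi2\<close>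

lemma psi2_denominator_pos: "(1 + x\<^sup>2 + x ^ 4 :: real) > 0"
  by (intro add_pos_nonneg) auto

text \<open>
  The upper bound is chosen so that \<open>2 * 10000 / 8067\<close> has a short reciprocal; completing the square
  in \<open>x\<^sup>2\<close> and then in \<open>x\<close> leaves a small positive remainder. The numbers \<open>282 / 10000\<close> and \<open>464 / 1000\<close>
  approximate the parameters of the double zero at the maximum near \<open>x = 0.464\<close>.
\<close>
lemma psi2_ratio_le:
  fixes x :: real
  assumes "x \<le> 1"
  shows "psi2_ratio x \<le> 10000 / 8067"
proof -
  have "10000 * (1 + x\<^sup>2 + x ^ 4) - 8067 * (1 + x + x ^ 3) =
          10000 * (x\<^sup>2 - 8067 / 20000 * x - 141 / 5000)\<^sup>2 + 357483511 / 40000 * (x - 58 / 125)\<^sup>2 +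
          1089931 / 1250000 * (1 - x) + 4406687 / 78125000"
    by (simp add: power2_eq_square power4_eq_xxxx power3_eq_cube field_simps)
  also have "\<dots> \<ge> 0"
    using assms by (intro add_nonneg_nonneg mult_nonneg_nonneg) auto
  finally have "8067 * (1 + x + x ^ 3) \<le> 10000 * (1 + x\<^sup>2 + x ^ 4)" by simp
  thus ?thesis using psi2_denominator_pos[of x] by (simp add: divide_le_eq)
qed

lemma bdd_above_psi2: "bdd_above ((\<lambda>x::real. psi2_ratio x) ` {0..1})"
  using psi2_ratio_le by (intro bdd_aboveI[of _ "10000 / 8067"]) auto

lemma psi2_le: "psi2 \<le> 10000 / 8067"
  unfolding psi2_def by (intro cSUP_least psi2_ratio_le) auto

lemma psi2_ge: "psi2 \<ge> 1.23956"
proof -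
  have "(1.23956::real) \<le> (1 + 0.464 + 0.464 ^ 3) / (1 + 0.464\<^sup>2 + 0.464 ^ 4)"
    by (simp add: power2_eq_square power4_eq_xxxx power3_eq_cube)
  also have "\<dots> \<le> psi2"
    unfolding psi2_def using bdd_above_psi2 by (intro cSUP_upper2[where x = "0.464"]) auto
  finally show ?thesis .
qed

lemma powr_inverse_bounds:
  fixes a b y :: real
  assumes "0 < a" "0 < b" "a ^ k \<le> y" "y < b ^ k" "k > 0"
  shows "a \<le> y powr (1 / real k)" "y powr (1 / real k) < b"
proof -
  have r: "(c ^ k) powr (1 / real k) = c" if "c > 0" for c :: real
    using that assms(5) by (simp add: powr_powr flip: powr_realpow)
  have y: "y > 0" using assms by (meson less_le_trans zero_less_power)
  show "a \<le> y powr (1 / real k)"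
    using powr_mono2[of "1 / real k" "a ^ k" y] assms r[of a] by simp
  show "y powr (1 / real k) < b"
    using powr_less_mono2[of "1 / real k" y "b ^ k"] assms y r[of b] by simp
qed

lemma psi2_powr_bounds:
  "1.1133 \<le> psi2 powr (1 / 2)" "psi2 powr (1 / 2) < 1.1134"
  "1.0742 \<le> psi2 powr (1 / 3)" "psi2 powr (1 / 3) < 1.0743"
proof -
  have "(1.1133::real)\<^sup>2 \<le> psi2" "psi2 < 1.1134\<^sup>2" "(1.0742::real) ^ 3 \<le> psi2" "psi2 < 1.0743 ^ 3"
    using psi2_le psi2_ge by (simp_all add: power2_eq_square power3_eq_cube)
  thus "1.1133 \<le> psi2 powr (1 / 2)" "psi2 powr (1 / 2) < 1.1134"
    "1.0742 \<le> psi2 powr (1 / 3)" "psi2 powr (1 / 3) < 1.0743"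
    using powr_inverse_bounds[of "1.1133" "1.1134" 2 psi2] powr_inverse_bounds[of "1.0742" "1.0743" 3 psi2] by simp_all
qed

section \<open>Growth of the chromatic number\<close>

text \<open>
  The largest color class in the \<open>k\<close>-fold product of \<open>V\<close> has density at least \<open>1 / r\<close>. If this exceeded
  \<open>k \<alpha> / card V\<close>, the class would contain a corner and hence a monochromatic copy of \<open>M\<close>. The legs are
  scaled independently in the blocks, so the single distance \<open>sqrt (2 p)\<close> in \<open>V\<close> suffices for all of them.
\<close>
lemma colorable_lower_bound:
  assumes M: "corner_embeddable k M" and k: "k > 0" and n: "k * m \<le> n" and col: "colorable n M r"
    and V: "finite V" "V \<noteq> {}" and p: "p > 0" and \<alpha>: "\<alpha> \<ge> 0"
    and indep: "\<And>S. S \<subseteq> V \<Longrightarrow> (\<forall>v\<in>S. \<forall>w\<in>S. sq_dist m v w \<noteq> 2 * int p) \<Longrightarrow> real (card S) \<le> \<alpha>"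
  shows "real (card V) \<le> real r * real k * \<alpha>"
proof -
  obtain col where col: "\<And>x. x \<in> topspace (Euclidean_space n) \<Longrightarrow> col x < r"
    "\<And>S. isometric_copy n M S \<Longrightarrow> \<not> monochromatic col S"
    using col unfolding colorable_def by blast
  obtain c where c: "\<And>n P Q. orthogonal_corner n k c P Q \<Longrightarrow> \<exists>S \<subseteq> insert P (Q ` {..<k}). isometric_copy n M S"
    using M unfolding corner_embeddable_def by blast
  define s where "s = (\<lambda>j. c j / sqrt (2 * real p))"
  define pt where "pt = block_point m k s"
  have pt: "pt x \<in> topspace (Euclidean_space n)" for x
    unfolding pt_def by (rule block_point_in_Euclidean_space[OF n])
  define X where "X = {..<k} \<rightarrow>\<^sub>E V"
  define C where "C = (\<lambda>t. {x\<in>X. col (pt x) = t})"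
  have small: "real (card (C t)) \<le> real k * \<alpha> * real (card V) ^ (k - 1)" for t
  proof (rule ccontr)
    assume "\<not> ?thesis"
    hence big: "real (card (C t)) > real k * \<alpha> * real (card V) ^ (k - 1)" by simp
    have sub: "C t \<subseteq> {..<k} \<rightarrow>\<^sub>E V" by (auto simp: C_def X_def)
    have "\<exists>x y. x \<in> C t \<and> (\<forall>j<k. (\<Sum>i<m. (x j i - y j i)\<^sup>2) = 2 * int p \<and> x(j := y j) \<in> C t)"
    proof (rule corner_exists[where adj = "\<lambda>v w. sq_dist m v w = 2 * int p", OF V(1) sub _ big])
      fix S assume "S \<subseteq> V" "\<forall>v\<in>S. \<forall>w\<in>S. sq_dist m v w \<noteq> 2 * int p"
      thus "real (card S) \<le> \<alpha>" by (rule indep)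
    next
      fix x y assume "x \<in> C t" "\<And>j. j < k \<Longrightarrow> (\<Sum>i<m. (x j i - y j i)\<^sup>2) = 2 * int p \<and> x(j := y j) \<in> C t"
      thus ?thesis by (intro exI[of _ x] exI[of _ y]) simp
    qed
    then obtain x y where xy: "x \<in> C t" 
      "\<And>j. j < k \<Longrightarrow> (\<Sum>i<m. (x j i - y j i)\<^sup>2) = 2 * int p \<and> x(j := y j) \<in> C t"
      by auto
    define Q where "Q = (\<lambda>j. pt (x(j := y j)))"
    have "orthogonal_corner n k c (pt x) Q"
      unfolding orthogonal_corner_def
    proof (intro conjI allI impI)
      have s: "s j = c j / sqrt (2 * real p)" for j by (simp add: s_def)
      have y: "(\<Sum>i<m. (x j i - y j i)\<^sup>2) = 2 * int p" if "j < k" for j using xy(2)[OF that] by simp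
      show "euclid_dist n (pt x) (Q j) = sqrt ((c j)\<^sup>2)" if "j < k" for j
        unfolding pt_def Q_def by (rule euclid_dist_corner(1)[OF n p s y that])
      show "euclid_dist n (Q j) (Q j') = sqrt ((c j)\<^sup>2 + (c j')\<^sup>2)" if "j < k" "j' < k" "j \<noteq> j'" for j j'
        unfolding pt_def Q_def by (rule euclid_dist_corner(2)[OF n p s y that])
    qed (simp_all add: pt Q_def)
    from c[OF this] have "\<exists>S \<subseteq> insert (pt x) (Q ` {..<k}). isometric_copy n M S" .
    then obtain S where S: "S \<subseteq> insert (pt x) (Q ` {..<k})" "isometric_copy n M S" by blast
    have "col z = t" if "z \<in> S" for z
      using that S(1) xy by (auto simp: C_def Q_def)
    hence "monochromatic col S" unfolding monochromatic_def by blast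
    thus False using col(2) S(2) by blast
  qed
  have "card V ^ k = card X" by (simp add: X_def card_funcsetE)
  also have "X = (\<Union>t<r. C t)" using col(1) pt by (auto simp: C_def)
  also have "card \<dots> \<le> (\<Sum>t<r. card (C t))" by (intro card_UN_le) auto
  finally have "real (card V ^ k) \<le> real (\<Sum>t<r. card (C t))" by (simp only: of_nat_le_iff)
  hence "real (card V) ^ k \<le> (\<Sum>t<r. real (card (C t)))" by simp
  also have "\<dots> \<le> (\<Sum>t<r. real k * \<alpha> * real (card V) ^ (k - 1))" by (intro sum_mono small)
  also have "\<dots> = (real r * real k * \<alpha>) * real (card V) ^ (k - 1)" by simp
  finally have "real (card V) * real (card V) ^ (k - 1) \<le> (real r * real k * \<alpha>) * real (card V) ^ (k - 1)"
    using k by (simp add: power_eq_if)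
  moreover have "real (card V) ^ (k - 1) > 0" using V by (simp add: card_gt_0_iff)
  ultimately show ?thesis by (rule mult_right_le_imp_le)
qed

lemma eventually_colorable_lower_bound:
  fixes x eps :: real
  assumes M: "corner_embeddable k M" and k: "k > 0"
    and x: "0 < x" "x \<le> 1" and eps: "0 < eps" "eps \<le> 1"
  defines "B \<equiv> psi2_ratio x * x powr (2 * eps)"
  shows "\<forall>\<^sub>F m in sequentially. \<forall>n r. k * m \<le> n \<longrightarrow> colorable n M r \<longrightarrow> B ^ m \<le> real r * real k * real (m + 1) ^ 2"
  using avoiding_family_exists[OF x eps, folded B_def]
proof eventually_elim
  case (elim m)
  then obtain V p where V: "V \<subseteq> sign_cube m" "V \<noteq> {}" "p > 0"
    "\<And>S. S \<subseteq> V \<Longrightarrow> (\<forall>v\<in>S. \<forall>w\<in>S. sq_dist m v w \<noteq> 2 * int p) \<Longrightarrow> real (card S) * B ^ m \<le> real (m + 1) ^ 2 * real (card V)"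
    by blast
  have B: "B > 0" unfolding B_def using x by (auto intro!: mult_pos_pos divide_pos_pos add_pos_pos)
  have fin: "finite V" using V(1) finite_sign_cube finite_subset by blast
  show ?case
  proof (intro allI impI)
    fix n r assume n: "k * m \<le> n" "colorable n M r"
    let ?\<alpha> = "real (m + 1) ^ 2 * real (card V) / B ^ m"
    have "real (card V) \<le> real r * real k * ?\<alpha>"
    proof (rule colorable_lower_bound[OF M k n fin V(2,3)])
      show "?\<alpha> \<ge> 0" using B by auto
      fix S assume "S \<subseteq> V" "\<forall>v\<in>S. \<forall>w\<in>S. sq_dist m v w \<noteq> 2 * int p"
      from V(4)[OF this] show "real (card S) \<le> ?\<alpha>" using B by (simp add: pos_le_divide_eq)
    qed
    hence "B ^ m * real (card V) \<le> (real r * real k * real (m + 1) ^ 2) * real (card V)"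
      using B by (simp add: field_simps)
    moreover have "real (card V) > 0" using fin V(2) by (simp add: card_gt_0_iff)
    ultimately show "B ^ m \<le> real r * real k * real (m + 1) ^ 2"
      by (rule mult_right_le_imp_le)
  qed
qed

text \<open>
  Comparing with \<open>max t 1\<close> excludes \<open>x = 0\<close>, where the quotient is \<open>1\<close>; the factor
  \<open>x powr (2 eps)\<close> tends to \<open>1\<close> for \<open>eps \<rightarrow> 0\<close>.
\<close>
lemma less_psi2_witness:
  assumes "0 \<le> t" "t < psi2"
  obtains x eps :: real where "0 < x" "x \<le> 1" "0 < eps" "eps \<le> 1" 
    "t < psi2_ratio x * x powr (2 * eps)"
proof -
  have "max t 1 < psi2" using assms psi2_ge by simp
  then obtain x :: real where x: "x \<in> {0..1}" "max t 1 < psi2_ratio x"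
    unfolding psi2_def using bdd_above_psi2 by (subst (asm) less_cSUP_iff) auto
  have x0: "x > 0" using x by (cases "x = 0") auto
  have "((\<lambda>e. psi2_ratio x * x powr (2 * e)) \<longlongrightarrow> 
          psi2_ratio x * x powr (2 * 0)) (at_right 0)"
    using x0 by (intro tendsto_intros) auto
  moreover have "t < psi2_ratio x * x powr (2 * 0)"
    using x x0 by simp
  ultimately have "\<forall>\<^sub>F e in at_right 0. t < psi2_ratio x * x powr (2 * e)"
    by (rule order_tendstoD(1))
  moreover have "\<forall>\<^sub>F e in at_right 0. e \<in> {0<..<(1::real)}"
    by (rule eventually_at_right_real) simp
  ultimately have "\<forall>\<^sub>F e in at_right 0. t < psi2_ratio x * x powr (2 * e) \<and> e \<in> {0<..<(1::real)}"
    by eventually_elim simp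
  then obtain e where "t < psi2_ratio x * x powr (2 * e)" "e \<in> {0<..<(1::real)}"
    using eventually_happens'[OF trivial_limit_at_right_real] by blast
  with x x0 show ?thesis by (intro that[of x e]) auto
qed

text \<open>
  Use blocks of dimension \<open>m = n div k\<close>. Rounding \<open>n\<close> down to \<open>k * m\<close> costs a constant factor, and the
  polynomial factor \<open>(m + 1)\<^sup>2\<close> is absorbed because \<open>b ^ k\<close> is smaller than the growth rate \<open>B\<close>.
\<close>
lemma eventually_power_le_colors:
  assumes M: "corner_embeddable k M" and k: "k > 0" and b: "0 < b" "b < psi2 powr (1 / real k)"
  shows "\<forall>\<^sub>F n in sequentially. \<forall>r. colorable n M r \<longrightarrow> b ^ n \<le> real r"
proof -
  have "b ^ k < (psi2 powr (1 / real k)) ^ k" using b k by (intro power_strict_mono) auto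
  also have "\<dots> = psi2" using k psi2_ge by (simp add: powr_powr flip: powr_realpow)
  finally obtain x eps :: real where x: "0 < x" "x \<le> 1" "0 < eps" "eps \<le> 1" 
    "b ^ k < psi2_ratio x * x powr (2 * eps)"
    using less_psi2_witness[of "b ^ k"] b by auto
  define B where "B = psi2_ratio x * x powr (2 * eps)"
  define q where "q = b ^ k / B"
  have Bb: "b ^ k < B" using x by (simp add: B_def)
  have B: "B > 0" using Bb b by (meson less_trans zero_less_power)
  have q: "0 < q" "q < 1" using Bb B b by (auto simp: q_def)
  define K where "K = max 1 b ^ k * real k"
  have K: "K \<ge> 0" using k by (auto simp: K_def)
  have "(\<lambda>m. K * (real (m + 1) ^ 2 * q ^ m)) \<longlonglongrightarrow> K * 0"
  proof (intro tendsto_intros)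
    show "(\<lambda>m. real (m + 1) ^ 2 * q ^ m) \<longlonglongrightarrow> 0" using q by real_asymp
  qed
  hence "\<forall>\<^sub>F m in sequentially. K * (real (m + 1) ^ 2 * q ^ m) < 1"
    by (intro order_tendstoD(2)) auto
  hence "\<forall>\<^sub>F m in sequentially. \<forall>n r. k * m \<le> n \<longrightarrow> n < k * m + k \<longrightarrow> colorable n M r \<longrightarrow> b ^ n \<le> real r"
    using eventually_colorable_lower_bound[OF M k x(1-4), folded B_def]
  proof eventually_elim
    case (elim m)
    show ?case
    proof (intro allI impI)
      fix n r assume n: "k * m \<le> n" "n < k * m + k" "colorable n M r"
      have Bm: "B ^ m \<le> real r * real k * real (m + 1) ^ 2" using elim n by blast
      have "b ^ n = (b ^ k) ^ m * b ^ (n - k * m)"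
        using n(1) by (simp flip: power_mult power_add)
      also have "b ^ (n - k * m) \<le> max 1 b ^ (n - k * m)" using b by (intro power_mono) auto
      also have "\<dots> \<le> max 1 b ^ k" using n(2) by (intro power_increasing) auto
      finally have "b ^ n \<le> (b ^ k) ^ m * max 1 b ^ k" using b by simp
      also have "(b ^ k) ^ m = q ^ m * B ^ m" using B by (simp add: q_def flip: power_mult_distrib)
      also have "q ^ m * B ^ m * max 1 b ^ k \<le> q ^ m * (real r * real k * real (m + 1) ^ 2) * max 1 b ^ k"
        using Bm q by (intro mult_right_mono mult_left_mono) auto
      also have "\<dots> = real r * (K * (real (m + 1) ^ 2 * q ^ m))" by (simp add: K_def)
      also have "\<dots> \<le> real r * 1" using elim by (intro mult_left_mono) auto
      finally show "b ^ n \<le> real r" by simp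
    qed
  qed
  moreover have "filterlim (\<lambda>n. n div k) sequentially sequentially"
    unfolding filterlim_at_top
  proof
    fix Z
    show "\<forall>\<^sub>F n in sequentially. Z \<le> n div k"
      using eventually_ge_at_top[of "Z * k"]
      by eventually_elim (use k in \<open>simp add: less_eq_div_iff_mult_less_eq\<close>)
  qed
  ultimately have "\<forall>\<^sub>F n in sequentially. \<forall>n' r. k * (n div k) \<le> n' \<longrightarrow> n' < k * (n div k) + k \<longrightarrow> colorable n' M r \<longrightarrow> b ^ n' \<le> real r"
    by (rule eventually_compose_filterlim)
  thus ?thesis
  proof eventually_elim
    case (elim n)
    have "k * (n div k) \<le> n" "n < k * (n div k) + k"
      using k mod_less_divisor[of k n] mult_div_mod_eq[of k n] by linarith+
    thus ?case using elim by blast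
  qed
qed

text \<open>
  The error term is \<open>e n \<le> 0\<close>, and \<open>- e n\<close> is the amount by which the \<open>n\<close>-th root of the least number of colors falls short of
  \<open>psi2 powr (1 / k)\<close>; it is set to \<open>0\<close> where there is no shortfall or no finite coloring.
\<close>
lemma chromatic_number_lower_bound:
  assumes M: "corner_embeddable k M" and k: "k > 0"
  shows "\<exists>e :: nat \<Rightarrow> real. e \<in> o(\<lambda>_. 1) \<and>
            (\<forall>\<^sub>F n in sequentially. ereal_of_enat (chromatic_number n M) \<ge> ereal ((psi2 powr (1 / real k) + e n) ^ n))"
proof -
  define L where "L = psi2 powr (1 / real k)"
  have L: "L > 0" using psi2_ge by (simp add: L_def)
  define R where "R = (\<lambda>n. LEAST r. colorable n M r)"
  define e where "e = (\<lambda>n. if (\<exists>r. colorable n M r) then min 0 (root n (real (R n)) - L) else 0)"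
  have R: "colorable n M (R n)" "R n \<le> r" if "colorable n M r" for n r
    unfolding R_def using that by (auto intro: LeastI Least_le)
  have "e \<longlonglongrightarrow> 0"
  proof (rule tendstoI)
    fix \<eta> :: real assume \<eta>: "\<eta> > 0"
    define b where "b = max (L - \<eta> / 2) (L / 2)"
    have b: "0 < b" "b < L" "b \<ge> L - \<eta> / 2" using L \<eta> by (auto simp: b_def)
    have "\<forall>\<^sub>F n in sequentially. \<forall>r. colorable n M r \<longrightarrow> b ^ n \<le> real r"
      using eventually_power_le_colors[OF M k] b unfolding L_def by blast
    thus "\<forall>\<^sub>F n in sequentially. dist (e n) 0 < \<eta>"
      using eventually_gt_at_top[of 0]
    proof eventually_elim
      case (elim n)
      have "e n \<le> 0" by (auto simp: e_def)
      moreover have "e n \<ge> - (\<eta> / 2)"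
      proof (cases "\<exists>r. colorable n M r")
        case True
        hence "b ^ n \<le> real (R n)" using R elim by blast
        hence "root n (b ^ n) \<le> root n (real (R n))" using elim by (intro real_root_le_mono) auto
        hence "b \<le> root n (real (R n))" using elim b by (simp add: real_root_power_cancel)
        thus ?thesis using b \<eta> True by (auto simp: e_def)
      qed (use \<eta> in \<open>auto simp: e_def\<close>)
      ultimately show ?case using \<eta> by (simp add: dist_real_def)
    qed
  qed
  hence "e \<in> o(\<lambda>_. 1)" by (intro smalloI_tendsto) auto
  moreover have "\<forall>\<^sub>F n in sequentially. ereal_of_enat (chromatic_number n M) \<ge> ereal ((L + e n) ^ n)"
    using eventually_gt_at_top[of 0]
  proof eventually_elim
    case (elim n)
    show ?case
    proof (cases "\<exists>r. colorable n M r")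
      case True
      have "L + e n = min L (root n (real (R n)))" using True by (auto simp: e_def)
      hence "0 \<le> L + e n" "L + e n \<le> root n (real (R n))" using L by (auto simp: real_root_ge_zero)
      hence "(L + e n) ^ n \<le> root n (real (R n)) ^ n" by (intro power_mono)
      also have "\<dots> = real (R n)" using elim by simp
      finally have "ereal ((L + e n) ^ n) \<le> ereal_of_enat (enat (R n))" by simp
      also have "enat (R n) \<le> chromatic_number n M"
        unfolding chromatic_number_def using R by (intro INF_greatest) auto
      hence "ereal_of_enat (enat (R n)) \<le> ereal_of_enat (chromatic_number n M)"
        by (simp only: ereal_of_enat_le_iff)
      finally show ?thesis .
    next
      case False
      hence "{r. colorable n M r} = {}" by blast
      hence "chromatic_number n M = \<infinity>" by (simp add: chromatic_number_def top_enat_def)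
      thus ?thesis by simp
    qed
  qed
  ultimately show ?thesis unfolding L_def by blast
qed

theorem theorem4:
  fixes R :: "'a::euclidean_space set" and A :: "'b::euclidean_space set"
  assumes "right_triangle R" and "acute_triangle A"
  shows "(\<exists>e :: nat \<Rightarrow> real. e \<in> o(\<lambda>_. 1) \<and>
            (\<forall>\<^sub>F n in sequentially.
               ereal_of_enat (chromatic_number n R) \<ge> ereal ((psi2 powr (1 / 2) + e n) ^ n))) \<and>
         (\<exists>e :: nat \<Rightarrow> real. e \<in> o(\<lambda>_. 1) \<and>
            (\<forall>\<^sub>F n in sequentially.
               ereal_of_enat (chromatic_number n A) \<ge> ereal ((psi2 powr (1 / 3) + e n) ^ n))) \<and>
         1.239 \<le> psi2 \<and> psi2 < 1.240 \<and>
         1.1133 \<le> psi2 powr (1 / 2) \<and> psi2 powr (1 / 2) < 1.1134 \<and>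
         1.0742 \<le> psi2 powr (1 / 3) \<and> psi2 powr (1 / 3) < 1.0743"
proof (intro conjI psi2_powr_bounds)
  show "\<exists>e :: nat \<Rightarrow> real. e \<in> o(\<lambda>_. 1) \<and>
          (\<forall>\<^sub>F n in sequentially. ereal_of_enat (chromatic_number n R) \<ge> ereal ((psi2 powr (1 / 2) + e n) ^ n))"
    using chromatic_number_lower_bound[OF right_triangle_corner_embeddable[OF assms(1)]] by simp
  show "\<exists>e :: nat \<Rightarrow> real. e \<in> o(\<lambda>_. 1) \<and>
          (\<forall>\<^sub>F n in sequentially. ereal_of_enat (chromatic_number n A) \<ge> ereal ((psi2 powr (1 / 3) + e n) ^ n))"
    using chromatic_number_lower_bound[OF acute_triangle_corner_embeddable[OF assms(2)]] by simp
  show "1.239 \<le> psi2" "psi2 < 1.240" using psi2_ge psi2_le by simp_all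
qed

end
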